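(* Let $n\ge 2$, $m=[n/2]$, $G=SL(n,\mathbb{C})$, $B\subset G$ the Borel subgroup of upper triangular matrices, and $Z=G/B$. Let $D\subset Z$ be an open $SL(n,\mathbb{R})$-orbit with base cycle $C_0$, and let $\mathcal{S}_{C_0}$ be the set of Schubert varieties $S_w\subset Z$ with $\dim S_w+\dim C_0=\dim Z$ and $S_w\cap C_0\neq\emptyset$. A Schubert variety $S_w$, $w\in\Sigma_n$, belongs to $\mathcal{S}_{C_0}$ if and only if $w$ satisfies the double box contraction condition. In particular, in this case $w$ satisfies the spacing condition and $|w|=m^2$ if $n=2m$, and $|w|=m^2+m$ if $n=2m+1$.
   Context: $Z=G/B$ is the manifold of complete flags $0\subset V_1\subset\dots\subset V_n=\mathbb{C}^n$, $\dim V_i=i$. Let $G_0=SL(n,\mathbb{R})$ and $K_0=SO(n,\mathbb{R})$. An open $G_0$-orbit $D$ in $Z$ contains a unique $K_0$-orbit $C_0$ which is a complex submanifold of $D$, called the base cycle. Let $b(v,w)=v^t w$ be the standard complex bilinear form on $\mathbb{C}^n$ and $\perp$ the orthogonal complement with respect to $b$; $C_0$ is the set of isotropic flags in $D$, i.e. flags in $D$ with $V_i\subset V_i^\perp$ and $V_{n-i}=V_i^\perp$ for all $1\le i\le m$. If $n=2m+1$ there is exactly one open orbit; if $n=2m$ there are two (positively and negatively oriented flags), interchanged by an orientation-reversing map, and $D$ is a fixed one of them. Schubert varieties: for $w\in\Sigma_n$ (permutations of $\{1,\dots,n\}$, one-line notation $w(1)\dots w(n)$), $V_w$ is the coordinate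 flag with $i$-th subspace $\langle e_{w(1)},\dots,e_{w(i)}\rangle$, $\mathcal{O}_w=B\cdot V_w$, $S_w=\overline{\mathcal{O}_w}$. The length $|w|$ is the number of inversions of $w$, and $\dim S_w=|w|$. Write $w=k_1\dots k_m\,l_*\,l_m\dots l_1$, with $l_*$ removed if $n=2m$. Spacing condition: $l_i<k_i$ for all $1\le i\le m$. Double box contraction condition: $w$ is constructed by the following immediate predecessor algorithm: choose $k_1$ and $l_1:=k_1-1$ from the ordered set $\{1,\dots,n\}$; if all numbers up to $k_i,l_i$ have been chosen, choose $k_{i+1}$ and $l_{i+1}$ from the ordered set $\{1,\dots,n\}\setminus\{k_1,l_1,\dots,k_i,l_i\}$ such that $l_{i+1}$ is the immediate left neighbour (immediate predecessor) of $k_{i+1}$ in this ordered set. This is done for $i=1,\dots,m$; if $n=2m+1$, $l_*$ is the remaining number. *)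

theory Defs
  imports "HOL-Analysis.Analysis" "HOL-Combinatorics.Permutations"
begin

text \<open>
  Throughout, \<open>n = CARD('n)\<close>, and the linear order of the index type \<open>'n\<close> plays the role of the
  order of \<open>{1..n}\<close>.  Permutations of \<open>{1..n}\<close> are functions on \<^typ>\<open>nat\<close>, so that one-line
  notation is directly available.
\<close>

section \<open>Permutations\<close>

definition inversions :: "nat \<Rightarrow> (nat \<Rightarrow> nat) \<Rightarrow> nat" where
  "inversions n w = card {(i, j). 1 \<le> i \<and> i < j \<and> j \<le> n \<and> w j < w i}"

text \<open>
  The one-line notation \<open>w(1) \<dots> w(n)\<close> is read as \<open>k\<^sub>1 \<dots> k\<^sub>m l\<^sub>* l\<^sub>m \<dots> l\<^sub>1\<close> with \<open>m = n div 2\<close>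
  (without \<open>l\<^sub>*\<close> if \<open>n\<close> is even), so \<open>k\<^sub>i = w i\<close> and \<open>l\<^sub>i = w (n + 1 - i)\<close>.
\<close>

definition entry_k :: "(nat \<Rightarrow> nat) \<Rightarrow> nat \<Rightarrow> nat" where
  "entry_k w i = w i"

definition entry_l :: "nat \<Rightarrow> (nat \<Rightarrow> nat) \<Rightarrow> nat \<Rightarrow> nat" where
  "entry_l n w i = w (n + 1 - i)"

definition spacing :: "nat \<Rightarrow> (nat \<Rightarrow> nat) \<Rightarrow> bool" where
  "spacing n w \<longleftrightarrow> (\<forall>i\<in>{1..n div 2}. entry_l n w i < entry_k w i)"

definition immediate_predecessor :: "nat set \<Rightarrow> nat \<Rightarrow> nat \<Rightarrow> bool" where
  "immediate_predecessor R a b \<longleftrightarrow> a \<in> R \<and> b \<in> R \<and> a < b \<and> \<not> (\<exists>c\<in>R. a < c \<and> c < b)"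

text \<open>The numbers still available in step \<open>i\<close> of the immediate predecessor algorithm.\<close>

definition remaining :: "nat \<Rightarrow> (nat \<Rightarrow> nat) \<Rightarrow> nat \<Rightarrow> nat set" where
  "remaining n w i = {1..n} - (entry_k w ` {1..<i} \<union> entry_l n w ` {1..<i})"

definition double_box_contraction :: "nat \<Rightarrow> (nat \<Rightarrow> nat) \<Rightarrow> bool" where
  "double_box_contraction n w \<longleftrightarrow>
     (\<forall>i\<in>{1..n div 2}. immediate_predecessor (remaining n w i) (entry_l n w i) (entry_k w i))"

section \<open>Groups\<close>

type_synonym 'n cmat = "((complex, 'n) vec, 'n) vec"

definition SL_C :: "'n::finite cmat set" where
  "SL_C = {g. det g = 1}"

definition Borel :: "'n::{finite,linorder} cmat set" where
  "Borel = {g \<in> SL_C. \<forall>i j. j < i \<longrightarrow> g $ i $ j = 0}"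

definition SL_R :: "'n::finite cmat set" where
  "SL_R = {g \<in> SL_C. \<forall>i j. g $ i $ j \<in> \<real>}"

definition SO_R :: "'n::finite cmat set" where
  "SO_R = {g \<in> SL_R. transpose g ** g = mat 1}"

section \<open>The flag manifold\<close>

text \<open>
  A flag is an indexed family of subspaces; beyond the index \<open>n\<close> it is constantly the whole
  space, so that equality of families is equality of flags.
\<close>

type_synonym 'n flag = "nat \<Rightarrow> (complex^'n) set"

definition flags :: "'n::finite flag set" where
  "flags = {F. (\<forall>i\<le>CARD('n). vec.subspace (F i) \<and> vec.dim (F i) = i) \<and>
               (\<forall>i<CARD('n). F i \<subseteq> F (Suc i)) \<and>
               (\<forall>i>CARD('n). F i = UNIV)}"

definition act :: "'n::finite cmat \<Rightarrow> 'n flag \<Rightarrow> 'n flag" where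
  "act g F = (\<lambda>i. (\<lambda>v. g *v v) ` F i)"

definition orbit :: "'n::finite cmat set \<Rightarrow> 'n flag \<Rightarrow> 'n flag set" where
  "orbit H F = (\<lambda>g. act g F) ` H"

text \<open>The standard basis vector \<open>e\<^sub>k\<close>, for \<open>1 \<le> k \<le> n\<close>.\<close>

definition basis_vec :: "nat \<Rightarrow> complex^'n::{finite,linorder}" where
  "basis_vec k = axis (sorted_list_of_set (UNIV :: 'n set) ! (k - 1)) 1"

definition coordinate_flag :: "(nat \<Rightarrow> nat) \<Rightarrow> 'n::{finite,linorder} flag" where
  "coordinate_flag w = (\<lambda>i. vec.span (basis_vec ` w ` {1..min i CARD('n)}))"

text \<open>The flag fixed by \<^const>\<open>Borel\<close>, i.e. the base point of \<open>G/B\<close>.\<close>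

definition base_flag :: "'n::{finite,linorder} flag" where
  "base_flag = coordinate_flag id"

text \<open>The quotient topology with respect to \<open>G \<rightarrow> G/B\<close>, \<open>g \<mapsto> g \<cdot> base_flag\<close>.\<close>

definition flag_topology :: "'n::{finite,linorder} flag topology" where
  "flag_topology = topology (\<lambda>U. U \<subseteq> flags \<and>
     openin (top_of_set SL_C) {g \<in> SL_C. act g base_flag \<in> U})"

lemma openin_flag_topology:
  "openin flag_topology U \<longleftrightarrow>
     U \<subseteq> flags \<and> openin (top_of_set SL_C) {g \<in> SL_C. act g base_flag \<in> U}"
proof -
  have "istopology (\<lambda>U :: 'a flag set. U \<subseteq> flags \<and>
     openin (top_of_set SL_C) {g \<in> SL_C. act g base_flag \<in> U})"
    unfolding istopology_def
  proof (intro conjI allI impI; (elim conjE)?)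
    fix S T :: "'a flag set"
    assume "S \<subseteq> flags"
    then show "S \<inter> T \<subseteq> flags" by blast
  next
    fix S T :: "'a flag set"
    assume "openin (top_of_set SL_C) {g \<in> SL_C. act g base_flag \<in> S}"
      and "openin (top_of_set SL_C) {g \<in> SL_C. act g base_flag \<in> T}"
    then have "openin (top_of_set SL_C)
        ({g \<in> SL_C. act g base_flag \<in> S} \<inter> {g \<in> SL_C. act g base_flag \<in> T})"
      by (rule openin_Int)
    then show "openin (top_of_set SL_C) {g \<in> SL_C. act g base_flag \<in> S \<inter> T}"
      by (rule back_subst) blast
  next
    fix K :: "'a flag set set"
    assume "\<forall>U\<in>K. U \<subseteq> flags \<and> openin (top_of_set SL_C) {g \<in> SL_C. act g base_flag \<in> U}"
    then show "\<Union>K \<subseteq> flags" by blast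
  next
    fix K :: "'a flag set set"
    assume "\<forall>U\<in>K. U \<subseteq> flags \<and> openin (top_of_set SL_C) {g \<in> SL_C. act g base_flag \<in> U}"
    then have "openin (top_of_set SL_C) (\<Union>U\<in>K. {g \<in> SL_C. act g base_flag \<in> U})"
      by (intro openin_Union) auto
    then show "openin (top_of_set SL_C) {g \<in> SL_C. act g base_flag \<in> \<Union>K}"
      by (rule back_subst) blast
  qed
  then show ?thesis
    unfolding flag_topology_def by (simp add: topology_inverse')
qed

section \<open>Complex submanifolds and dimension\<close>

definition cscale :: "complex \<Rightarrow> 'n::finite cmat \<Rightarrow> 'n cmat" where
  "cscale c X = (\<chi> i j. c * X $ i $ j)"

definition complex_subspace :: "'n::finite cmat set \<Rightarrow> bool" where
  "complex_subspace L \<longleftrightarrow> subspace L \<and> (\<forall>c. \<forall>X\<in>L. cscale c X \<in> L)"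

text \<open>The coordinate space of the charts of \<open>G/B\<close>, a copy of \<open>\<complex>\<^sup>N\<close> with \<open>N = n (n - 1) / 2\<close>.\<close>

definition strictly_lower :: "'n::{finite,linorder} cmat set" where
  "strictly_lower = {X. \<forall>i j. i \<le> j \<longrightarrow> X $ i $ j = 0}"

text \<open>
  For each \<open>g \<in> G\<close> this is (the inverse of) the holomorphic chart of \<open>G/B\<close> centred at
  \<open>g \<cdot> base_flag\<close> that is given by the translated big cell; these charts form an atlas.
\<close>

definition chart_at :: "'n::{finite,linorder} cmat \<Rightarrow> 'n cmat \<Rightarrow> 'n flag" where
  "chart_at g X = act (g ** (mat 1 + X)) base_flag"

text \<open>Holomorphy of maps defined on relatively open subsets of a complex subspace.\<close>

definition holomorphic_map :: "('n::finite cmat \<Rightarrow> 'n cmat) \<Rightarrow> 'n cmat set \<Rightarrow> bool" where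
  "holomorphic_map h S \<longleftrightarrow>
     (\<forall>X\<in>S. \<exists>h'. (h has_derivative h') (at X within S) \<and> (\<forall>c Y. h' (cscale c Y) = cscale c (h' Y)))"

definition biholomorphic ::
  "('n::{finite,linorder} cmat \<Rightarrow> 'n cmat) \<Rightarrow> 'n cmat set \<Rightarrow> 'n cmat set \<Rightarrow> bool"
  where
  "biholomorphic h S S' \<longleftrightarrow>
     openin (top_of_set strictly_lower) S \<and> openin (top_of_set strictly_lower) S' \<and>
     bij_betw h S S' \<and> holomorphic_map h S \<and> holomorphic_map (inv_into S h) S'"

text \<open>
  Complex submanifolds of complex dimension \<open>d\<close>: near each of its points, \<open>A\<close> becomes a
  \<open>d\<close>-dimensional complex linear slice in suitable holomorphic coordinates.  Here \<^const>\<open>dim\<close> is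
  the real dimension, whence the factor 2.
\<close>

definition complex_submanifold :: "nat \<Rightarrow> 'n::{finite,linorder} flag set \<Rightarrow> bool" where
  "complex_submanifold d A \<longleftrightarrow>
     A \<subseteq> flags \<and>
     (\<forall>p\<in>A. \<exists>g\<in>SL_C. act g base_flag = p \<and>
        (\<exists>S S' h L. 0 \<in> S \<and> biholomorphic h S S' \<and>
           complex_subspace L \<and> L \<subseteq> strictly_lower \<and> dim L = 2 * d \<and>
           h ` {X \<in> S. chart_at g X \<in> A} = S' \<inter> L))"

text \<open>
  The complex dimension of a nonempty, possibly singular, subset: the largest dimension of a
  nonempty complex submanifold contained in it.  For an analytic subset this is the maximal
  dimension at its regular points.  The maximum is over a finite set containing 0.
\<close>

definition cdim :: "'n::{finite,linorder} flag set \<Rightarrow> nat" where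
  "cdim A = Max {d. \<exists>Y. Y \<noteq> {} \<and> Y \<subseteq> A \<and> complex_submanifold d Y}"

section \<open>Open orbits, base cycles and Schubert varieties\<close>

definition open_orbit :: "'n::{finite,linorder} flag set \<Rightarrow> bool" where
  "open_orbit D \<longleftrightarrow> (\<exists>F\<in>flags. D = orbit SL_R F) \<and> openin flag_topology D"

definition base_cycle :: "'n::{finite,linorder} flag set \<Rightarrow> 'n flag set \<Rightarrow> bool" where
  "base_cycle D C \<longleftrightarrow> (\<exists>F\<in>D. C = orbit SO_R F) \<and> (\<exists>d. complex_submanifold d C)"

definition schubert_cell :: "(nat \<Rightarrow> nat) \<Rightarrow> 'n::{finite,linorder} flag set" where
  "schubert_cell w = orbit Borel (coordinate_flag w)"

definition schubert_variety :: "(nat \<Rightarrow> nat) \<Rightarrow> 'n::{finite,linorder} flag set" where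
  "schubert_variety w = flag_topology closure_of schubert_cell w"

definition schubert_duals :: "'n::{finite,linorder} flag set \<Rightarrow> 'n flag set set" where
  "schubert_duals C = {S. (\<exists>w. w permutes {1..CARD('n)} \<and> S = schubert_variety w) \<and>
     cdim S + cdim C = cdim (flags :: 'n flag set) \<and> S \<inter> C \<noteq> {}}"

end

theory Submission
  imports Defs "HOL-Computational_Algebra.Polynomial"
begin

text \<open>
Write \<open>V\<^sub>k\<close> for the members of a flag, \<open>b\<close> for the bilinear form and \<open>E\<^sub>q\<close> for the span of the first
\<open>q\<close> standard basis vectors.  Two dimensions have to be computed, that of a Schubert variety and that of the
base cycle; both follow from first-order calculations with curves of matrices.  It then remains to
compare the length of a permutation with the codimension of the base cycle.

\<^bold>\<open>Dimensions.\<close>  For a set \<open>A\<close> of flags let \<open>tangent A p\<close> consist of the matrices \<open>X\<close> such that some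
curve of matrices \<open>C\<close> with velocity \<open>X C(0)\<close> at 0 represents flags in \<open>A\<close> and starts in \<open>p\<close>.  For a
complex submanifold of dimension \<open>d\<close> this is a complex subspace of real dimension \<open>2 d + dim upper\<close>
(\<open>tangent_submanifold\<close>), so that dimensions can be compared by comparing curves.  A Schubert cell is
linear in suitable charts and has the length of its permutation as dimension.  Its closure satisfies
the usual rank inequalities; they imply that the other cells in the closure are shorter
(\<open>rank_count_mono_inversions\<close>), and a submanifold of the closure is near a point in its longest
cell contained in that cell (\<open>cdim_schubert_variety\<close>).

\<^bold>\<open>The base cycle.\<close>  In an open orbit of the real group \<open>V\<^sub>k\<close> and the conjugate of \<open>V\<^bsub>n-k\<^esub>\<close> are
complementary: whether the determinant of their joint frame is zero depends only on the orbit, and a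
polynomial that is not identically zero does not vanish on an open set (\<open>open_orbit_mix_nz\<close>).  The
absolute value of this determinant, divided by the norms of
the Pluecker vectors of \<open>V\<^sub>k\<close> and \<open>V\<^bsub>n-k\<^esub>\<close>, is constant on an orbit of the real orthogonal group.  If
the orbit is a complex submanifold, then with a real skew matrix \<open>X\<close> also \<open>\<i> X\<close> is tangent, and the
quotient has derivative 0 in the direction \<open>\<i> X\<close>.  For one particular direction this derivative is a
sum of squares of values of \<open>b\<close>, which thus vanish: the flags of the base cycle are isotropic
(\<open>base_cycle_isotropic_core\<close>).  Such flags have unitary frames on which conjugation reverses the order
of the columns.  These frames give the tangent space and the dimension of the cycle, and they show
that real orthogonal matrices connect any two isotropic flags.

\<^bold>\<open>The estimate.\<close>  If a Schubert variety meets an open orbit, so does its cell, and complementarity of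
\<open>V\<^sub>r\<close> and the conjugate of \<open>V\<^bsub>n-r\<^esub>\<close> inside \<open>E\<^sub>q\<close> says that at most as many of \<open>k\<^sub>1, \<dots>, k\<^sub>r\<close> as of
\<open>l\<^sub>1, \<dots>, l\<^sub>r\<close> are \<open>\<le> q\<close> (\<open>open_orbit_dominance\<close>).  Under this condition the length is at least
\<open>m (n - m)\<close>, with equality exactly for double box contractions
(\<open>minimal_length_double_box_contraction\<close>), and \<open>m (n - m)\<close> is the codimension of the base cycle.
Conversely, if \<open>l\<^sub>i < k\<^sub>i\<close> for all \<open>i\<close>, then the flag spanned by the vectors \<open>e\<^bsub>k\<^sub>i\<^esub> \<plusminus> \<i> e\<^bsub>l\<^sub>i\<^esub>\<close>, the
middle vector if there is one, and the conjugate vectors in reverse order is isotropic and lies in the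
cell.  One of the choices of signs gives the right orientation (\<open>spacing_cell_meets_base_cycle\<close>).
\<close>

section \<open>Positions in the index type\<close>

text \<open>
The position of an index in the order of the index type, counted from 1.  It translates between the
index type and the natural numbers that permutations act on; \<open>idx\<close> is its inverse.
\<close>

definition pos :: "'n::{finite,linorder} \<Rightarrow> nat" where
  "pos i = card {j. j \<le> i}"

definition idx :: "nat \<Rightarrow> 'n::{finite,linorder}" where
  "idx k = sorted_list_of_set (UNIV :: 'n set) ! (k - 1)"

lemma pos_ge_1: "1 \<le> pos (i::'n::{finite,linorder})"
proof -
  have "{j. j \<le> i} \<noteq> {}" by auto
  then have "card {j. j \<le> i} > 0" by (simp add: card_gt_0_iff)
  then show ?thesis by (simp add: pos_def)
qed

lemma pos_le: "pos (i::'n::{finite,linorder}) \<le> CARD('n)"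
  unfolding pos_def by (rule card_mono) auto

lemma pos_less_iff [simp]: "pos i < pos j \<longleftrightarrow> i < j"
proof -
  have "pos i < pos j" if "i < j" for i j :: 'a
    unfolding pos_def
  proof (rule psubset_card_mono)
    show "{k. k \<le> i} \<subset> {k. k \<le> j}"
      using that by (auto simp: psubset_eq set_eq_iff intro!: exI[of _ j])
  qed simp
  then show ?thesis
    by (metis less_imp_not_less linorder_neqE)
qed

lemma pos_le_iff [simp]: "pos i \<le> pos j \<longleftrightarrow> i \<le> j"
  by (meson leD leI pos_less_iff)

lemma pos_eq_iff [simp]: "pos i = pos j \<longleftrightarrow> i = j"
  by (metis order_antisym_conv order_refl pos_le_iff)

lemma inj_pos: "inj_on pos A"
  by (simp add: inj_on_def)

lemma pos_idx [simp]:
  assumes "1 \<le> k" "k \<le> CARD('n)"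
  shows "pos (idx k :: 'n::{finite,linorder}) = k"
proof -
  define xs where "xs = sorted_list_of_set (UNIV :: 'n set)"
  have len: "length xs = CARD('n)" and ss: "sorted_wrt (<) xs" and set: "set xs = UNIV"
    by (auto simp: xs_def)
  have lt: "xs ! a < xs ! b" if "a < b" "b < length xs" for a b
    using ss that by (simp add: sorted_wrt_iff_nth_less)
  have le: "xs ! a \<le> xs ! b \<longleftrightarrow> a \<le> b" if "a < length xs" "b < length xs" for a b
    using lt that by (metis leD leI le_less nat_neq_iff)
  have "{j. j \<le> xs ! (k - 1)} = (!) xs ` {..k - 1}"
  proof -
    have "j \<in> (!) xs ` {..k - 1}" if "j \<le> xs ! (k - 1)" for j
    proof -
      obtain a where "a < length xs" "j = xs ! a"
        using set by (metis UNIV_I in_set_conv_nth)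
      then show ?thesis using that le[of a "k - 1"] assms len by auto
    qed
    then show ?thesis using le assms len by auto
  qed
  moreover have "inj_on ((!) xs) {..k - 1}"
    using lt assms len by (intro inj_on_nth) (auto simp: xs_def)
  ultimately have "card {j. j \<le> xs ! (k - 1)} = card {..k - 1}"
    by (simp add: card_image)
  then show ?thesis using assms by (simp add: pos_def idx_def xs_def)
qed

lemma idx_pos [simp]: "idx (pos i) = i"
  using pos_ge_1 pos_le pos_idx[of "pos i"] by (metis pos_eq_iff)

lemma idx_eq_iff:
  assumes "k \<in> {1..CARD('n)}" "l \<in> {1..CARD('n)}"
  shows "(idx k :: 'n::{finite,linorder}) = idx l \<longleftrightarrow> k = l"
  using assms by (metis atLeastAtMost_iff pos_idx)

lemma basis_vec_idx: "basis_vec k = axis (idx k) 1"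
  by (simp add: basis_vec_def idx_def)

definition rev_index :: "'n::{finite,linorder} \<Rightarrow> 'n" where
  "rev_index i = idx (CARD('n) + 1 - pos i)"

lemma pos_rev: "pos (rev_index (i::'n::{finite,linorder})) = CARD('n) + 1 - pos i"
  using pos_ge_1[of i] pos_le[of i] by (simp add: rev_index_def)

lemma pos_rev_sum: "pos (rev_index (i::'n::{finite,linorder})) + pos i = CARD('n) + 1"
  using pos_ge_1[of i] pos_le[of i] by (simp add: pos_rev)

lemma rev_rev [simp]: "rev_index (rev_index i) = i"
proof -
  have "pos (rev_index (rev_index i)) = pos i"
    using pos_rev_sum[of i] pos_rev_sum[of "rev_index i"] by linarith
  then show ?thesis by simp
qed

lemma rev_less_iff [simp]: "rev_index i < rev_index j \<longleftrightarrow> j < i"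
proof -
  have "pos (rev_index i) < pos (rev_index j) \<longleftrightarrow> pos j < pos i"
    using pos_rev_sum[of i] pos_rev_sum[of j] by linarith
  then show ?thesis by simp
qed

lemma rev_eq_iff [simp]: "rev_index i = rev_index j \<longleftrightarrow> i = j"
  by (metis rev_rev)

section \<open>Flags and triangular matrices\<close>

definition upper :: "'n::{finite,linorder} cmat set" where
  "upper = {b. \<forall>i j. j < i \<longrightarrow> b $ i $ j = 0}"

definition prefix_space :: "nat \<Rightarrow> ((complex, 'n::{finite,linorder}) vec) set" where
  "prefix_space q = {v. \<forall>j. q < pos j \<longrightarrow> v $ j = 0}"

lemma span_axis_eq: "vec.span ((\<lambda>i. axis i (1::complex)) ` I) = {v::(complex, 'n::finite) vec. \<forall>j. j \<notin> I \<longrightarrow> v $ j = 0}"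
proof
  have "vec.subspace {v::(complex, 'n::finite) vec. \<forall>j. j \<notin> I \<longrightarrow> v $ j = 0}"
    by (auto simp: vec.subspace_def)
  then show "vec.span ((\<lambda>i. axis i (1::complex)) ` I) \<subseteq> {v::(complex, 'n) vec. \<forall>j. j \<notin> I \<longrightarrow> v $ j = 0}"
    by (intro vec.span_minimal) (auto simp: axis_def)
  show "{v::(complex, 'n) vec. \<forall>j. j \<notin> I \<longrightarrow> v $ j = 0} \<subseteq> vec.span ((\<lambda>i. axis i (1::complex)) ` I)"
  proof
    fix v :: "(complex, 'n) vec" assume v: "v \<in> {v. \<forall>j. j \<notin> I \<longrightarrow> v $ j = 0}"
    have "v = (\<Sum>i\<in>I. v $ i *s axis i 1)"
      using v by (auto simp: vec_eq_iff axis_def if_distrib[of "\<lambda>x. _ * x"] cong: if_cong)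
    also have "\<dots> \<in> vec.span ((\<lambda>i. axis i (1::complex)) ` I)"
      by (intro vec.span_sum vec.span_scale vec.span_base) auto
    finally show "v \<in> vec.span ((\<lambda>i. axis i (1::complex)) ` I)" .
  qed
qed

lemma coordinate_flag_eq:
  "coordinate_flag w p = {v::(complex, 'n::{finite,linorder}) vec. \<forall>j. j \<notin> idx ` w ` {1..min p CARD('n)} \<longrightarrow> v $ j = 0}"
proof -
  have "basis_vec ` w ` {1..min p CARD('n)} = (\<lambda>i. axis i (1::complex)) ` (idx ` w ` {1..min p CARD('n)} :: 'n set)"
    by (auto simp: basis_vec_idx image_iff)
  then show ?thesis
    unfolding coordinate_flag_def by (simp add: span_axis_eq)
qed

lemma idx_image_prefix: "(idx ` {1..min q CARD('n)} :: 'n::{finite,linorder} set) = {j. pos j \<le> q}"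
proof -
  have "j \<in> idx ` {1..min q CARD('n)}" if "pos j \<le> q" for j :: 'n
    using that pos_ge_1[of j] pos_le[of j] by (intro image_eqI[of _ _ "pos j"]) auto
  then show ?thesis by auto
qed

lemma base_flag_eq: "base_flag = (prefix_space :: nat \<Rightarrow> ((complex, 'n::{finite,linorder}) vec) set)"
  unfolding base_flag_def
  by (rule ext) (simp only: coordinate_flag_eq prefix_space_def idx_image_prefix not_le image_id id_apply mem_Collect_eq)

lemma subspace_prefix: "vec.subspace (prefix_space q)"
  by (auto simp: vec.subspace_def prefix_space_def)

lemma dim_coord: "vec.dim {v::(complex, 'n::finite) vec. \<forall>j. j \<notin> I \<longrightarrow> v $ j = 0} = card I"
  by (rule dim_substandard_cart)

lemma dim_prefix: "vec.dim (prefix_space q :: ((complex, 'n::{finite,linorder}) vec) set) = min q CARD('n)"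
proof -
  have "prefix_space q = {v::(complex, 'n) vec. \<forall>j. j \<notin> idx ` {1..min q CARD('n)} \<longrightarrow> v $ j = 0}"
    by (simp only: prefix_space_def idx_image_prefix not_le mem_Collect_eq)
  moreover have "card (idx ` {1..min q CARD('n)} :: 'n set) = min q CARD('n)"
    by (subst card_image) (auto simp: inj_on_def idx_eq_iff)
  ultimately show ?thesis using dim_coord[of "idx ` {1..min q CARD('n)} :: 'n set"] by simp
qed

lemma act_act: "act g (act h F) = act (g ** h) F"
  by (auto simp: act_def image_image matrix_vector_mul_assoc)

lemma act_one [simp]: "act (mat 1) F = F"
  by (simp add: act_def)

lemma det_inv_props:
  fixes g :: "'n::finite cmat"
  assumes "det g \<noteq> 0"
  shows "g ** matrix_inv g = mat 1" "matrix_inv g ** g = mat 1" "det (matrix_inv g) = inverse (det g)"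
proof -
  have inv: "invertible g" using assms invertible_det_nz by blast
  show 1: "g ** matrix_inv g = mat 1" and "matrix_inv g ** g = mat 1"
    using someI_ex[OF inv[unfolded invertible_def]] by (auto simp: matrix_inv_def)
  show "det (matrix_inv g) = inverse (det g)"
    using assms arg_cong[OF 1, of det] by (simp add: det_mul det_I field_simps)
qed

lemma act_flags:
  assumes "det g \<noteq> 0" "F \<in> flags"
  shows "act g (F :: 'n::finite flag) \<in> flags"
proof -
  have inj: "inj ((*v) g)"
    using assms(1) inj_matrix_vector_mult invertible_det_nz by blast
  have surj: "surj ((*v) g)"
    by (rule surjI[of _ "(*v) (matrix_inv g)"]) (simp add: matrix_vector_mul_assoc det_inv_props assms)
  have "vec.subspace ((*v) g ` F i)" if "i \<le> CARD('n)" for i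
    using assms(2) that by (auto simp: flags_def intro!: vec.linear_subspace_image)
  moreover have "vec.dim ((*v) g ` F i) = i" if "i \<le> CARD('n)" for i
    using assms(2) that inj by (subst vec.dim_image_eq) (auto simp: flags_def intro: inj_on_subset)
  ultimately show ?thesis
    using assms(2) surj by (simp add: flags_def act_def image_mono)
qed

lemma prefix_space_flags: "prefix_space \<in> (flags :: 'n::{finite,linorder} flag set)"
proof -
  have "prefix_space i = (UNIV :: ((complex, 'n) vec) set)" if "i > CARD('n)" for i
    using that pos_le[where 'n='n] by (auto simp: prefix_space_def) (meson leD le_trans less_imp_le)
  then show ?thesis
    by (auto simp: flags_def subspace_prefix dim_prefix) (auto simp: prefix_space_def)
qed

lemma coordinate_flag_flags:
  assumes "w permutes {1..CARD('n)}"
  shows "coordinate_flag w \<in> (flags :: 'n::{finite,linorder} flag set)"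
proof -
  have w: "w ` {1..CARD('n)} = {1..CARD('n)}"
    using assms permutes_image by blast
  have sub: "vec.subspace (coordinate_flag w i :: ((complex, 'n) vec) set)" for i
    by (simp add: coordinate_flag_def)
  have dim: "vec.dim (coordinate_flag w i :: ((complex, 'n) vec) set) = i" if "i \<le> CARD('n)" for i
  proof -
    have wi: "w ` {1..i} \<subseteq> {1..CARD('n)}" using w that by (metis atLeastatMost_subset_iff image_mono order_refl)
    have "inj_on (idx :: nat \<Rightarrow> 'n) (w ` {1..i})"
      using wi idx_eq_iff by (meson inj_onI subsetD)
    moreover have "inj_on w {1..i}"
      using assms permutes_inj_on by blast
    ultimately have "card (idx ` w ` {1..i} :: 'n set) = i"
      by (simp add: card_image)
    then show ?thesis using that dim_coord[of "idx ` w ` {1..i} :: 'n set"]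
      by (simp add: coordinate_flag_eq)
  qed
  have top: "coordinate_flag w i = (UNIV :: ((complex, 'n) vec) set)" if "i > CARD('n)" for i
  proof -
    have "idx ` w ` {1..min i CARD('n)} = (UNIV :: 'n set)"
      using that w idx_image_prefix[of "CARD('n)", where 'n='n] pos_le by (auto simp del: One_nat_def)
    then show ?thesis by (simp add: coordinate_flag_eq)
  qed
  have mono: "coordinate_flag w i \<subseteq> (coordinate_flag w (Suc i) :: ((complex, 'n) vec) set)" for i
    unfolding coordinate_flag_def by (intro vec.span_mono image_mono) auto
  show ?thesis using sub dim top mono by (auto simp: flags_def)
qed

lemma upper_mono: "b \<in> upper \<Longrightarrow> v \<in> prefix_space q \<Longrightarrow> b *v v \<in> prefix_space q"
  unfolding upper_def prefix_space_def matrix_vector_mult_def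
  by simp (smt (verit) le_less_trans linorder_not_le mult_eq_0_iff pos_less_iff sum.neutral leI less_le_trans)

text \<open>
The stabilizer of the base flag.  It also gives a short proof that inverses of upper triangular
matrices are upper triangular (\<open>upper_inv\<close>).
\<close>

lemma act_upper_base:
  assumes "det (b :: 'n::{finite,linorder} cmat) \<noteq> 0"
  shows "act b (base_flag :: 'n flag) = base_flag \<longleftrightarrow> b \<in> upper"
proof
  assume "b \<in> upper"
  then have sub: "(*v) b ` prefix_space q \<subseteq> prefix_space q" for q
    using upper_mono by blast
  have inj: "inj ((*v) b)"
    using assms(1) inj_matrix_vector_mult invertible_det_nz by blast
  have "(*v) b ` prefix_space q = prefix_space q" for q
  proof (rule vec.subspace_dim_equal[OF _ _ sub])
    show "vec.dim (prefix_space q :: ((complex, 'n) vec) set) \<le> vec.dim ((*v) b ` prefix_space q)"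
      using inj by (subst vec.dim_image_eq) (auto intro: inj_on_subset)
  qed (auto intro!: vec.linear_subspace_image simp: subspace_prefix)
  then show "act b base_flag = base_flag"
    by (auto simp: act_def base_flag_eq)
next
  assume act: "act b base_flag = base_flag"
  show "b \<in> upper"
    unfolding upper_def
  proof (intro CollectI allI impI)
    fix i j :: 'n assume "j < i"
    have "(axis j 1 :: (complex, 'n) vec) \<in> prefix_space (pos j)"
      by (auto simp: prefix_space_def axis_def)
    then have "b *v axis j 1 \<in> prefix_space (pos j)"
      using fun_cong[OF act, of "pos j"] by (auto simp: act_def base_flag_eq)
    then show "b $ i $ j = 0"
      using \<open>j < i\<close> by (auto simp: prefix_space_def matrix_vector_mult_def axis_def if_distrib[of "\<lambda>x. _ * x"] cong: if_cong)
  qed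
qed

lemma upper_mult: "a \<in> upper \<Longrightarrow> b \<in> upper \<Longrightarrow> a ** b \<in> upper"
  unfolding upper_def matrix_matrix_mult_def
  by simp (smt (verit) le_less_trans linorder_not_le mult_eq_0_iff sum.neutral leI less_le_trans)

lemma upper_one: "mat 1 \<in> upper"
  by (auto simp: upper_def mat_def)

lemma upper_inv:
  assumes "b \<in> upper" "det b \<noteq> 0"
  shows "matrix_inv b \<in> upper"
proof -
  have "act (matrix_inv b) base_flag = base_flag"
    by (metis act_act act_one act_upper_base assms det_inv_props(2))
  then show ?thesis
    using assms act_upper_base by (metis det_inv_props(3) inverse_nonzero_iff_nonzero)
qed

lemma act_base_eq_iff:
  assumes "det g \<noteq> 0" "det h \<noteq> 0"
  shows "act g base_flag = act h base_flag \<longleftrightarrow> matrix_inv g ** h \<in> upper"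
proof -
  have "act g base_flag = act h base_flag \<longleftrightarrow> act (matrix_inv g ** h) base_flag = base_flag"
    by (metis act_act act_one assms(1) det_inv_props(1,2))
  moreover have "det (matrix_inv g ** h) \<noteq> 0"
    using assms by (simp add: det_mul det_inv_props)
  ultimately show ?thesis using act_upper_base by blast
qed

lemma act_base_eqE:
  assumes "det g \<noteq> 0" "det h \<noteq> 0" "act g base_flag = act h base_flag"
  obtains b where "b \<in> upper" "det b \<noteq> 0" "h = g ** b"
proof
  show "matrix_inv g ** h \<in> upper" using act_base_eq_iff assms by blast
  show "det (matrix_inv g ** h) \<noteq> 0" using assms by (simp add: det_mul det_inv_props)
  show "h = g ** (matrix_inv g ** h)" using assms by (simp add: matrix_mul_assoc det_inv_props)
qed

lemma act_mult_upper:
  assumes "b \<in> upper" "det b \<noteq> 0"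
  shows "act (g ** b) base_flag = act g base_flag"
  by (metis act_act act_upper_base assms)

text \<open>
The matrix may be triangular with respect to any ranking of the indices: a permutation that
contributes to the determinant does not decrease the rank anywhere and preserves the sum of all ranks,
so it is the identity.  The ranking is free because the determinants below are triangular for orders
that differ from the order of the index type.
\<close>

lemma det_triangular:
  fixes A :: "'a::comm_ring_1^'n^'n" and r :: "'n::finite \<Rightarrow> nat"
  assumes inj: "inj r" and tri: "\<And>i j. A $ i $ j \<noteq> 0 \<Longrightarrow> r i \<le> r j"
  shows "det A = (\<Prod>i\<in>UNIV. A $ i $ i)"
proof -
  have "of_int (sign p) * (\<Prod>i\<in>UNIV. A $ i $ p i) = 0"
    if p: "p permutes (UNIV :: 'n set)" and "p \<noteq> id" for p
  proof (cases "\<forall>i. A $ i $ p i \<noteq> 0")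
    case True
    then have le: "r i \<le> r (p i)" for i using tri by blast
    have "(\<Sum>i\<in>UNIV. r (p i)) = (\<Sum>i\<in>UNIV. r i)"
      using sum.permute[OF p, of r] by (simp add: o_def)
    then have "r i = r (p i)" for i
      using sum_strict_mono_ex1[of UNIV r "\<lambda>i. r (p i)"] le
      by (metis UNIV_I finite_class.finite_UNIV le_neq_implies_less less_irrefl)
    then have "p = id" using inj by (auto simp: inj_def)
    then show ?thesis using that by simp
  next
    case False
    then have "(\<Prod>i\<in>UNIV. A $ i $ p i) = 0" by (intro prod_zero) auto
    then show ?thesis by simp
  qed
  then have "det A = (\<Sum>p\<in>{id}. of_int (sign p) * (\<Prod>i\<in>UNIV. A $ i $ p i))"
    unfolding det_def by (intro sum.mono_neutral_right) (auto simp: permutes_id)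
  then show ?thesis by (simp add: sign_id)
qed

lemma det_upper: "b \<in> upper \<Longrightarrow> det b = (\<Prod>i\<in>UNIV. b $ i $ i)"
  by (rule det_triangular[of pos]) (auto simp: inj_def upper_def not_less[symmetric])

lemma upper_diag_nz: "b \<in> upper \<Longrightarrow> det b \<noteq> 0 \<longleftrightarrow> (\<forall>i. b $ i $ i \<noteq> 0)"
  by (simp add: det_upper prod_zero_iff)

lemma unit_lower_det:
  assumes "X \<in> strictly_lower"
  shows "det (mat 1 + X) = 1"
proof -
  have "det (mat 1 + X) = (\<Prod>i\<in>UNIV. (mat 1 + X) $ i $ i)"
  proof (rule det_triangular)
    show "inj (\<lambda>i::'a. CARD('a) - pos i)"
    proof (rule injI)
      fix x y :: 'a assume "CARD('a) - pos x = CARD('a) - pos y"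
      then show "x = y" using pos_le[of x] pos_le[of y] by (metis diff_diff_cancel pos_eq_iff)
    qed
    show "CARD('a) - pos i \<le> CARD('a) - pos j" if "(mat 1 + X) $ i $ j \<noteq> 0" for i j
    proof -
      have "j \<le> i" using that assms by (cases "i < j") (auto simp: strictly_lower_def mat_def split: if_splits)
      then show ?thesis by (simp add: diff_le_mono2)
    qed
  qed
  also have "\<dots> = 1" using assms by (simp add: strictly_lower_def mat_def)
  finally show ?thesis .
qed

lemma LU_unique:
  assumes X: "X \<in> strictly_lower" and X': "X' \<in> strictly_lower" and b: "b \<in> upper"
    and eq: "(mat 1 + X) ** b = mat 1 + X'"
  shows "b = mat 1 \<and> X = X'"
proof -
  have row: "b $ i $ j = (mat 1 :: 'a cmat) $ i $ j" for i j
  proof (induction "pos i" arbitrary: i j rule: less_induct)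
    case less
    show ?case
    proof (cases "j < i")
      case True
      then show ?thesis using b by (auto simp: upper_def mat_def)
    next
      case False
      have "((mat 1 + X) ** b) $ i $ j = (\<Sum>k\<in>UNIV. (if i = k then 1 else 0) * b $ k $ j) + (\<Sum>k\<in>UNIV. X $ i $ k * b $ k $ j)"
        by (simp add: matrix_matrix_mult_def mat_def distrib_right sum.distrib)
      moreover have "(\<Sum>k\<in>UNIV. X $ i $ k * b $ k $ j) = 0"
      proof (rule sum.neutral, rule ballI)
        fix k show "X $ i $ k * b $ k $ j = 0"
        proof (cases "k < i")
          case True
          then have "b $ k $ j = (mat 1 :: 'a cmat) $ k $ j" using less by simp
          then show ?thesis using True False by (auto simp: mat_def)
        next
          case False
          then show ?thesis using X by (simp add: strictly_lower_def)
        qed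
      qed
      moreover have "(\<Sum>k\<in>UNIV. (if i = k then 1 else 0) * b $ k $ j) = b $ i $ j"
        by (simp add: if_distrib[of "\<lambda>x. x * _"] cong: if_cong)
      ultimately have "b $ i $ j = (mat 1 + X') $ i $ j" using eq by simp
      then show ?thesis using X' False by (simp add: strictly_lower_def)
    qed
  qed
  then have "b = mat 1" by (simp add: vec_eq_iff)
  with eq show ?thesis by simp
qed

section \<open>LU coordinates\<close>

definition low :: "'n::{finite,linorder} cmat \<Rightarrow> 'n cmat" where
  "low Z = (\<chi> i j. if j < i then Z $ i $ j else 0)"

definition up :: "'n::{finite,linorder} cmat \<Rightarrow> 'n cmat" where
  "up Z = (\<chi> i j. if j < i then 0 else Z $ i $ j)"

lemma low_plus_up: "low Z + up Z = Z"
  by (simp add: low_def up_def vec_eq_iff)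

lemma low_lower [simp]: "low Z \<in> strictly_lower"
  by (auto simp: low_def strictly_lower_def)

lemma up_upper [simp]: "up Z \<in> upper"
  by (auto simp: up_def upper_def)

lemma one_up_upper [simp]: "mat 1 + up Z \<in> upper"
  by (auto simp: up_def upper_def mat_def)

lemma linear_low: "linear low"
  by (rule linearI) (auto simp: low_def vec_eq_iff)

lemma linear_up: "linear up"
  by (rule linearI) (auto simp: up_def vec_eq_iff)

lemma low_0 [simp]: "low 0 = 0" and up_0 [simp]: "up 0 = 0"
  using linear_0[OF linear_low] linear_0[OF linear_up] by auto

lemma right_cancel:
  assumes "det (c :: 'n::finite cmat) \<noteq> 0" "a ** c = b ** c" shows "a = b"
proof -
  have "a ** c ** matrix_inv c = b ** c ** matrix_inv c" using assms(2) by simp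
  then show ?thesis by (simp add: matrix_mul_assoc[symmetric] det_inv_props assms(1))
qed

lemma low_id: "X \<in> strictly_lower \<Longrightarrow> low X = X"
  by (auto simp: low_def strictly_lower_def vec_eq_iff)

lemma low_upper: "b \<in> upper \<Longrightarrow> low b = 0"
  by (auto simp: low_def upper_def vec_eq_iff)

lemma subspace_strictly_lower: "subspace (strictly_lower :: 'n::{finite,linorder} cmat set)"
  by (auto simp: subspace_def strictly_lower_def)

lemma subspace_upper: "subspace (upper :: 'n::{finite,linorder} cmat set)"
  by (auto simp: subspace_def upper_def)

text \<open>
Makes the product rules for limits and derivatives available for the matrix product.
\<close>

lemma bounded_bilinear_mm: "bounded_bilinear ((**) :: 'n::finite cmat \<Rightarrow> 'n cmat \<Rightarrow> 'n cmat)"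
proof -
  have "bilinear ((**) :: 'n cmat \<Rightarrow> 'n cmat \<Rightarrow> 'n cmat)"
    unfolding bilinear_def
    by (intro conjI allI linearI)
       (auto simp: matrix_matrix_mult_def vec_eq_iff sum.distrib algebra_simps scaleR_sum_right)
  then show ?thesis by (simp add: bilinear_conv_bounded_bilinear)
qed

interpretation mm: bounded_bilinear "(**) :: 'n::finite cmat \<Rightarrow> 'n cmat \<Rightarrow> 'n cmat"
  by (rule bounded_bilinear_mm)

lemma continuous_det: "continuous_on UNIV (det :: 'n::finite cmat \<Rightarrow> complex)"
  unfolding det_def by (intro continuous_intros)

lemma open_det_nz: "open {Z :: 'n::finite cmat. det Z \<noteq> 0}"
proof -
  have "open (det -` (- {0}) :: 'n cmat set)"
    using continuous_det by (intro open_vimage) auto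
  then show ?thesis by (simp add: vimage_def Compl_eq)
qed

lemma eventually_det_nz:
  fixes C :: "real \<Rightarrow> 'n::finite cmat"
  assumes "continuous (at 0) C" "det (C 0) \<noteq> 0"
  shows "\<forall>\<^sub>F t in at 0. det (C t) \<noteq> 0"
proof -
  have "\<forall>\<^sub>F t in at 0. C t \<in> {Z. det Z \<noteq> 0}"
    using assms by (intro topological_tendstoD[OF _ open_det_nz]) (simp_all add: continuous_within)
  then show ?thesis by simp
qed

text \<open>
The map \<open>Z \<mapsto> (1 + low Z) (1 + up Z)\<close> has derivative \<^const>\<open>id\<close> at 0 and is injective where its second
factor is invertible, by uniqueness of the LU decomposition.  So the inverse function theorem yields
differentiable LU coordinates near the identity.
\<close>

lemma LU_local:
  obtains \<psi> :: "'n::{finite,linorder} cmat \<Rightarrow> 'n cmat" where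
    "\<psi> (mat 1) = 0" "(\<psi> has_derivative id) (at (mat 1))"
    "\<forall>\<^sub>F M in nhds (mat 1). (mat 1 + low (\<psi> M)) ** (mat 1 + up (\<psi> M)) = M \<and> det (mat 1 + up (\<psi> M)) \<noteq> 0"
proof -
  define f :: "'n cmat \<Rightarrow> 'n cmat" where "f Z = (mat 1 + low Z) ** (mat 1 + up Z)" for Z
  define S :: "'n cmat set" where "S = {Z. det (mat 1 + up Z) \<noteq> 0}"
  have bl: "bounded_linear (low :: 'n cmat \<Rightarrow> 'n cmat)" "bounded_linear (up :: 'n cmat \<Rightarrow> 'n cmat)"
    using linear_low linear_up linear_conv_bounded_linear by auto
  have cont: "continuous_on A (low :: 'n cmat \<Rightarrow> 'n cmat)" "continuous_on A (up :: 'n cmat \<Rightarrow> 'n cmat)" for A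
    using bl linear_continuous_on by blast+
  have contf: "continuous_on A f" for A
    unfolding f_def by (intro mm.continuous_on continuous_intros cont)
  have openS: "open S"
  proof -
    have "continuous_on UNIV (\<lambda>Z :: 'n cmat. mat 1 + up Z)"
      by (intro continuous_intros cont)
    then have "open ((\<lambda>Z. mat 1 + up Z) -` {Z :: 'n cmat. det Z \<noteq> 0})"
      using open_det_nz by (intro open_vimage)
    then show ?thesis by (simp add: S_def vimage_def)
  qed
  have zero: "0 \<in> S" "f 0 = mat 1"
    by (simp_all add: S_def f_def det_I)
  have inj: "inj_on f S"
  proof (rule inj_onI)
    fix Z Z' assume Z: "Z \<in> S" and Z': "Z' \<in> S" and eq: "f Z = f Z'"
    define b where "b = (mat 1 + up Z) ** matrix_inv (mat 1 + up Z')"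
    have nz: "det (mat 1 + up Z) \<noteq> 0" "det (mat 1 + up Z') \<noteq> 0" using Z Z' by (auto simp: S_def)
    have "b \<in> upper" unfolding b_def using nz by (intro upper_mult upper_inv) auto
    moreover have bZ: "b ** (mat 1 + up Z') = mat 1 + up Z"
      by (simp add: b_def matrix_mul_assoc[symmetric] det_inv_props nz)
    have "((mat 1 + low Z) ** b) ** (mat 1 + up Z') = (mat 1 + low Z') ** (mat 1 + up Z')"
      using eq by (simp add: f_def bZ matrix_mul_assoc[symmetric])
    then have "(mat 1 + low Z) ** b = mat 1 + low Z'"
      using right_cancel nz(2) by blast
    ultimately have *: "b = mat 1 \<and> low Z = low Z'" by (intro LU_unique) auto
    then have "mat 1 + up Z' = mat 1 + up Z" using bZ by simp
    then have "up Z = up Z'" by simp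
    then show "Z = Z'" using * low_plus_up by metis
  qed
  have derf: "(f has_derivative id) (at 0)"
  proof -
    have "(f has_derivative (\<lambda>H. (mat 1 + low 0) ** up H + low H ** (mat 1 + up 0))) (at 0)"
      unfolding f_def
      by (rule mm.FDERIV) (auto intro!: derivative_eq_intros bounded_linear_imp_has_derivative bl)
    also have "(\<lambda>H :: 'n cmat. (mat 1 + low 0) ** up H + low H ** (mat 1 + up 0)) = id"
      by (rule ext) (simp add: low_plus_up add.commute[of "up _"])
    finally show ?thesis .
  qed
  define \<psi> where "\<psi> = inv_into S f"
  have inv: "\<psi> (f Z) = Z" if "Z \<in> S" for Z
    using inj that by (simp add: \<psi>_def)
  show ?thesis
  proof
    show "\<psi> (mat 1) = 0" using inv[OF zero(1)] zero by simp
    have "(\<psi> has_derivative id) (at (f 0))"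
      by (rule has_derivative_inverse_strong[OF openS zero(1) contf inv derf]) auto
    then show "(\<psi> has_derivative id) (at (mat 1))" by (simp add: zero)
    have "open (f ` S)" by (rule invariance_of_domain[OF contf openS inj])
    moreover have "mat 1 \<in> f ` S" using zero by (metis imageI)
    ultimately have "\<forall>\<^sub>F M in nhds (mat 1). M \<in> f ` S"
      using eventually_nhds by blast
    then show "\<forall>\<^sub>F M in nhds (mat 1). (mat 1 + low (\<psi> M)) ** (mat 1 + up (\<psi> M)) = M \<and> det (mat 1 + up (\<psi> M)) \<noteq> 0"
    proof (rule eventually_mono)
      fix M assume "M \<in> f ` S"
      then have "f (\<psi> M) = M" "\<psi> M \<in> S"
        by (auto simp: \<psi>_def f_inv_into_f inv_into_into)
      then show "(mat 1 + low (\<psi> M)) ** (mat 1 + up (\<psi> M)) = M \<and> det (mat 1 + up (\<psi> M)) \<noteq> 0"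
        by (simp add: f_def S_def)
    qed
  qed
qed

lemma LU_curve:
  fixes M :: "real \<Rightarrow> 'n::{finite,linorder} cmat"
  assumes M0: "M 0 = mat 1" and der: "(M has_vector_derivative X) (at 0)"
  obtains \<eta> where "\<eta> 0 = 0" "\<And>t. \<eta> t \<in> strictly_lower" "(\<eta> has_vector_derivative low X) (at 0)"
    "\<forall>\<^sub>F t in at 0. \<exists>b\<in>upper. det b \<noteq> 0 \<and> M t = (mat 1 + \<eta> t) ** b"
proof -
  obtain \<psi> :: "'n cmat \<Rightarrow> 'n cmat" where \<psi>: "\<psi> (mat 1) = 0" "(\<psi> has_derivative id) (at (mat 1))"
    and ev: "\<forall>\<^sub>F M in nhds (mat 1). (mat 1 + low (\<psi> M)) ** (mat 1 + up (\<psi> M)) = M \<and> det (mat 1 + up (\<psi> M)) \<noteq> 0"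
    by (rule LU_local)
  have bl: "bounded_linear (low :: 'n cmat \<Rightarrow> 'n cmat)"
    using linear_low linear_conv_bounded_linear by auto
  show ?thesis
  proof
    show "low (\<psi> (M 0)) = 0" by (simp add: M0 \<psi>)
    show "low (\<psi> (M t)) \<in> strictly_lower" for t by simp
    have "((\<lambda>t. \<psi> (M t)) has_derivative (\<lambda>h. id (h *\<^sub>R X))) (at 0)"
      using der \<psi>(2) by (intro has_derivative_compose[of M _ 0 UNIV \<psi> id]) (auto simp: has_vector_derivative_def M0)
    then have "((\<lambda>t. \<psi> (M t)) has_vector_derivative X) (at 0)"
      by (simp add: has_vector_derivative_def)
    then show "((\<lambda>t. low (\<psi> (M t))) has_vector_derivative low X) (at 0)"
      by (rule bounded_linear.has_vector_derivative[OF bl])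
    have "(M \<longlongrightarrow> mat 1) (at 0)"
      using has_vector_derivative_continuous[OF der] M0 by (simp add: continuous_within)
    then have "\<forall>\<^sub>F t in at 0. (mat 1 + low (\<psi> (M t))) ** (mat 1 + up (\<psi> (M t))) = M t \<and> det (mat 1 + up (\<psi> (M t))) \<noteq> 0"
      by (rule eventually_compose_filterlim[OF ev])
    then show "\<forall>\<^sub>F t in at 0. \<exists>b\<in>upper. det b \<noteq> 0 \<and> M t = (mat 1 + low (\<psi> (M t))) ** b"
      by (rule eventually_mono) (metis one_up_upper)
  qed
qed

lemma has_vector_derivative_within_chain:
  fixes h :: "'a::real_normed_vector \<Rightarrow> 'b::real_normed_vector" and c :: "real \<Rightarrow> 'a"
  assumes h: "(h has_derivative h') (at (c 0) within S)" and c: "(c has_vector_derivative v) (at 0)"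
    and ev: "\<forall>\<^sub>F t in at 0. c t \<in> S" and c0: "c 0 \<in> S"
  shows "((\<lambda>t. h (c t)) has_vector_derivative h' v) (at 0)"
proof -
  obtain U where U: "open U" "0 \<in> U" "\<And>t. t \<in> U \<Longrightarrow> c t \<in> S"
    using ev c0 by (auto simp: eventually_at_topological) metis
  have "(h has_derivative h') (at (c 0) within c ` U)"
    using h by (rule has_derivative_subset) (use U in auto)
  moreover have "(c has_derivative (\<lambda>x. x *\<^sub>R v)) (at 0 within U)"
    using c by (auto simp: has_vector_derivative_def intro: has_derivative_at_withinI)
  ultimately have "((\<lambda>t. h (c t)) has_derivative (\<lambda>x. h' (x *\<^sub>R v))) (at 0 within U)"
    using has_derivative_in_compose[of c "\<lambda>x. x *\<^sub>R v" 0 U h h'] by blast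
  then have "((\<lambda>t. h (c t)) has_derivative (\<lambda>x. h' (x *\<^sub>R v))) (at 0)"
    using U at_within_open by metis
  moreover have "linear h'" using h has_derivative_linear by blast
  ultimately show ?thesis by (simp add: has_vector_derivative_def linear_scale)
qed

lemma has_vector_derivative_cong_eventually:
  fixes f g :: "real \<Rightarrow> 'a::real_normed_vector"
  assumes "\<forall>\<^sub>F t in at x. f t = g t" "f x = g x" "(f has_vector_derivative v) (at x)"
  shows "(g has_vector_derivative v) (at x)"
  using assms has_derivative_transform_eventually[of f "\<lambda>h. h *\<^sub>R v" x UNIV g]
  by (auto simp: has_vector_derivative_def)

lemma curve_in_subspace_derivative:
  fixes y :: "real \<Rightarrow> 'a::euclidean_space"
  assumes y: "(y has_vector_derivative v) (at 0)" and ev: "\<forall>\<^sub>F t in at 0. y t \<in> L"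
    and y0: "y 0 \<in> L" and L: "subspace L"
  shows "v \<in> L"
proof -
  have "((\<lambda>t. (y t - y 0) /\<^sub>R t) \<longlongrightarrow> v) (at 0)"
  proof -
    have "((\<lambda>t. norm ((y t - y 0) /\<^sub>R t - v)) \<longlongrightarrow> 0) (at 0)"
    proof (rule Lim_transform_eventually)
      show "((\<lambda>t. norm (y t - y 0 - t *\<^sub>R v) / norm t) \<longlongrightarrow> 0) (at 0)"
        using y by (simp add: has_vector_derivative_def has_derivative_at)
      show "\<forall>\<^sub>F t in at 0. norm (y t - y 0 - t *\<^sub>R v) / norm t = norm ((y t - y 0) /\<^sub>R t - v)"
      proof (rule eventually_at_filter[THEN iffD2, OF always_eventually], safe)
        fix t :: real assume "t \<noteq> 0"
        then have "(y t - y 0) /\<^sub>R t - v = (y t - y 0 - t *\<^sub>R v) /\<^sub>R t" by (simp add: scaleR_diff_right)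
        then show "norm (y t - y 0 - t *\<^sub>R v) / norm t = norm ((y t - y 0) /\<^sub>R t - v)"
          by (simp add: divide_inverse mult.commute)
      qed
    qed
    then show ?thesis using tendsto_norm_zero_iff LIM_zero_cancel by blast
  qed
  moreover have "\<forall>\<^sub>F t in at 0. (y t - y 0) /\<^sub>R t \<in> L"
    using ev by (rule eventually_mono) (intro subspace_scale subspace_diff L y0)
  ultimately show ?thesis
    by (intro Lim_in_closed_set[OF closed_subspace[OF L]]) auto
qed

section \<open>Tangent spaces of complex submanifolds\<close>

text \<open>
The tangent space of \<open>A\<close> at \<open>p\<close>, pulled back to the matrices along \<open>X \<mapsto> X \<cdot> p\<close>.  For \<open>p\<close> in \<open>A\<close>
it therefore contains the Lie algebra of the stabilizer of \<open>p\<close>.  In exchange it involves no chart.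
\<close>

definition tangent :: "'n::{finite,linorder} flag set \<Rightarrow> 'n flag \<Rightarrow> 'n cmat set" where
  "tangent A p = {X. \<exists>C :: real \<Rightarrow> 'n cmat. det (C 0) \<noteq> 0 \<and> act (C 0) base_flag = p \<and>
     (C has_vector_derivative X ** C 0) (at 0) \<and> (\<forall>\<^sub>F t in at 0. act (C t) base_flag \<in> A)}"

lemma tangent_lift:
  assumes "X \<in> tangent A p" "det g \<noteq> 0" "act g base_flag = p"
  obtains C where "C 0 = g" "(C has_vector_derivative X ** g) (at 0)" "\<forall>\<^sub>F t in at 0. act (C t) base_flag \<in> A"
proof -
  obtain C where C: "det (C 0) \<noteq> 0" "act (C 0) base_flag = p"
     "(C has_vector_derivative X ** C 0) (at 0)" "\<forall>\<^sub>F t in at 0. act (C t) base_flag \<in> A"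
    using assms unfolding tangent_def by blast
  obtain b where b: "b \<in> upper" "det b \<noteq> 0" "g = C 0 ** b"
    using act_base_eqE[OF C(1) assms(2)] C(2) assms(3) by metis
  show ?thesis
  proof
    show "C 0 ** b = g" by (simp add: b)
    have "((\<lambda>t. C t ** b) has_vector_derivative X ** C 0 ** b) (at 0)"
      by (rule bounded_linear.has_vector_derivative[OF mm.bounded_linear_left C(3)])
    then show "((\<lambda>t. C t ** b) has_vector_derivative X ** g) (at 0)" by (simp add: b matrix_mul_assoc)
    show "\<forall>\<^sub>F t in at 0. act (C t ** b) base_flag \<in> A"
      using C(4) by (simp add: act_mult_upper b)
  qed
qed

lemma tangent_mono_germ:
  assumes "\<And>C. continuous (at 0) C \<Longrightarrow> det (C 0) \<noteq> 0 \<Longrightarrow> act (C 0) base_flag = p \<Longrightarrow>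
      \<forall>\<^sub>F t in at 0. act (C t) base_flag \<in> A \<Longrightarrow> \<forall>\<^sub>F t in at (0::real). act (C t) base_flag \<in> A'"
  shows "tangent A p \<subseteq> tangent A' p"
  unfolding tangent_def
proof safe
  fix X :: "'a cmat" and C :: "real \<Rightarrow> 'a cmat"
  assume "det (C 0) \<noteq> 0" "(C has_vector_derivative X ** C 0) (at 0)" "p = act (C 0) base_flag"
    "\<forall>\<^sub>F t in at 0. act (C t) base_flag \<in> A"
  then show "\<exists>Ca. det (Ca 0) \<noteq> 0 \<and> act (Ca 0) base_flag = act (C 0) base_flag \<and>
     (Ca has_vector_derivative X ** Ca 0) (at 0) \<and> (\<forall>\<^sub>F t in at 0. act (Ca t) base_flag \<in> A')"
    using assms[of C] has_vector_derivative_continuous by blast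
qed

lemma tangent_mono: "A \<subseteq> A' \<Longrightarrow> tangent A p \<subseteq> tangent A' p"
  by (rule tangent_mono_germ) (auto elim: eventually_mono)

lemma dim_conj_low:
  fixes g :: "'n::{finite,linorder} cmat"
  assumes g: "det g \<noteq> 0" and Y: "subspace Y" "Y \<subseteq> strictly_lower"
  shows "subspace {X. low (matrix_inv g ** X ** g) \<in> Y}"
    and "dim {X. low (matrix_inv g ** X ** g) \<in> Y} = dim Y + dim (upper :: 'n cmat set)"
proof -
  define \<phi> where "\<phi> X = matrix_inv g ** X ** g" for X
  define \<psi> where "\<psi> X = g ** X ** matrix_inv g" for X
  have lin: "linear \<phi>" "linear \<psi>"
    unfolding \<phi>_def \<psi>_def
    by (intro linearI; simp add: mm.add_left mm.add_right mm.scaleR_left mm.scaleR_right)+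
  have inv: "\<phi> (\<psi> X) = X" "\<psi> (\<phi> X) = X" for X
  proof -
    have "\<phi> (\<psi> X) = (matrix_inv g ** g) ** X ** (matrix_inv g ** g)"
      by (simp add: \<phi>_def \<psi>_def matrix_mul_assoc)
    then show "\<phi> (\<psi> X) = X" by (simp add: det_inv_props g)
    have "\<psi> (\<phi> X) = (g ** matrix_inv g) ** X ** (g ** matrix_inv g)"
      by (simp add: \<phi>_def \<psi>_def matrix_mul_assoc)
    then show "\<psi> (\<phi> X) = X" by (simp add: det_inv_props g)
  qed
  define W where "W = {x + y | x y. x \<in> Y \<and> y \<in> (upper :: 'n cmat set)}"
  have W: "W = {X. low X \<in> Y}"
  proof -
    have "low (x + y) = x" if "x \<in> Y" "y \<in> upper" for x y
      using that Y(2) linear_add[OF linear_low] low_id low_upper by (metis add.right_neutral subsetD)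
    moreover have "X = low X + up X \<and> up X \<in> upper" for X :: "'n cmat" by (simp add: low_plus_up)
    ultimately show ?thesis unfolding W_def by (auto; metis)
  qed
  have "subspace W"
    using linear_low Y(1) linear_subspace_vimage[of low Y] by (simp add: W vimage_def)
  have eq: "{X. low (matrix_inv g ** X ** g) \<in> Y} = \<psi> ` W"
    using inv by (auto simp: W \<phi>_def[symmetric] image_iff) metis
  show "subspace {X. low (matrix_inv g ** X ** g) \<in> Y}"
    unfolding eq using lin \<open>subspace W\<close> linear_subspace_image by blast
  have "Y \<inter> upper \<subseteq> {0}"
  proof
    fix x assume "x \<in> Y \<inter> upper"
    then have "low x = x" "low x = 0" using Y(2) low_id low_upper by auto
    then show "x \<in> {0}" by simp
  qed
  then have "dim (Y \<inter> upper) = 0" by (simp add: dim_eq_0)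
  then have "dim W = dim Y + dim (upper :: 'n cmat set)"
    using dim_sums_Int[OF Y(1) subspace_upper] unfolding W_def by linarith
  moreover have "inj \<psi>" using inv by (metis injI)
  then have "dim (\<psi> ` W) = dim W"
    using lin by (intro dim_image_eq) (auto intro: inj_on_subset)
  ultimately show "dim {X. low (matrix_inv g ** X ** g) \<in> Y} = dim Y + dim (upper :: 'n cmat set)"
    by (simp add: eq)
qed

text \<open>
Along a curve the LU coordinates relative to \<open>g\<close> are the coordinates in the chart at \<open>g\<close>, so \<open>X\<close> is
tangent if and only if the lower part of \<open>g\<^sup>-\<^sup>1 X g\<close> is mapped to the slice \<open>L\<close> by the derivative of \<open>h\<close>.
This derivative is an isomorphism on the lower triangular matrices and complex linear, while the upper
part of \<open>g\<^sup>-\<^sup>1 X g\<close> is arbitrary.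
\<close>

lemma tangent_submanifold:
  fixes A :: "'n::{finite,linorder} flag set"
  assumes A: "complex_submanifold d A" and p: "p \<in> A"
  shows "subspace (tangent A p)" "dim (tangent A p) = 2 * d + dim (upper :: 'n cmat set)"
    "X \<in> tangent A p \<Longrightarrow> cscale c X \<in> tangent A p"
proof -
  obtain g S S' h L where g: "g \<in> SL_C" "act g base_flag = p" and S0: "0 \<in> S" and bih: "biholomorphic h S S'"
    and L: "complex_subspace L" "L \<subseteq> strictly_lower" "dim L = 2 * d"
    and hL: "h ` {X \<in> S. chart_at g X \<in> A} = S' \<inter> L"
    using A p unfolding complex_submanifold_def by (auto dest!: bspec[OF _ p])
  have detg: "det g \<noteq> 0" using g by (simp add: SL_C_def)
  have openS: "openin (top_of_set strictly_lower) S" and openS': "openin (top_of_set strictly_lower) S'"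
    and bij: "bij_betw h S S'" and holh: "holomorphic_map h S" and holi: "holomorphic_map (inv_into S h) S'"
    using bih by (auto simp: biholomorphic_def)
  define hi where "hi = inv_into S h"
  have hih: "hi (h X) = X" if "X \<in> S" for X using bij that by (simp add: hi_def bij_betw_inv_into_left)
  have hhi: "h (hi Y) = Y" "hi Y \<in> S" if "Y \<in> S'" for Y
    using bij that by (auto simp: hi_def bij_betw_inv_into_right bij_betw_def inv_into_into)
  have hS: "h X \<in> S'" if "X \<in> S" for X using bij that by (auto simp: bij_betw_def)
  have subL: "subspace L" using L by (simp add: complex_subspace_def)
  have subS: "S \<subseteq> strictly_lower" "S' \<subseteq> strictly_lower" using openS openS' openin_imp_subset by auto
  obtain h' where h': "(h has_derivative h') (at 0 within S)" and h'c: "\<And>c Y. h' (cscale c Y) = cscale c (h' Y)"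
    using holh S0 unfolding holomorphic_map_def by blast
  obtain hi' where hi': "(hi has_derivative hi') (at (h 0) within S')"
    using holi hS[OF S0] unfolding holomorphic_map_def hi_def by blast
  have linh': "linear h'" and linhi': "linear hi'" using h' hi' has_derivative_linear by auto
  have ev_open: "\<forall>\<^sub>F t in at (0::real). c t \<in> T"
    if T: "openin (top_of_set strictly_lower) T" and "c 0 \<in> T" and ct: "\<And>t. c t \<in> strictly_lower"
      and "continuous (at 0) c" for T and c :: "real \<Rightarrow> 'n cmat"
  proof -
    obtain U where U: "open U" "T = strictly_lower \<inter> U" using T by (auto simp: openin_open)
    have "\<forall>\<^sub>F t in at 0. c t \<in> U"
      using that U by (auto simp: continuous_within intro: topological_tendstoD)
    then show ?thesis using U ct by (auto elim: eventually_mono)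
  qed
  have line: "((\<lambda>t::real. x + t *\<^sub>R v) has_vector_derivative v) (at 0)" for x v :: "'n cmat"
    by (auto intro!: derivative_eq_intros)
  have line_cont: "continuous (at 0) (\<lambda>t::real. x + t *\<^sub>R v)" for x v :: "'n cmat"
    by (intro continuous_intros)
  have chart0: "chart_at g 0 = p" by (simp add: chart_at_def g)
  have h0L: "h 0 \<in> L" using hL S0 p chart0 by blast
  have inv1: "hi' (h' v) = v" if v: "v \<in> strictly_lower" for v
  proof -
    have ev: "\<forall>\<^sub>F t in at (0::real). 0 + t *\<^sub>R v \<in> S"
      using v S0 line_cont[of 0 v] subspace_scale[OF subspace_strictly_lower v] by (intro ev_open[OF openS]) auto
    have d1: "((\<lambda>t. h (0 + t *\<^sub>R v)) has_vector_derivative h' v) (at 0)"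
      by (rule has_vector_derivative_within_chain[OF _ line ev]) (use h' S0 in auto)
    have "((\<lambda>t. hi (h (0 + t *\<^sub>R v))) has_vector_derivative hi' (h' v)) (at 0)"
      by (rule has_vector_derivative_within_chain[OF _ d1, of hi hi' S'])
         (use hi' hS S0 in \<open>auto intro: eventually_mono[OF ev]\<close>)
    moreover have "\<forall>\<^sub>F t in at 0. hi (h (0 + t *\<^sub>R v)) = 0 + t *\<^sub>R v"
      using ev by (rule eventually_mono) (rule hih)
    moreover have "hi (h (0 + 0 *\<^sub>R v)) = 0 + 0 *\<^sub>R v" using hih S0 by simp
    ultimately have "((\<lambda>t::real. 0 + t *\<^sub>R v) has_vector_derivative hi' (h' v)) (at 0)"
      using has_vector_derivative_cong_eventually[of "\<lambda>t. hi (h (0 + t *\<^sub>R v))" "\<lambda>t. 0 + t *\<^sub>R v" 0] by blast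
    then show ?thesis using line vector_derivative_unique_at by blast
  qed
  have inv2: "hi' v \<in> strictly_lower \<and> h' (hi' v) = v" if v: "v \<in> strictly_lower" for v
  proof -
    have h0: "h 0 \<in> strictly_lower" using hS[OF S0] subS by auto
    have ev: "\<forall>\<^sub>F t in at (0::real). h 0 + t *\<^sub>R v \<in> S'"
      using h0 hS[OF S0] line_cont[of "h 0" v] subspace_add[OF subspace_strictly_lower h0 subspace_scale[OF subspace_strictly_lower v]]
      by (intro ev_open[OF openS']) auto
    have d1: "((\<lambda>t. hi (h 0 + t *\<^sub>R v)) has_vector_derivative hi' v) (at 0)"
      by (rule has_vector_derivative_within_chain[OF _ line ev]) (use hi' hS S0 in auto)
    have hi0: "hi (h 0 + 0 *\<^sub>R v) = 0" using hih S0 by simp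
    have "hi' v \<in> strictly_lower"
    proof (rule curve_in_subspace_derivative[OF d1])
      show "\<forall>\<^sub>F t in at 0. hi (h 0 + t *\<^sub>R v) \<in> strictly_lower"
        using ev by (rule eventually_mono) (use hhi subS in blast)
    qed (use hi0 subspace_strictly_lower subspace_0 in auto)
    moreover have "((\<lambda>t. h (hi (h 0 + t *\<^sub>R v))) has_vector_derivative h' (hi' v)) (at 0)"
      by (rule has_vector_derivative_within_chain[OF _ d1, of h h' S])
         (use h' hi0 S0 hhi in \<open>auto intro: eventually_mono[OF ev]\<close>)
    moreover have "\<forall>\<^sub>F t in at 0. h (hi (h 0 + t *\<^sub>R v)) = h 0 + t *\<^sub>R v"
      using ev by (rule eventually_mono) (rule hhi)
    moreover have "h (hi (h 0 + 0 *\<^sub>R v)) = h 0 + 0 *\<^sub>R v" using hi0 by simp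
    ultimately have "hi' v \<in> strictly_lower" "((\<lambda>t::real. h 0 + t *\<^sub>R v) has_vector_derivative h' (hi' v)) (at 0)"
      using has_vector_derivative_cong_eventually[of "\<lambda>t. h (hi (h 0 + t *\<^sub>R v))" "\<lambda>t. h 0 + t *\<^sub>R v" 0] by blast+
    then show ?thesis using line vector_derivative_unique_at by blast
  qed
  define T where "T = {v \<in> strictly_lower. h' v \<in> L}"
  have subT: "subspace T"
  proof -
    have "T = strictly_lower \<inter> h' -` L" by (auto simp: T_def)
    then show ?thesis
      using linear_subspace_vimage[OF linh' subL] subspace_inter[OF subspace_strictly_lower] by simp
  qed
  have T_lower: "T \<subseteq> strictly_lower" by (auto simp: T_def)
  have "inj_on h' T" using inv1 T_lower by (metis inj_on_def subsetD)
  moreover have "h' ` T = L"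
    using inv2 L(2) unfolding T_def by (auto simp: image_iff) (metis subsetD)
  ultimately have dimT: "dim T = 2 * d"
    using dim_image_eq[OF linh', of T] L(3) subT by (simp add: span_eq_iff[THEN iffD2, OF subT])
  have eq: "tangent A p = {X. low (matrix_inv g ** X ** g) \<in> T}"
  proof (intro equalityI subsetI; clarify)
    fix X assume "X \<in> tangent A p"
    then obtain C where C: "C 0 = g" "(C has_vector_derivative X ** g) (at 0)" "\<forall>\<^sub>F t in at 0. act (C t) base_flag \<in> A"
      using tangent_lift detg g(2) by metis
    define M where "M t = matrix_inv g ** C t" for t
    have M0: "M 0 = mat 1" by (simp add: M_def C det_inv_props detg)
    have "(M has_vector_derivative matrix_inv g ** (X ** g)) (at 0)"
      unfolding M_def by (rule bounded_linear.has_vector_derivative[OF mm.bounded_linear_right C(2)])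
    then have dM: "(M has_vector_derivative matrix_inv g ** X ** g) (at 0)" by (simp add: matrix_mul_assoc)
    obtain \<eta> where \<eta>: "\<eta> 0 = 0" "\<And>t. \<eta> t \<in> strictly_lower"
      "(\<eta> has_vector_derivative low (matrix_inv g ** X ** g)) (at 0)"
      "\<forall>\<^sub>F t in at 0. \<exists>b\<in>upper. det b \<noteq> 0 \<and> M t = (mat 1 + \<eta> t) ** b"
      by (rule LU_curve[OF M0 dM]) blast
    have evS: "\<forall>\<^sub>F t in at 0. \<eta> t \<in> S"
    proof (rule ev_open[OF openS])
      show "\<eta> 0 \<in> S" by (simp add: \<eta>(1) S0)
    qed (rule \<eta>(2) has_vector_derivative_continuous[OF \<eta>(3)])+
    have der: "((\<lambda>t. h (\<eta> t)) has_vector_derivative h' (low (matrix_inv g ** X ** g))) (at 0)"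
      by (rule has_vector_derivative_within_chain[OF _ \<eta>(3) evS]) (simp_all add: \<eta>(1) h' S0)
    have "h' (low (matrix_inv g ** X ** g)) \<in> L"
    proof (rule curve_in_subspace_derivative[OF der _ _ subL])
      show "h (\<eta> 0) \<in> L" by (simp add: \<eta> h0L)
      show "\<forall>\<^sub>F t in at 0. h (\<eta> t) \<in> L"
        using C(3) \<eta>(4) evS
      proof eventually_elim
        case (elim t)
        then obtain b where b: "b \<in> upper" "det b \<noteq> 0" "M t = (mat 1 + \<eta> t) ** b" by blast
        have "C t = g ** M t" by (simp add: M_def matrix_mul_assoc det_inv_props detg)
        also have "\<dots> = g ** (mat 1 + \<eta> t) ** b" by (simp add: b matrix_mul_assoc)
        finally have "act (C t) base_flag = chart_at g (\<eta> t)"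
          by (simp add: chart_at_def act_mult_upper b)
        then show ?case using elim hL by auto
      qed
    qed
    then show "low (matrix_inv g ** X ** g) \<in> T" by (simp add: T_def)
  next
    fix X assume XT: "low (matrix_inv g ** X ** g) \<in> T"
    define v where "v = low (matrix_inv g ** X ** g)"
    define \<beta> where "\<beta> = up (matrix_inv g ** X ** g)"
    have v: "v \<in> strictly_lower" "h' v \<in> L" using XT by (auto simp: v_def T_def)
    have h'v: "h' v \<in> strictly_lower" using v L by auto
    have h0: "h 0 \<in> strictly_lower" using hS[OF S0] subS by auto
    have ev: "\<forall>\<^sub>F t in at (0::real). h 0 + t *\<^sub>R h' v \<in> S'"
      using h0 hS[OF S0] line_cont[of "h 0" "h' v"]
        subspace_add[OF subspace_strictly_lower h0 subspace_scale[OF subspace_strictly_lower h'v]]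
      by (intro ev_open[OF openS']) auto
    define \<eta> where "\<eta> t = hi (h 0 + t *\<^sub>R h' v)" for t
    have d1: "(\<eta> has_vector_derivative hi' (h' v)) (at 0)"
      unfolding \<eta>_def by (rule has_vector_derivative_within_chain[OF _ line ev]) (use hi' hS S0 in auto)
    then have d\<eta>: "(\<eta> has_vector_derivative v) (at 0)" using inv1 v by simp
    have \<eta>0: "\<eta> 0 = 0" using hih S0 by (simp add: \<eta>_def)
    define C where "C t = g ** (mat 1 + \<eta> t) ** (mat 1 + t *\<^sub>R \<beta>)" for t
    have C0: "C 0 = g" by (simp add: C_def \<eta>0)
    have "((\<lambda>t. (mat 1 + \<eta> t) ** (mat 1 + t *\<^sub>R \<beta>)) has_vector_derivative
        (mat 1 + \<eta> 0) ** \<beta> + v ** (mat 1 + 0 *\<^sub>R \<beta>)) (at 0)"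
      by (rule mm.has_vector_derivative) (auto intro!: derivative_eq_intros d\<eta>)
    then have "((\<lambda>t. (mat 1 + \<eta> t) ** (mat 1 + t *\<^sub>R \<beta>)) has_vector_derivative matrix_inv g ** X ** g) (at 0)"
      using low_plus_up[of "matrix_inv g ** X ** g"] by (simp add: \<eta>0 v_def \<beta>_def add.commute)
    then have "((\<lambda>t. g ** ((mat 1 + \<eta> t) ** (mat 1 + t *\<^sub>R \<beta>))) has_vector_derivative g ** (matrix_inv g ** X ** g)) (at 0)"
      by (rule bounded_linear.has_vector_derivative[OF mm.bounded_linear_right])
    then have dC: "(C has_vector_derivative X ** C 0) (at 0)"
      by (simp add: C0 matrix_mul_assoc det_inv_props detg) (simp add: C_def[abs_def] matrix_mul_assoc)
    have evb: "\<forall>\<^sub>F t in at (0::real). det (mat 1 + t *\<^sub>R \<beta>) \<noteq> 0"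
      by (rule eventually_det_nz) (simp_all add: line_cont det_I)
    have "\<forall>\<^sub>F t in at 0. act (C t) base_flag \<in> A"
      using ev evb
    proof eventually_elim
      case (elim t)
      have "h 0 + t *\<^sub>R h' v \<in> L" using h0L v subL subspace_add subspace_scale by blast
      then have "h 0 + t *\<^sub>R h' v \<in> h ` {X \<in> S. chart_at g X \<in> A}" using elim hL by simp
      then obtain Z where Z: "Z \<in> S" "chart_at g Z \<in> A" "h 0 + t *\<^sub>R h' v = h Z" by blast
      then have "\<eta> t = Z" by (simp add: \<eta>_def hih)
      moreover have "mat 1 + t *\<^sub>R \<beta> \<in> upper"
        unfolding \<beta>_def by (intro subspace_add subspace_upper subspace_scale upper_one up_upper)
      ultimately have "act (C t) base_flag = chart_at g Z"
        using elim by (simp add: C_def chart_at_def act_mult_upper)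
      then show ?case using Z by simp
    qed
    then show "X \<in> tangent A p"
      unfolding tangent_def using dC C0 detg g(2) by auto
  qed
  show "subspace (tangent A p)" "dim (tangent A p) = 2 * d + dim (upper :: 'n cmat set)"
    using dim_conj_low[OF detg subT T_lower] by (simp_all add: eq dimT)
  show "cscale c X \<in> tangent A p" if "X \<in> tangent A p"
  proof -
    have "matrix_inv g ** cscale c X ** g = cscale c (matrix_inv g ** X ** g)"
      by (simp add: cscale_def matrix_matrix_mult_def vec_eq_iff sum_distrib_left sum_distrib_right mult_ac)
    moreover have "low (cscale c Z) = cscale c (low Z)" for Z :: "'n cmat"
      by (simp add: low_def cscale_def vec_eq_iff)
    moreover have "cscale c Z \<in> T" if "Z \<in> T" for Z
      using that L(1) by (auto simp: T_def h'c complex_subspace_def) (simp add: strictly_lower_def cscale_def)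
    ultimately show ?thesis using that by (simp add: eq)
  qed
qed

lemma submanifold_dim_mono_germ:
  fixes A A' :: "'n::{finite,linorder} flag set"
  assumes "complex_submanifold d A" "complex_submanifold d' A'" "p \<in> A" "p \<in> A'"
    and "tangent A p \<subseteq> tangent A' p"
  shows "d \<le> d'"
  using dim_subset[OF assms(5)] tangent_submanifold(2)[OF assms(1,3)] tangent_submanifold(2)[OF assms(2,4)]
  by linarith

lemma cdim_eqI:
  assumes "complex_submanifold d Y" "Y \<noteq> {}" "Y \<subseteq> A"
    and "\<And>d' Y'. complex_submanifold d' Y' \<Longrightarrow> Y' \<noteq> {} \<Longrightarrow> Y' \<subseteq> A \<Longrightarrow> d' \<le> d"
  shows "cdim A = d"
  unfolding cdim_def
proof (rule Max_eqI)
  have le: "x \<le> d" if "x \<in> {d. \<exists>Y. Y \<noteq> {} \<and> Y \<subseteq> A \<and> complex_submanifold d Y}" for x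
    using that assms(4) by blast
  then show "finite {d. \<exists>Y. Y \<noteq> {} \<and> Y \<subseteq> A \<and> complex_submanifold d Y}"
    by (meson atMost_iff finite_atMost finite_subset subsetI)
  show "x \<le> d" if "x \<in> {d. \<exists>Y. Y \<noteq> {} \<and> Y \<subseteq> A \<and> complex_submanifold d Y}" for x
    by (rule le[OF that])
  show "d \<in> {d. \<exists>Y. Y \<noteq> {} \<and> Y \<subseteq> A \<and> complex_submanifold d Y}"
    using assms(1-3) by blast
qed

lemma cdim_submanifold:
  assumes "complex_submanifold d A" "A \<noteq> {}"
  shows "cdim A = d"
  by (rule cdim_eqI[OF assms order_refl]) (metis assms(1) ex_in_conv submanifold_dim_mono_germ subsetD tangent_mono)

lemma dim_entries: "dim {X :: 'n::finite cmat. \<forall>i j. (i, j) \<notin> Q \<longrightarrow> X $ i $ j = 0} = 2 * card Q"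
proof -
  define f where "f = (\<lambda>((i::'n, j::'n), c::complex). axis i (axis j c) :: 'n cmat)"
  let ?d = "f ` (Q \<times> Basis)"
  have sub: "?d \<subseteq> Basis" by (auto simp: f_def Basis_vec_def)
  have inj: "inj_on f (Q \<times> Basis)"
    by (auto simp: inj_on_def f_def axis_eq_axis)
  have "card ?d = card Q * card (Basis :: complex set)"
    using inj by (simp add: card_image card_cartesian_product)
  then have card: "card ?d = 2 * card Q" by (simp add: Basis_complex_def)
  have "{X :: 'n cmat. \<forall>i j. (i, j) \<notin> Q \<longrightarrow> X $ i $ j = 0} = {X. \<forall>b\<in>Basis. b \<notin> ?d \<longrightarrow> X \<bullet> b = 0}"
  proof (intro equalityI subsetI CollectI ballI allI impI)
    fix X b assume X: "X \<in> {X :: 'n cmat. \<forall>i j. (i, j) \<notin> Q \<longrightarrow> X $ i $ j = 0}" and "b \<in> Basis" "b \<notin> ?d"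
    then obtain i j c where b: "b = axis i (axis j c)" "c \<in> Basis" by (auto simp: Basis_vec_def)
    then have "(i, j) \<notin> Q" using \<open>b \<notin> ?d\<close> by (force simp: f_def)
    then show "X \<bullet> b = 0" using X by (simp add: b inner_axis)
  next
    fix X :: "'n cmat" and i j
    assume X: "X \<in> {X. \<forall>b\<in>Basis. b \<notin> ?d \<longrightarrow> X \<bullet> b = 0}" and ij: "(i, j) \<notin> Q"
    have "X $ i $ j \<bullet> c = 0" if c: "c \<in> Basis" for c
    proof -
      have "axis i (axis j c) \<in> (Basis :: 'n cmat set)" using c by (auto simp: Basis_vec_def)
      moreover have "axis i (axis j c) \<notin> ?d"
      proof
        assume "axis i (axis j c) \<in> ?d"
        then obtain i' j' c' where "(i', j') \<in> Q" "c' \<in> Basis" "axis i (axis j c) = axis i' (axis j' c')"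
          by (auto simp: f_def)
        moreover have "c \<noteq> 0" "axis j c \<noteq> 0" using c by (auto simp: axis_eq_0_iff nonzero_Basis)
        ultimately show False using ij by (auto simp: axis_eq_axis)
      qed
      ultimately have "X \<bullet> axis i (axis j c) = 0" using X by blast
      then show ?thesis by (simp add: inner_axis)
    qed
    then show "X $ i $ j = 0" by (metis euclidean_all_zero_iff)
  qed
  then show ?thesis using dim_substandard[OF sub] card by simp
qed

section \<open>Permutation matrices and the Bruhat decomposition\<close>

definition index_perm :: "(nat \<Rightarrow> nat) \<Rightarrow> 'n::{finite,linorder} \<Rightarrow> 'n" where
  "index_perm w j = idx (w (pos j))"

lemma pos_in: "pos (j::'n::{finite,linorder}) \<in> {1..CARD('n)}"
  using pos_ge_1 pos_le by auto

lemma pos_index_perm: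
  assumes "w permutes {1..CARD('n)}"
  shows "pos (index_perm w (j::'n::{finite,linorder})) = w (pos j)"
  using permutes_in_image[OF assms, of "pos j"] pos_in[of j] by (simp add: index_perm_def)

lemma bij_index_perm:
  assumes "w permutes {1..CARD('n)}"
  shows "bij (index_perm w :: 'n::{finite,linorder} \<Rightarrow> 'n)"
proof -
  have "inj (index_perm w :: 'n \<Rightarrow> 'n)"
  proof (rule injI)
    fix x y :: 'n assume "index_perm w x = index_perm w y"
    then have "w (pos x) = w (pos y)" using pos_index_perm[OF assms] by metis
    then have "pos x = pos y" using permutes_inj[OF assms] by (simp add: inj_eq)
    then show "x = y" by simp
  qed
  then show ?thesis by (metis bij_def finite_class.finite_UNIV finite_UNIV_inj_surj)
qed

text \<open>
The scalars \<open>d\<close> are needed to give a permutation matrix determinant 1 without changing its flag.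
\<close>

definition monomial_matrix :: "('n::finite \<Rightarrow> 'n) \<Rightarrow> ('n \<Rightarrow> complex) \<Rightarrow> 'n cmat" where
  "monomial_matrix \<sigma> d = (\<chi> i j. if i = \<sigma> j then d j else 0)"

lemma monomial_mult_vec:
  assumes "bij \<sigma>"
  shows "(monomial_matrix \<sigma> d *v x) $ (\<sigma> j) = d j * x $ j"
proof -
  have "(monomial_matrix \<sigma> d *v x) $ (\<sigma> j) = (\<Sum>k\<in>UNIV. (if j = k then d k else 0) * x $ k)"
    unfolding monomial_matrix_def matrix_vector_mult_def
    using assms by (auto simp: bij_def inj_eq)
  then show ?thesis by (simp add: if_distrib[of "\<lambda>z. z * _"] cong: if_cong)
qed

lemma monomial_mult_left:
  assumes "bij \<sigma>"
  shows "(monomial_matrix \<sigma> d ** M) $ (\<sigma> i) $ j = d i * M $ i $ j"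
proof -
  have "(monomial_matrix \<sigma> d ** M) $ (\<sigma> i) $ j = (\<Sum>k\<in>UNIV. (if i = k then d k else 0) * M $ k $ j)"
    unfolding monomial_matrix_def matrix_matrix_mult_def
    using assms by (auto simp: bij_def inj_eq)
  then show ?thesis by (simp add: if_distrib[of "\<lambda>z. z * _"] cong: if_cong)
qed

lemma monomial_mult_right: "(M ** monomial_matrix \<sigma> d) $ i $ j = M $ i $ \<sigma> j * d j"
  unfolding monomial_matrix_def matrix_matrix_mult_def
  by (simp add: if_distrib[of "\<lambda>x. _ * x"] cong: if_cong)

lemma det_monomial_nz:
  assumes "bij \<sigma>" "\<And>j. d j \<noteq> 0"
  shows "det (monomial_matrix \<sigma> d) \<noteq> 0"
proof -
  define N :: "'a cmat" where "N = (\<chi> i j. if j = \<sigma> i then 1 / d i else 0)"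
  have "(monomial_matrix \<sigma> d ** N) $ k $ j = mat 1 $ k $ j" for k j
  proof -
    obtain i where i: "k = \<sigma> i" using assms(1) by (metis bij_pointE)
    show ?thesis
      unfolding i by (subst monomial_mult_left[OF assms(1)]) (auto simp: mat_def assms(2) N_def)
  qed
  then have "monomial_matrix \<sigma> d ** N = mat 1" by (simp add: vec_eq_iff)
  from arg_cong[OF this, of det] show ?thesis by (auto simp: det_mul det_I)
qed

lemma act_monomial_base:
  assumes w: "w permutes {1..CARD('n)}" and d: "\<And>j. d j \<noteq> 0"
  shows "act (monomial_matrix (index_perm w) d) base_flag = (coordinate_flag w :: 'n::{finite,linorder} flag)"
proof
  fix p
  let ?\<sigma> = "index_perm w :: 'n \<Rightarrow> 'n"
  have bij: "bij ?\<sigma>" using w by (rule bij_index_perm)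
  have I: "idx ` w ` {1..min p CARD('n)} = ?\<sigma> ` {j. pos j \<le> p}"
    unfolding idx_image_prefix[symmetric] by (force simp: index_perm_def image_image image_iff)
  show "act (monomial_matrix ?\<sigma> d) base_flag p = (coordinate_flag w p :: (complex, 'n) vec set)"
    unfolding act_def base_flag_eq coordinate_flag_eq I
  proof (intro equalityI subsetI CollectI allI impI)
    fix v j assume v: "v \<in> (*v) (monomial_matrix ?\<sigma> d) ` prefix_space p" and j: "j \<notin> ?\<sigma> ` {j. pos j \<le> p}"
    obtain k where k: "j = ?\<sigma> k" using bij by (metis bij_pointE)
    then have "p < pos k" using j by auto
    then show "v $ j = 0" using v by (auto simp: k monomial_mult_vec[OF bij] prefix_space_def)
  next
    fix v :: "(complex, 'n) vec" assume v: "v \<in> {v. \<forall>j. j \<notin> ?\<sigma> ` {j. pos j \<le> p} \<longrightarrow> v $ j = 0}"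
    define x where "x = (\<chi> j. v $ ?\<sigma> j / d j)"
    have "(monomial_matrix ?\<sigma> d *v x) $ k = v $ k" for k
    proof -
      obtain i where "k = ?\<sigma> i" using bij by (metis bij_pointE)
      then show ?thesis by (simp add: monomial_mult_vec[OF bij] x_def d)
    qed
    then have "v = monomial_matrix ?\<sigma> d *v x" by (simp add: vec_eq_iff)
    moreover have "x \<in> prefix_space p"
    proof -
      have "v $ ?\<sigma> j = 0" if "p < pos j" for j
      proof -
        have "?\<sigma> j \<notin> ?\<sigma> ` {j. pos j \<le> p}" using that bij by (auto simp: bij_def inj_eq)
        then show ?thesis using v by blast
      qed
      then show ?thesis by (auto simp: prefix_space_def x_def)
    qed
    ultimately show "v \<in> (*v) (monomial_matrix ?\<sigma> d) ` prefix_space p" by blast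
  qed
qed

abbreviation perm_mat :: "(nat \<Rightarrow> nat) \<Rightarrow> 'n::{finite,linorder} cmat" where
  "perm_mat w \<equiv> monomial_matrix (index_perm w) (\<lambda>_. 1)"

definition diag_scale :: "complex \<Rightarrow> 'n::{finite,linorder} cmat" where
  "diag_scale c = (\<chi> i j. if i = j then if pos i = 1 then c else 1 else 0)"

lemma det_diag_scale: "det (diag_scale c :: 'n::{finite,linorder} cmat) = c"
proof -
  have "det (diag_scale c :: 'n cmat) = (\<Prod>i\<in>UNIV. if i = idx 1 then c else 1)"
  proof -
    have "pos i = 1 \<longleftrightarrow> i = idx 1" for i :: 'n
    proof -
      have "1 \<le> CARD('n)" by (simp add: Suc_le_eq)
      then have "pos (idx 1 :: 'n) = 1" by (intro pos_idx) auto
      then show ?thesis by (metis pos_eq_iff)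
    qed
    then have "(diag_scale c :: 'n cmat) $ i $ i = (if i = idx 1 then c else 1)" for i
      by (simp add: diag_scale_def)
    moreover have "det (diag_scale c :: 'n cmat) = (\<Prod>i\<in>UNIV. (diag_scale c :: 'n cmat) $ i $ i)"
      by (rule det_diagonal) (simp add: diag_scale_def)
    ultimately show ?thesis by simp
  qed
  then show ?thesis by simp
qed

lemma diag_scale_upper: "diag_scale c \<in> upper"
  by (auto simp: diag_scale_def upper_def)

lemma act_diag_scale_coordinate:
  assumes "w permutes {1..CARD('n)}" "c \<noteq> 0"
  shows "act (diag_scale c) (coordinate_flag w) = (coordinate_flag w :: 'n::{finite,linorder} flag)"
proof -
  let ?d = "\<lambda>j::'n. if pos (index_perm w j) = 1 then c else 1"
  have "diag_scale c ** perm_mat w = monomial_matrix (index_perm w) ?d"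
    by (simp add: vec_eq_iff monomial_mult_right) (auto simp: diag_scale_def monomial_matrix_def)
  then have "act (diag_scale c) (act (perm_mat w) base_flag) = act (monomial_matrix (index_perm w) ?d) base_flag"
    by (simp add: act_act)
  then show ?thesis
    using act_monomial_base[OF assms(1), of ?d] act_monomial_base[OF assms(1), of "\<lambda>_. 1"] assms(2)
    by simp
qed

lemma mem_schubert_cell:
  assumes "w permutes {1..CARD('n)}"
  shows "(F :: 'n::{finite,linorder} flag) \<in> schubert_cell w \<longleftrightarrow>
    (\<exists>b\<in>upper. det b \<noteq> 0 \<and> F = act b (coordinate_flag w))"
proof
  assume "F \<in> schubert_cell w"
  then show "\<exists>b\<in>upper. det b \<noteq> 0 \<and> F = act b (coordinate_flag w)"
    by (force simp: schubert_cell_def orbit_def Borel_def SL_C_def upper_def)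
next
  assume "\<exists>b\<in>upper. det b \<noteq> 0 \<and> F = act b (coordinate_flag w)"
  then obtain b where b: "b \<in> upper" "det b \<noteq> 0" "F = act b (coordinate_flag w)" by blast
  have "b ** diag_scale (1 / det b) \<in> Borel"
    using upper_mult[OF b(1) diag_scale_upper] b(2)
    by (simp add: Borel_def SL_C_def det_mul det_diag_scale upper_def)
  moreover have "F = act (b ** diag_scale (1 / det b)) (coordinate_flag w)"
    using act_diag_scale_coordinate[OF assms, of "1 / det b"] b by (metis act_act divide_eq_0_iff one_neq_zero)
  ultimately show "F \<in> schubert_cell w" unfolding schubert_cell_def orbit_def by blast
qed

lemma perm_mat_base:
  assumes "w permutes {1..CARD('n)}"
  shows "act (perm_mat w) base_flag = (coordinate_flag w :: 'n::{finite,linorder} flag)"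
  using act_monomial_base[OF assms, of "\<lambda>_. 1"] by simp

lemma det_perm_mat:
  assumes "w permutes {1..CARD('n)}"
  shows "det (perm_mat w :: 'n::{finite,linorder} cmat) \<noteq> 0"
  using det_monomial_nz[OF bij_index_perm[OF assms]] by simp

lemma prefix_top: "q \<ge> CARD('n) \<Longrightarrow> prefix_space q = (UNIV :: (complex, 'n::{finite,linorder}) vec set)"
  by (auto simp: prefix_space_def dest: less_le_trans[OF _ pos_le] )

lemma prefix_zero: "prefix_space 0 = {0 :: (complex, 'n::{finite,linorder}) vec}"
proof -
  have "0 < pos j" for j :: 'n using pos_ge_1[of j] by simp
  then show ?thesis by (auto simp: prefix_space_def vec_eq_iff)
qed

lemma flags_mono:
  assumes "F \<in> (flags :: 'n::finite flag set)" "p \<le> q" "q \<le> CARD('n)"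
  shows "F p \<subseteq> F q"
  using assms(2,3)
proof (induction q rule: dec_induct)
  case (step q)
  then have "F q \<subseteq> F (Suc q)" using assms(1) by (simp add: flags_def)
  then show ?case using step by simp
qed simp

lemma flags_eqI:
  assumes F: "F \<in> (flags :: 'n::finite flag set)" and G: "G \<in> flags" and sub: "\<And>p. p \<le> CARD('n) \<Longrightarrow> F p \<subseteq> G p"
  shows "F = G"
proof
  fix p show "F p = G p"
  proof (cases "p \<le> CARD('n)")
    case True
    have "vec.subspace (F p)" "vec.subspace (G p)" "vec.dim (F p) = p" "vec.dim (G p) = p"
      using F G True by (simp_all add: flags_def)
    then show ?thesis using vec.subspace_dim_equal[OF _ _ sub[OF True]] by simp
  next
    case False
    then show ?thesis using F G by (simp add: flags_def)
  qed
qed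

lemma flags_step:
  assumes F: "F \<in> (flags :: 'n::finite flag set)" and p: "1 \<le> p" "p \<le> CARD('n)"
  shows "\<exists>x. x \<in> F p \<and> x \<notin> F (p - 1)"
proof -
  have "vec.dim (F p) = p" "vec.dim (F (p - 1)) = p - 1" using F p by (simp_all add: flags_def)
  then have "\<not> F p \<subseteq> F (p - 1)" using p vec.dim_subset[of "F p" "F (p - 1)"] by auto
  then show ?thesis by blast
qed

lemma matrix_of_columns_flag:
  fixes g :: "'n::{finite,linorder} cmat"
  assumes F: "F \<in> flags" and det: "det g \<noteq> 0" and col: "\<And>j. column j g \<in> F (pos j)"
  shows "act g base_flag = F"
proof (rule flags_eqI)
  show "act g base_flag \<in> flags" using act_flags[OF det prefix_space_flags] by (simp add: base_flag_eq)
  show "F \<in> flags" by fact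
  fix p assume p: "p \<le> CARD('n)"
  show "act g base_flag p \<subseteq> F p"
  proof
    fix y assume "y \<in> act g base_flag p"
    then obtain x where x: "x \<in> prefix_space p" "y = g *v x" by (auto simp: act_def base_flag_eq)
    have sub: "vec.subspace (F p)" using F p by (auto simp: flags_def)
    have "y = (\<Sum>j\<in>UNIV. x $ j *s column j g)" by (simp add: x matrix_mult_sum)
    also have "\<dots> \<in> F p"
    proof (rule vec.subspace_sum[OF sub])
      fix j
      show "x $ j *s column j g \<in> F p"
      proof (cases "pos j \<le> p")
        case True
        then have "column j g \<in> F p" using col[of j] flags_mono[OF F True p] by blast
        then show ?thesis by (rule vec.subspace_scale[OF sub])
      next
        case False
        then have "x $ j = 0" using x by (simp add: prefix_space_def)
        then show ?thesis using vec.subspace_0[OF sub] by simp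
      qed
    qed
    finally show "y \<in> F p" .
  qed
qed

text \<open>
For each \<open>p\<close> a vector of \<open>V\<^sub>p\<close> outside \<open>V\<^bsub>p-1\<^esub>\<close> is chosen whose last nonzero coordinate comes as early
as possible.  The positions of these coordinates are distinct, so they form a permutation, and the
vectors are the columns of an upper triangular matrix in permuted order.
\<close>

theorem bruhat_decomposition:
  assumes F: "F \<in> (flags :: 'n::{finite,linorder} flag set)"
  obtains v b where "v permutes {1..CARD('n)}" "b \<in> upper" "det b \<noteq> 0" "F = act b (coordinate_flag v)"
proof -
  let ?n = "CARD('n)"
  define L where "L p = (LEAST q. \<exists>x\<in>F p - F (p - 1). x \<in> prefix_space q)" for p
  have ex: "\<exists>q. \<exists>x\<in>F p - F (p - 1). x \<in> prefix_space q" if "p \<in> {1..?n}" for p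
  proof -
    have "1 \<le> p" "p \<le> ?n" using that by simp_all
    then obtain x where "x \<in> F p" "x \<notin> F (p - 1)" using flags_step[OF F] by blast
    then show ?thesis using prefix_top[of ?n, where 'n='n] by blast
  qed
  have "\<exists>x. x \<in> F p \<and> x \<notin> F (p - 1) \<and> x \<in> prefix_space (L p)" if "p \<in> {1..?n}" for p
    using LeastI_ex[OF ex[OF that]] unfolding L_def by blast
  then obtain x where x: "\<And>p. p \<in> {1..?n} \<Longrightarrow> x p \<in> F p \<and> x p \<notin> F (p - 1) \<and> x p \<in> prefix_space (L p)"
    by metis
  have least: "y \<notin> prefix_space q" if "y \<in> F p" "y \<notin> F (p - 1)" "q < L p" for y p q
    using that not_less_Least[of q "\<lambda>q. \<exists>x\<in>F p - F (p - 1). x \<in> prefix_space q"] unfolding L_def by blast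
  have subsp: "vec.subspace (F p)" if "p \<le> ?n" for p using F that by (auto simp: flags_def)
  have Lin: "L p \<in> {1..?n}" if p: "p \<in> {1..?n}" for p
  proof -
    have "x p \<noteq> 0" using x[OF p] vec.subspace_0[OF subsp[of "p - 1"]] p by auto
    then have "L p \<noteq> 0" using x[OF p] by (metis prefix_zero singletonD)
    moreover have "L p \<le> ?n"
    proof (rule ccontr)
      assume "\<not> L p \<le> ?n"
      then have "x p \<notin> prefix_space ?n" using least x[OF p] by auto
      then show False using prefix_top[of ?n, where 'n='n] by auto
    qed
    ultimately show ?thesis by auto
  qed
  have lead: "x p $ idx (L p) \<noteq> 0" if p: "p \<in> {1..?n}" for p
  proof
    assume 0: "x p $ idx (L p) = 0"
    have "x p \<in> prefix_space (L p - 1)"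
      unfolding prefix_space_def
    proof (intro CollectI allI impI)
      fix j :: 'n assume "L p - 1 < pos j"
      then consider "pos j = L p" | "L p < pos j" using Lin[OF p] by fastforce
      then show "x p $ j = 0"
      proof cases
        case 1 then show ?thesis using 0 by (metis idx_pos)
      next
        case 2 then show ?thesis using x[OF p] by (simp add: prefix_space_def)
      qed
    qed
    moreover have "x p \<notin> prefix_space (L p - 1)" using least[of "x p" p "L p - 1"] x[OF p] Lin[OF p] by auto
    ultimately show False by blast
  qed
  \<comment> \<open>With equal last positions a combination of the two vectors would have an earlier one.\<close>
  have neq: "L r \<noteq> L p" if r: "r \<in> {1..?n}" and p: "p \<in> {1..?n}" and "r < p" for r p
  proof
    assume eq: "L r = L p"
    define c where "c = x p $ idx (L p) / x r $ idx (L p)"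
    define y where "y = x p - c *s x r"
    have le: "p - 1 \<le> ?n" "p \<le> ?n" and rp: "r \<le> p - 1" "r \<le> p" using p \<open>r < p\<close> by simp_all
    have xr: "x r \<in> F (p - 1)" using x[OF r] flags_mono[OF F rp(1) le(1)] by (meson subsetD)
    have "x r \<in> F p" using x[OF r] flags_mono[OF F rp(2) le(2)] by (meson subsetD)
    then have "y \<in> F p" unfolding y_def
      using vec.subspace_diff[OF subsp[OF le(2)]] vec.subspace_scale[OF subsp[OF le(2)]] x[OF p] by blast
    moreover have "y \<notin> F (p - 1)"
    proof
      assume "y \<in> F (p - 1)"
      then have "y + c *s x r \<in> F (p - 1)"
        using vec.subspace_add[OF subsp[OF le(1)]] vec.subspace_scale[OF subsp[OF le(1)] xr] by blast
      then show False using x[OF p] by (simp add: y_def)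
    qed
    ultimately have "y \<notin> prefix_space (L p - 1)" using least[of y p "L p - 1"] Lin[OF p] by auto
    moreover have "y \<in> prefix_space (L p - 1)"
      unfolding prefix_space_def
    proof (intro CollectI allI impI)
      fix j :: 'n assume "L p - 1 < pos j"
      then consider "pos j = L p" | "L p < pos j" using Lin[OF p] by fastforce
      then show "y $ j = 0"
      proof cases
        case 1
        then have "j = idx (L p)" by (metis idx_pos)
        then show ?thesis using lead[OF r] by (simp add: y_def c_def eq)
      next
        case 2 then show ?thesis using x[OF p] x[OF r] by (simp add: y_def prefix_space_def eq)
      qed
    qed
    ultimately show False by blast
  qed
  have inj: "inj_on L {1..?n}" using neq by (metis (no_types) inj_onI linorder_neqE_nat)
  define v where "v k = (if k \<in> {1..?n} then L k else k)" for k
  have v: "v permutes {1..?n}"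
  proof (rule bij_imp_permutes)
    have vL: "v k = L k" if "k \<in> {1..?n}" for k using that by (simp add: v_def)
    have "inj_on v {1..?n}" using inj inj_on_cong[of "{1..?n}" v L] vL by blast
    moreover have "v ` {1..?n} \<subseteq> {1..?n}" using Lin vL by (metis image_subsetI)
    ultimately show "bij_betw v {1..?n} {1..?n}"
      using endo_inj_surj[of "{1..?n}" v] by (simp add: bij_betw_def)
    show "v k = k" if "k \<notin> {1..?n}" for k using that by (simp only: v_def if_False)
  qed
  define b :: "'n cmat" where "b = (\<chi> i j. x (inv v (pos j)) $ i)"
  have bcol: "column (index_perm v j) b = x (pos j)" for j :: 'n
    using pos_index_perm[OF v, of j] permutes_inverses(2)[OF v] by (simp add: column_def b_def vec_eq_iff)
  have inv_in: "inv v (pos j) \<in> {1..?n}" "L (inv v (pos j)) = pos j" for j :: 'n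
  proof -
    show 1: "inv v (pos j) \<in> {1..?n}" using permutes_in_image[OF permutes_inv[OF v]] pos_in by metis
    have "v (inv v (pos j)) = pos j" using permutes_inverses(1)[OF v] by simp
    moreover have "v (inv v (pos j)) = L (inv v (pos j))" using 1 by (simp only: v_def if_True)
    ultimately show "L (inv v (pos j)) = pos j" by simp
  qed
  have bu: "b \<in> upper"
    unfolding upper_def
  proof (intro CollectI allI impI)
    fix i j :: 'n assume "j < i"
    have "x (inv v (pos j)) \<in> prefix_space (pos j)"
      using x[OF inv_in(1)[of j]] inv_in(2)[of j] by simp
    then show "b $ i $ j = 0" using \<open>j < i\<close> by (simp add: b_def prefix_space_def)
  qed
  have bd: "det b \<noteq> 0"
  proof -
    have "x (inv v (pos j)) $ j \<noteq> 0" for j :: 'n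
      using lead[OF inv_in(1)[of j]] inv_in(2)[of j] by simp
    then show ?thesis unfolding upper_diag_nz[OF bu] by (simp add: b_def)
  qed
  have "act (b ** perm_mat v) base_flag = F"
  proof (rule matrix_of_columns_flag[OF F])
    show "det (b ** perm_mat v) \<noteq> 0" using bd det_perm_mat[OF v] by (simp add: det_mul)
    fix j :: 'n
    have "column j (b ** perm_mat v) = x (pos j)"
      unfolding bcol[symmetric] by (simp add: column_def vec_eq_iff monomial_mult_right)
    then show "column j (b ** perm_mat v) \<in> F (pos j)" using x[OF pos_in] by simp
  qed
  then have "F = act b (coordinate_flag v)" using perm_mat_base[OF v] by (metis act_act)
  then show ?thesis using that v bu bd by blast
qed

lemma flags_GL:
  assumes "F \<in> (flags :: 'n::{finite,linorder} flag set)"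
  obtains g where "det g \<noteq> 0" "act g base_flag = F"
proof -
  obtain v b where vb: "v permutes {1..CARD('n)}" "b \<in> upper" "det b \<noteq> 0" "F = act b (coordinate_flag v)"
    by (rule bruhat_decomposition[OF assms])
  show ?thesis
    using that[of "b ** perm_mat v"] det_perm_mat[OF vb(1)] vb perm_mat_base[OF vb(1)]
    by (simp add: det_mul act_act[symmetric])
qed

lemma GL_to_SL:
  assumes "det (g :: 'n::{finite,linorder} cmat) \<noteq> 0"
  shows "g ** diag_scale (1 / det g) \<in> SL_C" "act (g ** diag_scale (1 / det g)) base_flag = act g base_flag"
  using assms by (simp_all add: SL_C_def det_mul det_diag_scale act_mult_upper diag_scale_upper)

lemma act_base_flags: "det g \<noteq> 0 \<Longrightarrow> act g base_flag \<in> flags"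
  by (simp add: base_flag_eq act_flags prefix_space_flags)

lemma schubert_cell_subset_flags:
  assumes w: "w permutes {1..CARD('n)}"
  shows "schubert_cell w \<subseteq> (flags :: 'n::{finite,linorder} flag set)"
proof
  fix F :: "'n flag" assume "F \<in> schubert_cell w"
  then obtain b where "det b \<noteq> 0" "F = act b (coordinate_flag w)"
    unfolding mem_schubert_cell[OF w] by metis
  then show "F \<in> flags" using act_flags coordinate_flag_flags[OF w] by metis
qed

section \<open>Rank inequalities and lengths of permutations\<close>

definition rank_count :: "(nat \<Rightarrow> nat) \<Rightarrow> nat \<Rightarrow> nat \<Rightarrow> nat" where
  "rank_count w p q = card {i \<in> {1..p}. w i \<le> q}"

lemma rank_count_sum: "rank_count w p q = (\<Sum>i=1..p. if w i \<le> q then 1 else 0)"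
  by (simp add: rank_count_def sum.If_cases Int_def conj_commute)

lemma inversions_le: "inversions n w \<le> n * n"
proof -
  have "inversions n w \<le> card ({1..n} \<times> {1..n})"
    unfolding inversions_def by (rule card_mono) auto
  then show ?thesis by (simp add: card_cartesian_product)
qed

text \<open>
The inversions of \<open>v\<close> inject into those of the new permutation without hitting \<open>(a, b)\<close>: a pair with
exactly one of its positions in \<open>{a, b}\<close> whose other position lies between them stays in place, and the
other pairs are moved by the transposition.
\<close>

lemma inversions_swap:
  assumes ab: "1 \<le> a" "a < b" "b \<le> n" and lt: "v a < v b"
    and inj: "inj_on v {1..n}"
    and gap: "\<And>k. a < k \<Longrightarrow> k < b \<Longrightarrow> v k < v a \<or> v b < v k"
  shows "inversions n v < inversions n (v \<circ> Transposition.transpose a b)"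
proof -
  let ?v = "v \<circ> Transposition.transpose a b" and ?t = "Transposition.transpose a b"
  let ?I = "\<lambda>v. {(i, j). 1 \<le> i \<and> i < j \<and> j \<le> n \<and> v j < v i}"
  define f where "f = (\<lambda>(i, j). if (i = a \<and> j < b) \<or> (j = b \<and> a < i) then (i, j) else (?t i, ?t j))"
  have t: "?t x = (if x = a then b else if x = b then a else x)" for x by (simp add: transpose_def)
  have "inj_on f (?I v)"
  proof (rule inj_onI)
    fix x y assume x: "x \<in> ?I v" and y: "y \<in> ?I v" and eq: "f x = f y"
    then show "x = y" using ab gap unfolding f_def t
      by (cases x; cases y) (auto split: if_splits)
  qed
  moreover have "f ` ?I v \<subseteq> ?I ?v - {(a, b)}"
  proof
    fix z assume "z \<in> f ` ?I v"
    then obtain i j where ij: "1 \<le> i" "i < j" "j \<le> n" "v j < v i" and z: "z = f (i, j)" by auto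
    show "z \<in> ?I ?v - {(a, b)}"
      using ij ab lt gap[of i] gap[of j] unfolding z f_def t
      by (auto simp: t split: if_splits)
  qed
  moreover have fin: "finite (?I w)" for w :: "nat \<Rightarrow> nat"
    by (rule finite_subset[of _ "{1..n} \<times> {1..n}"]) auto
  ultimately have "card (?I v) \<le> card (?I ?v - {(a, b)})"
    using card_inj_on_le finite_Diff[OF fin] by blast
  also have "\<dots> < card (?I ?v)"
  proof (rule card_Diff1_less[OF fin])
    show "(a, b) \<in> ?I ?v" using ab lt by (auto simp: t)
  qed
  finally show ?thesis by (simp add: inversions_def)
qed

text \<open>
Rank inequalities bound lengths: this is the part of the tableau criterion for the Bruhat order that
is needed for dimensions.  If \<open>v \<noteq> w\<close>, then \<open>v\<close> can be replaced by a longer permutation for which the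
inequalities still hold.  To find it, let \<open>p\<close> be the first position at which they differ, so that
\<open>v p < w p\<close>, and swap \<open>v p\<close> with the next value of \<open>v\<close> in the interval from \<open>v p\<close> to \<open>w p\<close>.
\<close>

lemma rank_count_mono_inversions:
  assumes "v permutes {1..n}" "w permutes {1..n}"
    and "\<And>p q. p \<le> n \<Longrightarrow> q \<le> n \<Longrightarrow> rank_count w p q \<le> rank_count v p q"
  shows "inversions n v \<le> inversions n w \<and> (inversions n v = inversions n w \<longrightarrow> v = w)"
  using assms(1,3)
proof (induction "n * n - inversions n v" arbitrary: v rule: less_induct)
  case less
  note v = less.prems(1) and le = less.prems(2) and w = assms(2)
  show ?case
  proof (cases "v = w")
    case False
    have "\<exists>p. p \<in> {1..n} \<and> v p \<noteq> w p"
    proof (rule ccontr)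
      assume "\<not> ?thesis"
      then have "v x = w x" for x using permutes_not_in[OF v, of x] permutes_not_in[OF w, of x] by metis
      then show False using False by auto
    qed
    then obtain p where p: "p \<in> {1..n}" "v p \<noteq> w p" and first: "\<And>i. i \<in> {1..n} \<Longrightarrow> i < p \<Longrightarrow> v i = w i"
      using exists_least_iff[of "\<lambda>p. p \<in> {1..n} \<and> v p \<noteq> w p"] by metis
    have injv: "inj_on v {1..n}" and injw: "inj_on w {1..n}" using v w permutes_inj_on by auto
    have vin: "v i \<in> {1..n} \<longleftrightarrow> i \<in> {1..n}" and win: "w i \<in> {1..n} \<longleftrightarrow> i \<in> {1..n}" for i
      using permutes_in_image v w by metis+
    have split: "rank_count u x q = (\<Sum>i\<in>{1..<p}. if u i \<le> q then 1 else 0) + (\<Sum>i\<in>{p..x}. if u i \<le> q then 1 else 0)"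
      if "p \<le> x" for u x q
    proof -
      have "{1..x} = {1..<p} \<union> {p..x}" using p that by auto
      moreover have "{1..<p} \<inter> {p..x} = {}" by auto
      ultimately show ?thesis unfolding rank_count_sum by (simp add: sum.union_disjoint)
    qed
    have pre: "(\<Sum>i\<in>{1..<p}. if v i \<le> q then 1 else 0) = (\<Sum>i\<in>{1..<p}. if w i \<le> q then 1 else (0::nat))" for q
      using first p by (intro sum.cong) auto
    have less: "v p < w p"
    proof (rule ccontr)
      assume "\<not> v p < w p"
      then have "w p < v p" using p by simp
      moreover have "rank_count w p (w p) \<le> rank_count v p (w p)" using le p win[of p] by auto
      ultimately show False using split[of p v "w p"] split[of p w "w p"] pre[of "w p"] by simp
    qed
    obtain j0 where j0: "j0 \<in> {1..n}" "v j0 = w p"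
      using permutes_image[OF v] win[of p] p by (metis imageE)
    have "p < j0"
    proof (rule ccontr)
      assume "\<not> p < j0"
      then have "j0 < p" using j0 p less by (metis less_irrefl linorder_neqE_nat)
      then have "w j0 = w p" using first j0 by metis
      then show False using inj_onD[OF injw, of j0 p] j0 p \<open>j0 < p\<close> by simp
    qed
    then have "\<exists>j. p < j \<and> j \<le> n \<and> v p < v j \<and> v j \<le> w p" using j0 less by auto
    then obtain j where j: "p < j" "j \<le> n" "v p < v j" "v j \<le> w p"
      and minj: "\<And>k. k < j \<Longrightarrow> \<not> (p < k \<and> k \<le> n \<and> v p < v k \<and> v k \<le> w p)"
      using exists_least_iff[of "\<lambda>j. p < j \<and> j \<le> n \<and> v p < v j \<and> v j \<le> w p"] by metis
    have gap: "v k < v p \<or> w p < v k" if "p < k" "k < j" for k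
    proof -
      have "v k \<noteq> v p" using inj_onD[OF injv, of k p] that p j by auto
      moreover have "\<not> (v p < v k \<and> v k \<le> w p)" using minj[of k] that j by simp
      ultimately show ?thesis by linarith
    qed
    \<comment> \<open>By the choice of \<open>j\<close> no value of \<open>v\<close> between \<open>p\<close> and \<open>j\<close> lies in the interval from \<open>v p\<close> to \<open>w p\<close>.  So where the swap lowers a rank of \<open>v\<close>, there is room for it.\<close>
    define v' where "v' = v \<circ> Transposition.transpose p j"
    have v': "v' permutes {1..n}"
      unfolding v'_def using p j v by (intro permutes_compose permutes_swap_id) auto
    have inc: "inversions n v < inversions n v'"
      unfolding v'_def using p j gap by (intro inversions_swap injv) (auto, fastforce)
    have "rank_count w x q \<le> rank_count v' x q" if xq: "x \<le> n" "q \<le> n" for x q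
    proof (cases "p \<le> x \<and> x < j \<and> v p \<le> q \<and> q < v j")
      case False
      have "rank_count v x q \<le> rank_count v' x q"
      proof -
        let ?t = "Transposition.transpose p j"
        define A where "A = {i \<in> {1..x}. v i \<le> q}"
        have "(if x < j then id else ?t) ` A \<subseteq> {i \<in> {1..x}. v' i \<le> q}"
          using False p j unfolding A_def v'_def by (auto simp: Transposition.transpose_def)
        moreover have "inj_on (if x < j then id else ?t) A"
          by (auto simp: inj_on_def Transposition.transpose_def split: if_splits)
        moreover have "finite {i \<in> {1..x}. v' i \<le> q}" by simp
        ultimately show ?thesis unfolding rank_count_def A_def[symmetric]
          using card_inj_on_le by blast
      qed
      then show ?thesis using le[OF xq] by simp
    next
      case True
      have "rank_count v x q = rank_count v' x q + 1"
      proof -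
        have "{i \<in> {1..x}. v i \<le> q} = insert p {i \<in> {1..x}. v' i \<le> q}" "p \<notin> {i \<in> {1..x}. v' i \<le> q}"
          using True p j unfolding v'_def by (auto simp: Transposition.transpose_def)
        then show ?thesis by (simp add: rank_count_def)
      qed
      moreover have "rank_count w x q < rank_count v x q"
      proof -
        have *: "(\<Sum>i\<in>{p..x}. if w i \<le> q then 1 else 0) + 1 + (\<Sum>i\<in>{p..x}. if v i \<le> w p then 1 else 0)
           \<le> (\<Sum>i\<in>{p..x}. if w i \<le> w p then 1 else (0::nat)) + (\<Sum>i\<in>{p..x}. if v i \<le> q then 1 else 0)"
        proof -
          have "(\<Sum>i\<in>{p..x}. if w i \<le> q then 1 else 0) + 1 \<le> (\<Sum>i\<in>{p..x}. if w i \<le> w p then 1 else (0::nat))"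
          proof -
            have "(\<Sum>i\<in>{p..x}. if w i \<le> q then 1 else 0) + 1 = (\<Sum>i\<in>{p..x}. (if w i \<le> q then 1 else 0) + (if i = p then 1 else (0::nat)))"
              using True by (simp add: sum.distrib)
            also have "\<dots> \<le> (\<Sum>i\<in>{p..x}. if w i \<le> w p then 1 else 0)"
              using True j by (intro sum_mono) auto
            finally show ?thesis .
          qed
          moreover have "(\<Sum>i\<in>{p..x}. if v i \<le> w p then 1 else 0) \<le> (\<Sum>i\<in>{p..x}. if v i \<le> q then 1 else (0::nat))"
          proof (rule sum_mono)
            fix i assume "i \<in> {p..x}"
            then show "(if v i \<le> w p then 1 else 0) \<le> (if v i \<le> q then 1 else (0::nat))"
              using gap[of i] True by (cases "i = p") auto
          qed
          ultimately show ?thesis by linarith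
        qed
        have "rank_count w x (w p) \<le> rank_count v x (w p)" using le xq win[of p] p by auto
        then show ?thesis
          using split[of x] True pre[of q] pre[of "w p"] * by (auto simp: split)
      qed
      ultimately show ?thesis by simp
    qed
    then have "inversions n v' \<le> inversions n w"
      using less.hyps[OF _ v'] inc inversions_le[of n v'] by auto
    then show ?thesis using inc by simp
  qed simp
qed

section \<open>Schubert cells and Schubert varieties\<close>

lemma complex_submanifold_linear:
  fixes A :: "'n::{finite,linorder} flag set"
  assumes A: "A \<subseteq> flags"
    and charts: "\<And>p. p \<in> A \<Longrightarrow> \<exists>g\<in>SL_C. act g base_flag = p \<and> {X \<in> strictly_lower. chart_at g X \<in> A} = L"
    and L: "complex_subspace L" "L \<subseteq> strictly_lower" "dim L = 2 * d"
  shows "complex_submanifold d A"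
proof -
  let ?S = "strictly_lower :: 'n cmat set"
  have inv: "inv_into ?S id x = id x" if "x \<in> ?S" for x
    using inv_into_f_f[OF inj_on_id that] by simp
  have hol: "holomorphic_map id ?S"
    unfolding holomorphic_map_def
    by (intro ballI exI[of _ id] conjI has_derivative_id) simp
  have hol': "holomorphic_map (inv_into ?S id) ?S"
    unfolding holomorphic_map_def
  proof (intro ballI exI[of _ id] conjI)
    fix X :: "'n cmat" assume X: "X \<in> ?S"
    show "(inv_into ?S id has_derivative id) (at X within ?S)"
      by (rule has_derivative_transform[OF X inv has_derivative_id])
  qed simp
  have bih: "biholomorphic id ?S ?S"
    unfolding biholomorphic_def using hol hol' by (simp add: bij_betw_def)
  have 0: "0 \<in> ?S" using subspace_strictly_lower subspace_0 by blast
  show ?thesis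
    unfolding complex_submanifold_def
  proof (intro conjI ballI A)
    fix p assume "p \<in> A"
    then obtain g where g: "g \<in> SL_C" "act g base_flag = p" "{X \<in> ?S. chart_at g X \<in> A} = L"
      using charts by blast
    have "id ` {X \<in> ?S. chart_at g X \<in> A} = ?S \<inter> L" using g(3) L(2) by auto
    then show "\<exists>g\<in>SL_C. act g base_flag = p \<and> (\<exists>S S' h L. 0 \<in> S \<and> biholomorphic h S S' \<and>
           complex_subspace L \<and> L \<subseteq> strictly_lower \<and> dim L = 2 * d \<and>
           h ` {X \<in> S. chart_at g X \<in> A} = S' \<inter> L)"
      using g(1,2) L 0 bih by blast
  qed
qed

lemma complex_subspace_entries:
  "complex_subspace {X :: 'n::finite cmat. \<forall>i j. (i, j) \<notin> Q \<longrightarrow> X $ i $ j = 0}"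
  by (simp add: complex_subspace_def subspace_def cscale_def)

text \<open>
If a product of LU form is block triangular for another order of the indices, so are its factors.  With
the order pulled back along \<open>w\<close> this says that the points of a chart that lie in the Schubert cell form
a coordinate subspace.
\<close>

lemma LU_in_ranked_group:
  fixes X b :: "'n::{finite,linorder} cmat" and r :: "'n \<Rightarrow> 'm::linorder"
  assumes X: "X \<in> strictly_lower" and b: "b \<in> upper" "det b \<noteq> 0"
    and c: "\<And>i j. ((mat 1 + X) ** b) $ i $ j \<noteq> 0 \<Longrightarrow> r i \<le> r j"
  shows "(j < i \<longrightarrow> X $ i $ j \<noteq> 0 \<longrightarrow> r i \<le> r j) \<and> (b $ i $ j \<noteq> 0 \<longrightarrow> r i \<le> r j)"
proof (induction "min (pos i) (pos j)" arbitrary: i j rule: less_induct)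
  case less
  have ent: "((mat 1 + X) ** b) $ i $ j = b $ i $ j + (\<Sum>k\<in>UNIV. X $ i $ k * b $ k $ j)"
    by (simp add: matrix_matrix_mult_def mat_def distrib_right sum.distrib if_distrib[of "\<lambda>z. z * _"] cong: if_cong)
  have small: "X $ i $ k * b $ k $ j = 0 \<or> r i \<le> r j" if "k < i" "k < j" for k
  proof (rule disjCI)
    assume nr: "\<not> r i \<le> r j"
    have 1: "X $ i $ k \<noteq> 0 \<longrightarrow> r i \<le> r k" using less[of i k] that by simp
    have 2: "b $ k $ j \<noteq> 0 \<longrightarrow> r k \<le> r j" using less[of k j] that by simp
    show "X $ i $ k * b $ k $ j = 0" using 1 2 nr by (metis mult_eq_0_iff order_trans)
  qed
  show ?case
  proof (cases "r i \<le> r j")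
    case True then show ?thesis by simp
  next
    case False
    then have c0: "((mat 1 + X) ** b) $ i $ j = 0" using c by blast
    show ?thesis
    proof (cases "j < i")
      case True
      have z: "b $ i $ j = 0" using b True by (simp add: upper_def)
      have "(\<Sum>k\<in>UNIV. X $ i $ k * b $ k $ j) = (\<Sum>k\<in>{j}. X $ i $ k * b $ k $ j)"
      proof (rule sum.mono_neutral_right)
        show "\<forall>k\<in>UNIV - {j}. X $ i $ k * b $ k $ j = 0"
        proof
          fix k assume "k \<in> UNIV - {j}"
          then consider "k < j" | "j < k" by fastforce
          then show "X $ i $ k * b $ k $ j = 0"
          proof cases
            case 1 then show ?thesis using small[of k] True False by simp
          next
            case 2 then show ?thesis using b by (simp add: upper_def)
          qed
        qed
      qed auto
      then have "X $ i $ j * b $ j $ j = 0" using ent c0 z by simp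
      moreover have "b $ j $ j \<noteq> 0" using b upper_diag_nz by blast
      ultimately show ?thesis using z by simp
    next
      case nlt: False
      have "(\<Sum>k\<in>UNIV. X $ i $ k * b $ k $ j) = 0"
      proof (rule sum.neutral, rule ballI)
        fix k
        show "X $ i $ k * b $ k $ j = 0"
        proof (cases "k < i")
          case True then show ?thesis using small[of k] nlt False by simp
        next
          case False then show ?thesis using X by (simp add: strictly_lower_def)
        qed
      qed
      then show ?thesis using ent c0 nlt by simp
    qed
  qed
qed

text \<open>
The matrix positions in which the chart coordinates of a Schubert cell are free.
\<close>

definition cell_directions :: "(nat \<Rightarrow> nat) \<Rightarrow> ('n::{finite,linorder} \<times> 'n) set" where
  "cell_directions w = {(i, j). j < i \<and> index_perm w i < index_perm w j}"

lemma cell_chart: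
  fixes b X :: "'n::{finite,linorder} cmat"
  assumes w: "w permutes {1..CARD('n)}" and b: "b \<in> upper" "det b \<noteq> 0" and X: "X \<in> strictly_lower"
    and d: "\<And>j. d j \<noteq> 0"
  shows "chart_at (b ** monomial_matrix (index_perm w) d) X \<in> schubert_cell w \<longleftrightarrow>
    (\<forall>i j. (i, j) \<notin> cell_directions w \<longrightarrow> X $ i $ j = 0)"
proof -
  let ?\<sigma> = "index_perm w :: 'n \<Rightarrow> 'n"
  let ?M = "monomial_matrix ?\<sigma> d"
  have bij: "bij ?\<sigma>" by (rule bij_index_perm[OF w])
  have detM: "det ?M \<noteq> 0" by (rule det_monomial_nz[OF bij d])
  have base: "act ?M base_flag = coordinate_flag w" by (rule act_monomial_base[OF w d])
  have cell: "act (b' ** ?M) base_flag \<in> schubert_cell w" if "b' \<in> upper" "det b' \<noteq> 0" for b'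
    unfolding mem_schubert_cell[OF w] act_act[symmetric] base using that by blast
  show ?thesis
  proof
    assume "chart_at (b ** ?M) X \<in> schubert_cell w"
    then obtain b1 where b1: "b1 \<in> upper" "det b1 \<noteq> 0" "act (b ** ?M ** (mat 1 + X)) base_flag = act (b1 ** ?M) base_flag"
      unfolding mem_schubert_cell[OF w] chart_at_def act_act[symmetric] base by blast
    have nz: "det (b ** ?M ** (mat 1 + X)) \<noteq> 0" "det (b1 ** ?M) \<noteq> 0"
      using b b1 detM unit_lower_det[OF X] by (simp_all add: det_mul)
    obtain b2 where b2: "b2 \<in> upper" "det b2 \<noteq> 0" "b1 ** ?M = b ** ?M ** (mat 1 + X) ** b2"
      using act_base_eqE[OF nz b1(3)] by metis
    define b3 where "b3 = matrix_inv b ** b1"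
    have b3: "b3 \<in> upper" unfolding b3_def by (intro upper_mult upper_inv b b1)
    have "?M ** ((mat 1 + X) ** b2) = matrix_inv b ** b ** ?M ** (mat 1 + X) ** b2"
      by (simp add: det_inv_props b matrix_mul_assoc)
    also have "\<dots> = matrix_inv b ** (b1 ** ?M)" by (simp only: b2(3) matrix_mul_assoc)
    finally have eq: "?M ** ((mat 1 + X) ** b2) = b3 ** ?M" by (simp add: b3_def matrix_mul_assoc)
    have "?\<sigma> i \<le> ?\<sigma> j" if "((mat 1 + X) ** b2) $ i $ j \<noteq> 0" for i j
    proof -
      have "d i * ((mat 1 + X) ** b2) $ i $ j = b3 $ ?\<sigma> i $ ?\<sigma> j * d j"
        using eq monomial_mult_left[OF bij, of d "(mat 1 + X) ** b2" i j] monomial_mult_right[of b3 ?\<sigma> d "?\<sigma> i" j] by simp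
      then have "b3 $ ?\<sigma> i $ ?\<sigma> j \<noteq> 0" using that d by (metis mult_eq_0_iff)
      then show ?thesis using b3 unfolding upper_def by (metis (mono_tags, lifting) mem_Collect_eq not_le_imp_less)
    qed
    from LU_in_ranked_group[of X b2 ?\<sigma>, OF X b2(1,2) this]
    have le: "j < i \<Longrightarrow> X $ i $ j \<noteq> 0 \<Longrightarrow> ?\<sigma> i \<le> ?\<sigma> j" for i j by blast
    show "\<forall>i j. (i, j) \<notin> cell_directions w \<longrightarrow> X $ i $ j = 0"
    proof (intro allI impI)
      fix i j :: 'n assume n: "(i, j) \<notin> cell_directions w"
      show "X $ i $ j = 0"
      proof (cases "j < i")
        case True
        then have "?\<sigma> i \<noteq> ?\<sigma> j" using bij by (simp add: bij_def inj_eq)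
        then show ?thesis using le[OF True] n True by (fastforce simp: cell_directions_def)
      next
        case False then show ?thesis using X by (simp add: strictly_lower_def)
      qed
    qed
  next
    assume X0: "\<forall>i j. (i, j) \<notin> cell_directions w \<longrightarrow> X $ i $ j = 0"
    let ?i = "inv ?\<sigma>"
    have inv: "?i (?\<sigma> k) = k" "?\<sigma> (?i k) = k" for k
      using bij by (simp_all add: bij_def inv_f_f surj_f_inv_f)
    define b' :: "'n cmat" where "b' = (\<chi> i j. d (?i i) * (mat 1 + X) $ ?i i $ ?i j / d (?i j))"
    have "b' \<in> upper"
      unfolding upper_def
    proof (intro CollectI allI impI)
      fix i j :: 'n assume "j < i"
      then have "(?i i, ?i j) \<notin> cell_directions w" by (auto simp: cell_directions_def inv)
      then have "X $ ?i i $ ?i j = 0" using X0 by blast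
      moreover have "?i i \<noteq> ?i j"
      proof
        assume "?i i = ?i j"
        then have "?\<sigma> (?i i) = ?\<sigma> (?i j)" by simp
        then show False using \<open>j < i\<close> unfolding inv(2) by simp
      qed
      ultimately show "b' $ i $ j = 0" by (simp add: b'_def mat_def)
    qed
    have "(?M ** (mat 1 + X)) $ k $ j = (b' ** ?M) $ k $ j" for k j
    proof -
      have "(?M ** (mat 1 + X)) $ ?\<sigma> (?i k) $ j = d (?i k) * (mat 1 + X) $ ?i k $ j"
        by (rule monomial_mult_left[OF bij])
      moreover have "(b' ** ?M) $ k $ j = b' $ k $ ?\<sigma> j * d j" by (rule monomial_mult_right)
      ultimately show ?thesis by (simp add: b'_def inv d)
    qed
    then have eq: "?M ** (mat 1 + X) = b' ** ?M" by (simp add: vec_eq_iff)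
    from arg_cong[OF eq, of det] have "det b' \<noteq> 0" using detM by (auto simp: det_mul unit_lower_det[OF X])
    have "act (b ** b' ** ?M) base_flag \<in> schubert_cell w"
      by (rule cell) (use b \<open>b' \<in> upper\<close> \<open>det b' \<noteq> 0\<close> upper_mult in \<open>simp_all add: det_mul\<close>)
    then show "chart_at (b ** ?M) X \<in> schubert_cell w"
      by (simp add: chart_at_def matrix_mul_assoc[symmetric] eq)
  qed
qed

lemma card_cell_directions:
  assumes w: "w permutes {1..CARD('n)}"
  shows "card (cell_directions w :: ('n::{finite,linorder} \<times> 'n) set) = inversions CARD('n) w"
proof -
  let ?f = "\<lambda>(i::'n, j::'n). (pos j, pos i)"
  have "?f ` cell_directions w = {(i, j). 1 \<le> i \<and> i < j \<and> j \<le> CARD('n) \<and> w j < w i}"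
  proof (intro equalityI subsetI)
    fix z assume "z \<in> ?f ` cell_directions w"
    then obtain i j :: 'n where z: "z = (pos j, pos i)" "j < i" "index_perm w i < index_perm w j"
      by (auto simp: cell_directions_def)
    then have "w (pos i) < w (pos j)" by (metis pos_index_perm[OF w] pos_less_iff)
    then show "z \<in> {(i, j). 1 \<le> i \<and> i < j \<and> j \<le> CARD('n) \<and> w j < w i}"
      using z pos_ge_1[of j] pos_le[of i] by simp
  next
    fix z assume "z \<in> {(i, j). 1 \<le> i \<and> i < j \<and> j \<le> CARD('n) \<and> w j < w i}"
    then obtain a c where z: "z = (a, c)" and ac: "1 \<le> a" "a < c" "c \<le> CARD('n)" "w c < w a" by blast
    define i j where "i = (idx c :: 'n)" and "j = (idx a :: 'n)"
    have p: "pos i = c" "pos j = a" using ac by (simp_all add: i_def j_def)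
    have "j < i" using p ac(2) by (metis pos_less_iff)
    moreover have "index_perm w i < index_perm w j" using p ac(4) by (metis pos_index_perm[OF w] pos_less_iff)
    ultimately have "(i, j) \<in> cell_directions w" by (simp add: cell_directions_def)
    then show "z \<in> ?f ` cell_directions w" using p z by force
  qed
  moreover have "inj_on ?f (cell_directions w)" by (auto simp: inj_on_def)
  ultimately show ?thesis using card_image[of ?f "cell_directions w"] by (simp add: inversions_def)
qed

lemma schubert_cell_submanifold:
  assumes w: "w permutes {1..CARD('n)}"
  shows "complex_submanifold (inversions CARD('n) w) (schubert_cell w :: 'n::{finite,linorder} flag set)"
proof (rule complex_submanifold_linear[where L = "{X. \<forall>i j. (i, j) \<notin> cell_directions w \<longrightarrow> X $ i $ j = 0}"])
  show "schubert_cell w \<subseteq> (flags :: 'n flag set)" by (rule schubert_cell_subset_flags[OF w])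
  show "complex_subspace {X :: 'n cmat. \<forall>i j. (i, j) \<notin> cell_directions w \<longrightarrow> X $ i $ j = 0}"
    by (rule complex_subspace_entries)
  show lower: "{X :: 'n cmat. \<forall>i j. (i, j) \<notin> cell_directions w \<longrightarrow> X $ i $ j = 0} \<subseteq> strictly_lower"
  proof
    fix X :: "'n cmat" assume X: "X \<in> {X. \<forall>i j. (i, j) \<notin> cell_directions w \<longrightarrow> X $ i $ j = 0}"
    have "(i, j) \<notin> cell_directions w" if "i \<le> j" for i j :: 'n using that by (auto simp: cell_directions_def)
    then show "X \<in> strictly_lower" using X by (simp add: strictly_lower_def)
  qed
  show "dim {X :: 'n cmat. \<forall>i j. (i, j) \<notin> cell_directions w \<longrightarrow> X $ i $ j = 0} = 2 * inversions CARD('n) w"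
    by (simp only: dim_entries card_cell_directions[OF w])
  fix p :: "'n flag" assume "p \<in> schubert_cell w"
  then obtain b where b: "b \<in> upper" "det b \<noteq> 0" "p = act b (coordinate_flag w)"
    unfolding mem_schubert_cell[OF w] by blast
  define g0 where "g0 = b ** perm_mat w"
  have g0: "det g0 \<noteq> 0" "act g0 base_flag = p"
    using b det_perm_mat[OF w] perm_mat_base[OF w] by (simp_all add: g0_def det_mul act_act[symmetric])
  define c where "c = 1 / det g0"
  have c: "c \<noteq> 0" using g0 by (simp add: c_def)
  define d where "d j = (if pos j = 1 then c else 1)" for j :: 'n
  have d: "d j \<noteq> 0" for j using c by (simp add: d_def)
  have "perm_mat w ** diag_scale c = monomial_matrix (index_perm w) d"
  proof -
    have "(perm_mat w ** diag_scale c) $ i $ j = monomial_matrix (index_perm w) d $ i $ j" for i j :: 'n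
    proof -
      have "(perm_mat w ** diag_scale c) $ i $ j = (\<Sum>k\<in>UNIV. if k = j then (if i = index_perm w k then d k else 0) else 0)"
        unfolding matrix_matrix_mult_def monomial_matrix_def diag_scale_def d_def vec_lambda_beta
        by (rule sum.cong) simp_all
      then show ?thesis by (simp add: monomial_matrix_def)
    qed
    then show ?thesis by (simp add: vec_eq_iff)
  qed
  then have g: "g0 ** diag_scale c = b ** monomial_matrix (index_perm w) d"
    by (simp add: g0_def matrix_mul_assoc[symmetric])
  show "\<exists>g\<in>SL_C. act g base_flag = p \<and>
     {X \<in> strictly_lower. chart_at g X \<in> schubert_cell w} = {X. \<forall>i j. (i, j) \<notin> cell_directions w \<longrightarrow> X $ i $ j = 0}"
  proof (intro bexI conjI)
    show "g0 ** diag_scale c \<in> SL_C" "act (g0 ** diag_scale c) base_flag = p"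
      using GL_to_SL[OF g0(1)] g0(2) by (simp_all add: c_def)
    show "{X \<in> strictly_lower. chart_at (g0 ** diag_scale c) X \<in> schubert_cell w} = {X. \<forall>i j. (i, j) \<notin> cell_directions w \<longrightarrow> X $ i $ j = 0}"
      unfolding g
    proof (intro equalityI subsetI)
      fix X assume "X \<in> {X \<in> strictly_lower. chart_at (b ** monomial_matrix (index_perm w) d) X \<in> schubert_cell w}"
      then have X: "X \<in> strictly_lower" "chart_at (b ** monomial_matrix (index_perm w) d) X \<in> schubert_cell w" by auto
      show "X \<in> {X. \<forall>i j. (i, j) \<notin> cell_directions w \<longrightarrow> X $ i $ j = 0}"
        using X(2) unfolding cell_chart[OF w b(1,2) X(1) d] by simp
    next
      fix X :: "'n cmat" assume X: "X \<in> {X. \<forall>i j. (i, j) \<notin> cell_directions w \<longrightarrow> X $ i $ j = 0}"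
      then have "X \<in> strictly_lower" using lower by blast
      then show "X \<in> {X \<in> strictly_lower. chart_at (b ** monomial_matrix (index_perm w) d) X \<in> schubert_cell w}"
        using X cell_chart[OF w b(1,2) \<open>X \<in> strictly_lower\<close> d] by simp
    qed
  qed
qed

lemma flags_submanifold:
  "complex_submanifold (card {(i::'n::{finite,linorder}, j::'n). j < i}) (flags :: 'n flag set)"
proof (rule complex_submanifold_linear[where L = "{X. \<forall>i j. (i, j) \<notin> {(i, j). j < i} \<longrightarrow> X $ i $ j = 0}"])
  have L: "{X :: 'n cmat. \<forall>i j. (i, j) \<notin> {(i, j). j < i} \<longrightarrow> X $ i $ j = 0} = strictly_lower"
    by (simp add: strictly_lower_def not_less)
  then show "{X :: 'n cmat. \<forall>i j. (i, j) \<notin> {(i, j). j < i} \<longrightarrow> X $ i $ j = 0} \<subseteq> strictly_lower" by simp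
  show "complex_subspace {X :: 'n cmat. \<forall>i j. (i, j) \<notin> {(i, j). j < i} \<longrightarrow> X $ i $ j = 0}"
    by (rule complex_subspace_entries)
  show "dim {X :: 'n cmat. \<forall>i j. (i, j) \<notin> {(i, j). j < i} \<longrightarrow> X $ i $ j = 0} = 2 * card {(i::'n, j::'n). j < i}"
    by (rule dim_entries)
  fix p assume "p \<in> (flags :: 'n flag set)"
  then obtain g0 :: "'n cmat" where g0: "det g0 \<noteq> 0" "act g0 base_flag = p" using flags_GL by metis
  define g where "g = g0 ** diag_scale (1 / det g0)"
  have g: "g \<in> SL_C" "act g base_flag = p" using GL_to_SL[OF g0(1)] g0(2) by (simp_all add: g_def)
  have "det (g ** (mat 1 + X)) \<noteq> 0" if "X \<in> strictly_lower" for X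
    using g(1) unit_lower_det[OF that] by (simp add: det_mul SL_C_def)
  then have "chart_at g X \<in> flags" if "X \<in> strictly_lower" for X
    using that by (simp add: chart_at_def act_base_flags)
  then show "\<exists>g\<in>SL_C. act g base_flag = p \<and>
     {X \<in> strictly_lower. chart_at g X \<in> flags} = {X. \<forall>i j. (i, j) \<notin> {(i, j). j < i} \<longrightarrow> X $ i $ j = 0}"
    unfolding L using g by blast
qed simp

definition flag_dim :: "'n::{finite,linorder} flag \<Rightarrow> nat \<Rightarrow> nat \<Rightarrow> nat" where
  "flag_dim F p q = vec.dim (F p \<inter> prefix_space q)"

lemma flag_dim_upper:
  assumes "b \<in> upper" "det b \<noteq> 0"
  shows "flag_dim (act b F) p q = flag_dim F p q"
proof -
  have inj: "inj ((*v) b)" using assms(2) inj_matrix_vector_mult invertible_det_nz by blast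
  have "act b base_flag = base_flag" using act_upper_base[OF assms(2)] assms(1) by simp
  then have "(*v) b ` prefix_space q = prefix_space q"
    unfolding act_def base_flag_eq by (rule fun_cong)
  then have "act b F p \<inter> prefix_space q = (*v) b ` (F p \<inter> prefix_space q)"
    using image_Int[OF inj] by (simp add: act_def)
  then show ?thesis
    unfolding flag_dim_def using inj_on_subset[OF inj] by (simp add: vec.dim_image_eq)
qed

lemma rank_count_index:
  assumes w: "w permutes {1..CARD('n)}" and p: "p \<le> CARD('n)"
  shows "rank_count w p q = card {j::'n::{finite,linorder}. pos j \<le> p \<and> pos (index_perm w j) \<le> q}"
proof -
  have "pos ` {j::'n. pos j \<le> p \<and> pos (index_perm w j) \<le> q} = {i \<in> {1..p}. w i \<le> q}"
  proof (intro equalityI subsetI)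
    fix i assume i: "i \<in> {i \<in> {1..p}. w i \<le> q}"
    then have "pos (idx i :: 'n) = i" using p by (intro pos_idx) auto
    then show "i \<in> pos ` {j::'n. pos j \<le> p \<and> pos (index_perm w j) \<le> q}"
      using i pos_index_perm[OF w, of "idx i"] by (intro image_eqI[of _ _ "idx i"]) auto
  qed (use pos_ge_1 in \<open>auto simp: pos_index_perm[OF w]\<close>)
  then show ?thesis
    unfolding rank_count_def using card_image[OF inj_pos, of "{j::'n. pos j \<le> p \<and> pos (index_perm w j) \<le> q}"] by simp
qed

lemma flag_dim_coordinate:
  assumes w: "w permutes {1..CARD('n)}" and p: "p \<le> CARD('n)"
  shows "flag_dim (coordinate_flag w :: 'n::{finite,linorder} flag) p q = rank_count w p q"
proof -
  let ?\<sigma> = "index_perm w :: 'n \<Rightarrow> 'n"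
  have I: "idx ` w ` {1..min p CARD('n)} = ?\<sigma> ` {j. pos j \<le> p}"
    unfolding idx_image_prefix[symmetric] by (force simp: index_perm_def image_image image_iff)
  have "coordinate_flag w p \<inter> prefix_space q =
      {v :: (complex, 'n) vec. \<forall>k. k \<notin> ?\<sigma> ` {j. pos j \<le> p \<and> pos (?\<sigma> j) \<le> q} \<longrightarrow> v $ k = 0}"
  proof (intro equalityI subsetI)
    fix v :: "(complex, 'n) vec" assume v: "v \<in> coordinate_flag w p \<inter> prefix_space q"
    have "v $ k = 0" if k: "k \<notin> ?\<sigma> ` {j. pos j \<le> p \<and> pos (?\<sigma> j) \<le> q}" for k
    proof (cases "pos k \<le> q")
      case True
      then have "k \<notin> ?\<sigma> ` {j. pos j \<le> p}" using k by blast
      then show ?thesis using v unfolding coordinate_flag_eq I by blast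
    next
      case False then show ?thesis using v by (simp add: prefix_space_def)
    qed
    then show "v \<in> {v. \<forall>k. k \<notin> ?\<sigma> ` {j. pos j \<le> p \<and> pos (?\<sigma> j) \<le> q} \<longrightarrow> v $ k = 0}" by blast
  next
    fix v :: "(complex, 'n) vec"
    assume v: "v \<in> {v. \<forall>k. k \<notin> ?\<sigma> ` {j. pos j \<le> p \<and> pos (?\<sigma> j) \<le> q} \<longrightarrow> v $ k = 0}"
    have "v $ k = 0" if "k \<notin> ?\<sigma> ` {j. pos j \<le> p} \<or> q < pos k" for k
    proof -
      have "k \<notin> ?\<sigma> ` {j. pos j \<le> p \<and> pos (?\<sigma> j) \<le> q}" using that by auto
      then show ?thesis using v by blast
    qed
    then show "v \<in> coordinate_flag w p \<inter> prefix_space q"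
      unfolding coordinate_flag_eq I prefix_space_def by blast
  qed
  then have "flag_dim (coordinate_flag w :: 'n flag) p q = card (?\<sigma> ` {j. pos j \<le> p \<and> pos (?\<sigma> j) \<le> q})"
    unfolding flag_dim_def by (simp only: dim_coord)
  also have "\<dots> = card {j. pos j \<le> p \<and> pos (?\<sigma> j) \<le> q}"
    using bij_index_perm[OF w] by (intro card_image) (meson bij_is_inj inj_on_subset subset_UNIV)
  finally show ?thesis using rank_count_index[OF w p] by simp
qed

lemma flag_dim_cell:
  assumes w: "w permutes {1..CARD('n)}" and p: "p \<le> CARD('n)" and F: "(F :: 'n::{finite,linorder} flag) \<in> schubert_cell w"
  shows "flag_dim F p q = rank_count w p q"
proof -
  obtain b where "b \<in> upper" "det b \<noteq> 0" "F = act b (coordinate_flag w)"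
    using F unfolding mem_schubert_cell[OF w] by blast
  then show ?thesis by (simp add: flag_dim_upper flag_dim_coordinate[OF w p])
qed

text \<open>
Semicontinuity of \<open>dim (V\<^sub>p \<inter> E\<^sub>q)\<close>: at a given point a minor of size \<open>p - dim (V\<^sub>p \<inter> E\<^sub>q)\<close> with rows
beyond \<open>q\<close> is nonzero.  Where it stays nonzero, its columns span a subspace of \<open>V\<^sub>p\<close> that meets \<open>E\<^sub>q\<close>
only in 0.
\<close>

lemma open_flag_dim_le:
  assumes p: "p \<le> CARD('n)"
  shows "open {g :: 'n::{finite,linorder} cmat. det g \<noteq> 0 \<and> flag_dim (act g base_flag) p q \<le> c}"
proof (subst open_subopen, intro ballI)
  fix g0 :: "'n cmat" assume "g0 \<in> {g. det g \<noteq> 0 \<and> flag_dim (act g base_flag) p q \<le> c}"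
  then have g0: "det g0 \<noteq> 0" "flag_dim (act g0 base_flag) p q \<le> c" by auto
  obtain v b where v: "v permutes {1..CARD('n)}" and b: "b \<in> upper" "det b \<noteq> 0"
    and F: "act g0 base_flag = act b (coordinate_flag v)"
    by (rule bruhat_decomposition[OF act_base_flags[OF g0(1)]])
  let ?\<sigma> = "index_perm v :: 'n \<Rightarrow> 'n"
  have bij: "bij ?\<sigma>" by (rule bij_index_perm[OF v])
  have nz: "det (b ** perm_mat v) \<noteq> 0" using b det_perm_mat[OF v] by (simp add: det_mul)
  have "act (b ** perm_mat v) base_flag = act g0 base_flag"
    by (simp add: F act_act[symmetric] perm_mat_base[OF v])
  then obtain b2 where b2: "b2 \<in> upper" "det b2 \<noteq> 0" "b ** perm_mat v = g0 ** b2"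
    using act_base_eqE[OF g0(1) nz] by metis
  define N where "N g = matrix_inv b ** g ** b2" for g :: "'n cmat"
  have N0: "N g0 = perm_mat v"
    using b2(3) by (simp add: N_def matrix_mul_assoc[symmetric]) (simp add: b2(3)[symmetric] matrix_mul_assoc det_inv_props b)
  define I where "I = {j::'n. pos j \<le> p \<and> q < pos (?\<sigma> j)}"
  \<comment> \<open>the minor of \<open>N g\<close> with columns \<open>I\<close> and rows \<open>?\<sigma> ` I\<close>, completed by the identity\<close>
  define T :: "'n cmat \<Rightarrow> 'n cmat" where
    "T g = (\<chi> i j. if i \<in> I \<and> j \<in> I then N g $ ?\<sigma> i $ j else if i = j then 1 else 0)" for g
  have T0: "T g0 = mat 1"
    unfolding T_def N0 using bij by (simp add: vec_eq_iff monomial_matrix_def mat_def bij_def inj_eq)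
  have contN: "continuous_on UNIV N"
    unfolding N_def by (intro mm.continuous_on continuous_intros)
  have contT: "continuous_on UNIV T"
  proof -
    have "continuous_on UNIV (\<lambda>g. if i \<in> I \<and> j \<in> I then N g $ ?\<sigma> i $ j else if i = j then 1 else 0)" for i j
    proof (cases "i \<in> I \<and> j \<in> I")
      case True
      then show ?thesis by (simp add: contN continuous_on_component)
    next
      case False
      show ?thesis by (simp only: False if_False continuous_on_const)
    qed
    then show ?thesis unfolding T_def by (intro continuous_on_vec_lambda)
  qed
  define U where "U = {g. det g \<noteq> 0} \<inter> T -` {g. det g \<noteq> 0}"
  have "open U" unfolding U_def by (intro open_Int open_det_nz open_vimage contT)
  moreover have "g0 \<in> U" using g0 by (simp add: U_def T0 det_I)
  moreover have "U \<subseteq> {g. det g \<noteq> 0 \<and> flag_dim (act g base_flag) p q \<le> c}"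
  proof
    fix g assume g: "g \<in> U"
    then have dg: "det g \<noteq> 0" and dT: "det (T g) \<noteq> 0" by (auto simp: U_def)
    have "act g base_flag = act b (act (N g) base_flag)"
    proof -
      have "b ** N g = g ** b2" by (simp add: N_def matrix_mul_assoc det_inv_props b)
      then show ?thesis by (simp add: act_act act_mult_upper b2)
    qed
    then have fd: "flag_dim (act g base_flag) p q = flag_dim (act (N g) base_flag) p q"
      by (simp add: flag_dim_upper b)
    have dN: "det (N g) \<noteq> 0" using dg b b2 by (simp add: N_def det_mul det_inv_props)
    have injN: "inj ((*v) (N g))" using dN inj_matrix_vector_mult invertible_det_nz by blast
    let ?P = "act (N g) base_flag p"
    have PF: "vec.subspace ?P" "vec.dim ?P = p" using act_base_flags[OF dN] p by (simp_all add: flags_def)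
    define Z where "Z = {x :: (complex, 'n) vec. \<forall>j. j \<notin> I \<longrightarrow> x $ j = 0}"
    have subZ: "vec.subspace Z" by (simp add: Z_def vec.subspace_def)
    define S where "S = (*v) (N g) ` Z"
    have subS: "vec.subspace S" unfolding S_def by (rule vec.linear_subspace_image) (simp_all add: subZ)
    have dimS: "vec.dim S = card I"
      unfolding S_def using inj_on_subset[OF injN] dim_coord[of I] by (simp add: vec.dim_image_eq Z_def)
    have "Z \<subseteq> prefix_space p" by (auto simp: Z_def prefix_space_def I_def)
    then have SP: "S \<subseteq> ?P" unfolding S_def act_def base_flag_eq by (rule image_mono)
    have "S \<inter> prefix_space q \<subseteq> {0}"
    proof
      fix y assume y: "y \<in> S \<inter> prefix_space q"
      then obtain x where x: "x \<in> Z" "y = N g *v x" by (auto simp: S_def)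
      have "(T g *v x) $ i = 0" for i
      proof (cases "i \<in> I")
        case True
        have "(T g *v x) $ i = (\<Sum>j\<in>UNIV. N g $ ?\<sigma> i $ j * x $ j)"
          unfolding matrix_vector_mult_def using True x(1) by (auto simp: T_def Z_def intro!: sum.cong)
        also have "\<dots> = y $ ?\<sigma> i" by (simp add: x matrix_vector_mult_def)
        also have "\<dots> = 0" using y True by (simp add: I_def prefix_space_def)
        finally show ?thesis .
      next
        case False
        then have "(T g *v x) $ i = (\<Sum>j\<in>UNIV. (if i = j then 1 else 0) * x $ j)"
          unfolding matrix_vector_mult_def by (simp add: T_def)
        also have "\<dots> = x $ i" by (simp add: if_distrib[of "\<lambda>z. z * _"] cong: if_cong)
        finally show ?thesis using False x(1) by (simp add: Z_def)
      qed
      then have "T g *v x = T g *v 0" by (simp add: vec_eq_iff)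
      moreover have "inj ((*v) (T g))" using dT inj_matrix_vector_mult invertible_det_nz by blast
      ultimately have "x = 0" using injD[of "(*v) (T g)" x 0] by blast
      then show "y \<in> {0}" by (simp add: x)
    qed
    then have int0: "vec.dim (S \<inter> (?P \<inter> prefix_space q)) = 0"
      using vec.dim_eq_0 by (metis (no_types, lifting) inf.coboundedI2 inf_commute inf_left_commute)
    have "vec.dim {x + y | x y. x \<in> S \<and> y \<in> ?P \<inter> prefix_space q} + vec.dim (S \<inter> (?P \<inter> prefix_space q))
        = vec.dim S + vec.dim (?P \<inter> prefix_space q)"
      by (rule vec.dim_sums_Int[OF subS vec.subspace_inter[OF PF(1) subspace_prefix]])
    moreover have sub: "{x + y | x y. x \<in> S \<and> y \<in> ?P \<inter> prefix_space q} \<subseteq> ?P"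
      using SP vec.subspace_add[OF PF(1)] by blast
    then have "vec.dim {x + y | x y. x \<in> S \<and> y \<in> ?P \<inter> prefix_space q} \<le> p"
      using vec.dim_subset[OF sub] PF(2) by simp
    ultimately have le: "card I + flag_dim (act (N g) base_flag) p q \<le> p"
      using int0 by (simp add: dimS flag_dim_def)
    have "rank_count v p q + card I = card {j::'n. pos j \<le> p}"
    proof -
      have "{j::'n. pos j \<le> p} = {j. pos j \<le> p \<and> pos (?\<sigma> j) \<le> q} \<union> I" by (auto simp: I_def)
      moreover have "{j. pos j \<le> p \<and> pos (?\<sigma> j) \<le> q} \<inter> I = {}" by (auto simp: I_def)
      ultimately have "card {j::'n. pos j \<le> p} = card {j. pos j \<le> p \<and> pos (?\<sigma> j) \<le> q} + card I"
        by (metis card_Un_disjoint finite_code)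
      then show ?thesis using rank_count_index[OF v p] by metis
    qed
    moreover have "card {j::'n. pos j \<le> p} = p"
    proof -
      have "card (idx ` {1..min p CARD('n)} :: 'n set) = min p CARD('n)"
        by (subst card_image) (auto simp: inj_on_def idx_eq_iff)
      then show ?thesis using p by (simp add: idx_image_prefix[symmetric] min_absorb1)
    qed
    moreover have "rank_count v p q \<le> c"
      using g0(2) by (simp add: F flag_dim_upper b flag_dim_coordinate[OF v p])
    ultimately show "g \<in> {g. det g \<noteq> 0 \<and> flag_dim (act g base_flag) p q \<le> c}"
      using le dg fd by simp
  qed
  ultimately show "\<exists>T. open T \<and> g0 \<in> T \<and> T \<subseteq> {g. det g \<noteq> 0 \<and> flag_dim (act g base_flag) p q \<le> c}"
    by blast
qed

lemma topspace_flag_topology: "topspace flag_topology = (flags :: 'n::{finite,linorder} flag set)"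
proof -
  have "{g \<in> SL_C. act g base_flag \<in> (flags :: 'n flag set)} = SL_C"
    by (auto simp: SL_C_def act_base_flags)
  then have "openin flag_topology (flags :: 'n flag set)"
    unfolding openin_flag_topology by simp
  then show ?thesis
    using openin_subset openin_topspace[of "flag_topology :: 'n flag topology"] openin_flag_topology by blast
qed

lemma schubert_variety_rank:
  assumes w: "w permutes {1..CARD('n)}" and v: "v permutes {1..CARD('n)}"
    and F: "(F :: 'n::{finite,linorder} flag) \<in> schubert_variety w" "F \<in> schubert_cell v" and p: "p \<le> CARD('n)"
  shows "rank_count w p q \<le> rank_count v p q"
proof -
  define U where "U = {F' \<in> (flags :: 'n flag set). flag_dim F' p q \<le> rank_count v p q}"
  have eq: "{g \<in> SL_C. act g base_flag \<in> U} = SL_C \<inter> {g. det g \<noteq> 0 \<and> flag_dim (act g base_flag) p q \<le> rank_count v p q}"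
    by (auto simp: SL_C_def U_def act_base_flags)
  have "openin (top_of_set SL_C) {g \<in> SL_C. act g base_flag \<in> U}"
    unfolding eq by (rule openin_open_Int[OF open_flag_dim_le[OF p]])
  then have "openin flag_topology U"
    unfolding openin_flag_topology by (simp add: U_def)
  moreover have "F \<in> U"
    using flag_dim_cell[OF v p F(2)] schubert_cell_subset_flags[OF v] F(2) by (auto simp: U_def)
  ultimately obtain F' where "F' \<in> schubert_cell w" "F' \<in> U"
    using F(1) unfolding schubert_variety_def in_closure_of by blast
  then show ?thesis using flag_dim_cell[OF w p] by (simp add: U_def)
qed

lemma flag_in_cell:
  assumes "F \<in> (flags :: 'n::{finite,linorder} flag set)"
  obtains v where "v permutes {1..CARD('n)}" "F \<in> schubert_cell v"
proof -
  obtain v b where v: "v permutes {1..CARD('n)}" "b \<in> upper" "det b \<noteq> 0" "F = act b (coordinate_flag v)"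
    by (rule bruhat_decomposition[OF assms])
  have "F \<in> schubert_cell v" unfolding mem_schubert_cell[OF v(1)] using v by blast
  then show ?thesis using that v(1) by blast
qed

lemma schubert_cell_nonempty:
  assumes "w permutes {1..CARD('n)}"
  shows "coordinate_flag w \<in> (schubert_cell w :: 'n::{finite,linorder} flag set)"
  unfolding mem_schubert_cell[OF assms] by (intro bexI[of _ "mat 1"]) (simp_all add: upper_one det_I)

lemma schubert_cell_subset_variety:
  assumes "w permutes {1..CARD('n)}"
  shows "schubert_cell w \<subseteq> (schubert_variety w :: 'n::{finite,linorder} flag set)"
  unfolding schubert_variety_def
  by (rule closure_of_subset) (simp add: topspace_flag_topology schubert_cell_subset_flags[OF assms])

lemma schubert_variety_subset_flags: "schubert_variety w \<subseteq> (flags :: 'n::{finite,linorder} flag set)"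
  unfolding schubert_variety_def topspace_flag_topology[symmetric] by (rule closure_of_subset_topspace)

text \<open>
The cell itself attains the length of \<open>w\<close>.  A submanifold \<open>Y\<close> of the closure is examined at a point in
a cell of maximal length among those that it meets, where \<open>Y\<close> has no tangent directions outside this
cell.
\<close>

theorem cdim_schubert_variety:
  assumes w: "w permutes {1..CARD('n)}"
  shows "cdim (schubert_variety w :: 'n::{finite,linorder} flag set) = inversions CARD('n) w"
proof (rule cdim_eqI[OF schubert_cell_submanifold[OF w] _ schubert_cell_subset_variety[OF w]])
  let ?n = "CARD('n)"
  show "schubert_cell w \<noteq> ({} :: 'n flag set)" using schubert_cell_nonempty[OF w] by (metis empty_iff)
  fix d and Y :: "'n flag set" assume Y: "complex_submanifold d Y" "Y \<noteq> {}" "Y \<subseteq> schubert_variety w"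
  let ?P = "\<lambda>k. \<exists>v p. v permutes {1..?n} \<and> p \<in> Y \<and> p \<in> schubert_cell v \<and> inversions ?n v = k"
  have "\<exists>k. ?P k"
  proof -
    obtain p where p: "p \<in> Y" using Y(2) by blast
    then have "p \<in> flags" using Y(3) schubert_variety_subset_flags by blast
    then obtain v where "v permutes {1..?n}" "p \<in> schubert_cell v" by (rule flag_in_cell)
    then show ?thesis using p by blast
  qed
  moreover have "\<forall>k. ?P k \<longrightarrow> k \<le> ?n * ?n" using inversions_le by blast
  ultimately have "\<exists>k. ?P k \<and> (\<forall>l. ?P l \<longrightarrow> l \<le> k)" using Nat.ex_has_greatest_nat[of ?P] by blast
  then obtain v p where v: "v permutes {1..?n}" and p: "p \<in> Y" "p \<in> schubert_cell v"
    and maxv: "\<And>v' p'. v' permutes {1..?n} \<Longrightarrow> p' \<in> Y \<Longrightarrow> p' \<in> schubert_cell v' \<Longrightarrow> inversions ?n v' \<le> inversions ?n v"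
    by blast
  \<comment> \<open>Near \<open>p\<close> the numbers \<open>dim (V\<^sub>a \<inter> E\<^sub>q)\<close> do not grow, so nearby points of \<open>Y\<close> lie in cells at least as long as that of \<open>v\<close>.  Maximality leaves only the cell of \<open>v\<close>.\<close>
  have "tangent Y p \<subseteq> tangent (schubert_cell v) p"
  proof (rule tangent_mono_germ)
    fix C :: "real \<Rightarrow> 'n cmat"
    assume C: "continuous (at 0) C" "det (C 0) \<noteq> 0" "act (C 0) base_flag = p"
      and ev: "\<forall>\<^sub>F t in at 0. act (C t) base_flag \<in> Y"
    have "\<forall>\<^sub>F t in at 0. flag_dim (act (C t) base_flag) a q \<le> rank_count v a q" if "a \<le> ?n" for a q
    proof -
      have "\<forall>\<^sub>F t in at 0. C t \<in> {g. det g \<noteq> 0 \<and> flag_dim (act g base_flag) a q \<le> rank_count v a q}"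
      proof (rule topological_tendstoD[OF _ open_flag_dim_le[OF that]])
        show "(C \<longlongrightarrow> C 0) (at 0)" using C(1) by (simp add: continuous_within)
        show "C 0 \<in> {g. det g \<noteq> 0 \<and> flag_dim (act g base_flag) a q \<le> rank_count v a q}"
          using C flag_dim_cell[OF v that p(2)] by simp
      qed
      then show ?thesis by (rule eventually_mono) simp
    qed
    then have "\<forall>\<^sub>F t in at 0. \<forall>(a, q)\<in>{..?n} \<times> {..?n}. flag_dim (act (C t) base_flag) a q \<le> rank_count v a q"
      by (intro eventually_ball_finite) auto
    then show "\<forall>\<^sub>F t in at 0. act (C t) base_flag \<in> schubert_cell v"
      using ev
    proof eventually_elim
      case (elim t)
      let ?F = "act (C t) base_flag"
      have "?F \<in> flags" using elim(2) Y(3) schubert_variety_subset_flags by blast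
      then obtain v' where v': "v' permutes {1..?n}" "?F \<in> schubert_cell v'" by (rule flag_in_cell)
      have "rank_count v' a q \<le> rank_count v a q" if "a \<le> ?n" "q \<le> ?n" for a q
        using bspec[OF elim(1), of "(a, q)"] that flag_dim_cell[OF v'(1) that(1) v'(2), of q] by simp
      then have "inversions ?n v \<le> inversions ?n v' \<and> (inversions ?n v = inversions ?n v' \<longrightarrow> v = v')"
        by (rule rank_count_mono_inversions[OF v v'(1)])
      moreover have "inversions ?n v' \<le> inversions ?n v" using maxv[OF v'(1) elim(2) v'(2)] .
      ultimately have "v = v'" by (meson le_antisym)
      then show ?case using v'(2) by simp
    qed
  qed
  then have "d \<le> inversions ?n v"
    by (rule submanifold_dim_mono_germ[OF Y(1) schubert_cell_submanifold[OF v] p])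
  moreover have "inversions ?n v \<le> inversions ?n w"
  proof -
    have pw: "p \<in> schubert_variety w" using p(1) Y(3) by blast
    show ?thesis
      using rank_count_mono_inversions[OF v w schubert_variety_rank[OF w v pw p(2)]] by simp
  qed
  ultimately show "d \<le> inversions ?n w" by simp
qed

section \<open>Lengths and double box contraction\<close>

text \<open>
The signed indicator function of the interval between \<open>l\<^sub>p\<close> and \<open>k\<^sub>p\<close>: off the endpoints it is 1 in
between if \<open>l\<^sub>p < k\<^sub>p\<close>, and \<open>- 1\<close> in between if \<open>k\<^sub>p < l\<^sub>p\<close>.
\<close>

definition pair_sign :: "nat \<Rightarrow> (nat \<Rightarrow> nat) \<Rightarrow> nat \<Rightarrow> nat \<Rightarrow> int" where
  "pair_sign n w p y = (if w (n + 1 - p) \<le> y then 1 else 0) - (if w p \<le> y then 1 else 0)"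

lemma inversions_as_sum:
  "int (inversions n w) = (\<Sum>i\<in>{1..n}. \<Sum>j\<in>{1..n}. if i < j \<and> w j < w i then 1 else 0)"
proof -
  have "{(i, j). 1 \<le> i \<and> i < j \<and> j \<le> n \<and> w j < w i} = (SIGMA i:{1..n}. {j\<in>{1..n}. i < j \<and> w j < w i})"
    by auto
  then have "inversions n w = (\<Sum>i\<in>{1..n}. card {j\<in>{1..n}. i < j \<and> w j < w i})"
    by (simp add: inversions_def)
  then have "int (inversions n w) = (\<Sum>i\<in>{1..n}. int (card {j\<in>{1..n}. i < j \<and> w j < w i}))"
    by simp
  also have "\<dots> = (\<Sum>i\<in>{1..n}. \<Sum>j\<in>{1..n}. if i < j \<and> w j < w i then 1 else 0)"
    by (rule sum.cong) (simp_all add: sum.If_cases Int_def conj_commute)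
  finally show ?thesis .
qed

text \<open>
Inversions are counted by peeling off the outermost pair of positions \<open>p\<close> and \<open>n + 1 - p\<close>.  A position
\<open>x\<close> strictly between them is involved in one inversion with the pair, corrected by the sign with which
\<open>w x\<close> lies between \<open>l\<^sub>p\<close> and \<open>k\<^sub>p\<close>.
\<close>

lemma inversions_by_layers:
  assumes w: "w permutes {1..n}" and m: "m = n div 2"
  shows "int (inversions n w) = int (m * (n - m)) + (\<Sum>p\<in>{1..m}. \<Sum>x\<in>{p+1..n-p}. pair_sign n w p (w x))
    - int (card {p\<in>{1..m}. w p < w (n + 1 - p)})"
proof -
  have inj: "w a \<noteq> w b" if "a \<noteq> b" for a b using permutes_inj[OF w] that by (simp add: inj_eq)
  define f where "f i j = (if i < j \<and> w j < w i then 1 else 0 :: int)" for i j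
  define T where "T a b = (\<Sum>i\<in>{a..b}. \<Sum>j\<in>{a..b}. f i j)" for a b
  define lev where "lev p = (\<Sum>x\<in>{p+1..n-p}. 1 + pair_sign n w p (w x)) + (if w p < w (n + 1 - p) then 0 else 1)" for p
  have step: "T p (n + 1 - p) = lev p + T (p + 1) (n - p)" if p: "1 \<le> p" "p \<le> m" for p
  proof -
    let ?q = "n + 1 - p" and ?M = "{p+1..n-p}"
    have pq: "p < ?q" and np: "p \<le> n" using p m by auto
    have set: "{p..?q} = insert p (insert ?q ?M)" using p m by auto
    have nin: "p \<notin> insert ?q ?M" "?q \<notin> ?M" using p m by auto
    have ins: "(\<Sum>j\<in>{p..?q}. g j) = g p + (g ?q + (\<Sum>j\<in>?M. g j))" for g :: "nat \<Rightarrow> int"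
      unfolding set using nin by simp
    have z: "f x p = 0" "f ?q x = 0" "f p p = 0" "f ?q ?q = 0" "f ?q p = 0" if "x \<in> ?M" for x
      using that pq by (auto simp: f_def)
    have z': "f p p = 0" "f ?q ?q = 0" "f ?q p = 0" using pq by (auto simp: f_def)
    have T: "T p ?q = f p ?q + (\<Sum>x\<in>?M. f p x) + (\<Sum>x\<in>?M. f x ?q) + T (p + 1) (n - p)"
      unfolding T_def ins using z z' by (simp add: sum.distrib)
    have S: "(\<Sum>x\<in>?M. f p x) + (\<Sum>x\<in>?M. f x ?q) = (\<Sum>x\<in>?M. 1 + pair_sign n w p (w x))"
      unfolding sum.distrib[symmetric]
    proof (rule sum.cong)
      fix x assume x: "x \<in> ?M"
      then have ne: "x \<noteq> p" "x \<noteq> ?q" using p m by auto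
      have "w x \<noteq> w p" "w x \<noteq> w ?q" using inj[OF ne(1)] inj[OF ne(2)] by simp_all
      then show "f p x + f x ?q = 1 + pair_sign n w p (w x)"
        using x p m by (auto simp: f_def pair_sign_def)
    qed simp
    have E: "f p ?q = (if w p < w ?q then 0 else 1)" using pq inj[of p ?q] by (auto simp: f_def)
    show ?thesis using T S E unfolding lev_def by linarith
  qed
  have "T 1 n = (\<Sum>p\<in>{1..r}. lev p) + T (r + 1) (n - r)" if "r \<le> m" for r
    using that
  proof (induction r)
    case (Suc r)
    then show ?case using step[of "r + 1"] by simp
  qed simp
  from this[of m] have "T 1 n = (\<Sum>p\<in>{1..m}. lev p) + T (m + 1) (n - m)" by simp
  moreover have "T (m + 1) (n - m) = 0"
    unfolding T_def
  proof (intro sum.neutral ballI)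
    fix i j assume "i \<in> {m + 1..n - m}" "j \<in> {m + 1..n - m}"
    then have "i = j" using m by auto
    then show "f i j = 0" by (simp add: f_def)
  qed
  moreover have "int (inversions n w) = T 1 n" unfolding inversions_as_sum T_def f_def by simp
  ultimately have "int (inversions n w) = (\<Sum>p\<in>{1..m}. lev p)" by simp
  also have "\<dots> = (\<Sum>p\<in>{1..m}. (int n - 2 * int p + 1) + (\<Sum>x\<in>{p+1..n-p}. pair_sign n w p (w x))
      - (if w p < w (n + 1 - p) then 1 else 0))"
  proof (rule sum.cong)
    fix p assume p: "p \<in> {1..m}"
    then have "int (card {p+1..n-p}) = int n - 2 * int p" using m by auto
    then show "lev p = (int n - 2 * int p + 1) + (\<Sum>x\<in>{p+1..n-p}. pair_sign n w p (w x)) - (if w p < w (n + 1 - p) then 1 else 0)"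
      by (simp add: lev_def sum.distrib)
  qed simp
  also have "\<dots> = (\<Sum>p\<in>{1..m}. int n - 2 * int p + 1) + (\<Sum>p\<in>{1..m}. \<Sum>x\<in>{p+1..n-p}. pair_sign n w p (w x))
     - int (card {p\<in>{1..m}. w p < w (n + 1 - p)})"
    by (simp add: sum.distrib sum_subtractf sum.If_cases Int_def conj_commute)
  also have "(\<Sum>p\<in>{1..m}. int n - 2 * int p + 1) = int (m * (n - m))"
  proof -
    have "(\<Sum>p\<in>{1..k}. int n - 2 * int p + 1) = int k * (int n - int k)" for k
      by (induction k) (simp_all add: algebra_simps)
    then show ?thesis using m by (simp add: of_nat_diff)
  qed
  finally show ?thesis .
qed

lemma remaining_eq:
  assumes w: "w permutes {1..n}" and i: "1 \<le> i" "i \<le> n div 2"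
  shows "remaining n w i = w ` {i..n + 1 - i}"
proof -
  have im: "w ` {1..n} = {1..n}" by (rule permutes_image[OF w])
  have "entry_l n w ` {1..<i} = w ` {n + 2 - i..n}"
  proof -
    have "(\<lambda>j. n + 1 - j) ` {1..<i} = {n + 2 - i..n}"
    proof (intro equalityI subsetI)
      fix x assume "x \<in> {n + 2 - i..n}"
      then show "x \<in> (\<lambda>j. n + 1 - j) ` {1..<i}" using i by (intro image_eqI[of _ _ "n + 1 - x"]) auto
    qed (use i in auto)
    then show ?thesis unfolding entry_l_def image_image[symmetric, of w "\<lambda>j. n + 1 - j"] by simp
  qed
  moreover have "entry_k w ` {1..<i} = w ` {1..<i}" by (simp add: entry_k_def)
  moreover have "{1..n} - ({1..<i} \<union> {n + 2 - i..n}) = {i..n + 1 - i}" using i by auto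
  ultimately show ?thesis
    unfolding remaining_def using image_set_diff[OF permutes_inj[OF w], of "{1..n}" "{1..<i} \<union> {n + 2 - i..n}"] im
    by (simp add: image_Un)
qed

lemma double_box_contraction_iff:
  assumes w: "w permutes {1..n}"
  shows "double_box_contraction n w \<longleftrightarrow>
    (\<forall>p\<in>{1..n div 2}. w (n + 1 - p) < w p \<and> (\<forall>x\<in>{p+1..n-p}. pair_sign n w p (w x) = 0))"
proof -
  have "immediate_predecessor (remaining n w p) (entry_l n w p) (entry_k w p) \<longleftrightarrow>
    w (n + 1 - p) < w p \<and> (\<forall>x\<in>{p+1..n-p}. pair_sign n w p (w x) = 0)" if p: "p \<in> {1..n div 2}" for p
  proof -
    let ?q = "n + 1 - p"
    have rem: "remaining n w p = w ` {p..?q}" using remaining_eq[OF w] p by simp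
    have mem: "w p \<in> w ` {p..?q}" "w ?q \<in> w ` {p..?q}" using p by auto
    have set: "{p..?q} = insert p (insert ?q {p+1..n-p})" using p by auto
    have neq: "w x \<noteq> w p \<and> w x \<noteq> w ?q" if "x \<in> {p+1..n-p}" for x
      using that p permutes_inj[OF w] by (auto simp: inj_eq)
    have "(\<not> (\<exists>c\<in>w ` {p..?q}. w ?q < c \<and> c < w p)) \<longleftrightarrow> (\<forall>x\<in>{p+1..n-p}. \<not> (w ?q < w x \<and> w x < w p))"
      unfolding set by auto
    moreover have "(\<forall>x\<in>{p+1..n-p}. \<not> (w ?q < w x \<and> w x < w p)) \<longleftrightarrow> (\<forall>x\<in>{p+1..n-p}. pair_sign n w p (w x) = 0)"
      if "w ?q < w p"
      using neq that by (intro ball_cong refl) (force simp: pair_sign_def)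
    ultimately show ?thesis
      unfolding immediate_predecessor_def rem entry_l_def entry_k_def using mem by blast
  qed
  then show ?thesis unfolding double_box_contraction_def by blast
qed

lemma double_box_contraction_inversions:
  assumes w: "w permutes {1..n}" and c: "double_box_contraction n w"
  shows "inversions n w = n div 2 * (n - n div 2)"
proof -
  have c': "\<forall>p\<in>{1..n div 2}. w (n + 1 - p) < w p \<and> (\<forall>x\<in>{p+1..n-p}. pair_sign n w p (w x) = 0)"
    using c unfolding double_box_contraction_iff[OF w] .
  then have "{p\<in>{1..n div 2}. w p < w (n + 1 - p)} = {}" by fastforce
  moreover have "(\<Sum>p\<in>{1..n div 2}. \<Sum>x\<in>{p+1..n-p}. pair_sign n w p (w x)) = 0"
    using c' by (intro sum.neutral ballI) blast
  ultimately have "int (inversions n w) = int (n div 2 * (n - n div 2))"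
    using inversions_by_layers[OF w refl] by simp
  then show ?thesis by (simp only: of_nat_eq_iff)
qed

lemma double_box_contraction_spacing:
  assumes w: "w permutes {1..n}" and c: "double_box_contraction n w"
  shows "spacing n w"
  using c by (simp add: double_box_contraction_def spacing_def immediate_predecessor_def)

text \<open>
The hypothesis says that the first \<open>r\<close> signed intervals together cover every point nonnegatively.  So by
\<open>inversions_by_layers\<close>, read as a sum over \<open>x\<close>, only the pairs with \<open>k\<^sub>p < l\<^sub>p\<close> can lower the length
below \<open>m (n - m)\<close>, each by 1.  But both entries of such a pair have to be covered by earlier intervals,
which raises the length by at least 2.  Hence minimal length leaves only pairs with \<open>l\<^sub>p < k\<^sub>p\<close> and no
remaining number between \<open>l\<^sub>p\<close> and \<open>k\<^sub>p\<close>.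
\<close>

lemma minimal_length_double_box_contraction:
  assumes w: "w permutes {1..n}"
    and dom: "\<And>r q. r \<le> n div 2 \<Longrightarrow> q \<le> n \<Longrightarrow>
      card {i\<in>{1..r}. w i \<le> q} \<le> card {i\<in>{1..r}. w (n + 1 - i) \<le> q}"
    and len: "inversions n w = n div 2 * (n - n div 2)"
  shows "double_box_contraction n w"
proof -
  define m where "m = n div 2"
  let ?s = "pair_sign n w"
  let ?bad = "{p\<in>{1..m}. w p < w (n + 1 - p)}"
  define t where "t x = min x (n + 1 - x)" for x
  define g where "g x = (\<Sum>p\<in>{1..<t x}. ?s p (w x))" for x
  have win: "w x \<le> n" "1 \<le> w x" if "x \<in> {1..n}" for x using permutes_in_image[OF w, of x] that by auto
  have inj: "w a \<noteq> w b" if "a \<noteq> b" for a b using permutes_inj[OF w] that by (simp add: inj_eq)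
  have cov: "(\<Sum>p\<in>{1..r}. ?s p q) \<ge> 0" if "r \<le> m" "q \<le> n" for r q
  proof -
    have "(\<Sum>p\<in>{1..r}. ?s p q) = int (card {i\<in>{1..r}. w (n + 1 - i) \<le> q}) - int (card {i\<in>{1..r}. w i \<le> q})"
      by (simp add: pair_sign_def sum_subtractf sum.If_cases Int_def conj_commute)
    then show ?thesis using dom[of r q] that by (simp add: m_def)
  qed
  have gcov: "g x = (\<Sum>p\<in>{1..t x - 1}. ?s p (w x))" for x
    unfolding g_def by (rule sum.cong) auto
  have g0: "0 \<le> g x" if "x \<in> {1..n}" for x
    unfolding gcov using that win[OF that] by (intro cov) (auto simp: t_def m_def)
  \<comment> \<open>The interval of \<open>r\<close> covers \<open>k\<^sub>r\<close> and \<open>l\<^sub>r - 1\<close> with sign \<open>- 1\<close>, which earlier intervals must outweigh.  Their coverage does not change from \<open>l\<^sub>r - 1\<close> to \<open>l\<^sub>r\<close>, because \<open>l\<^sub>r\<close> is not one of their endpoints.\<close>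
  have bad1: "1 \<le> g r \<and> 1 \<le> g (n + 1 - r)" if r: "r \<in> ?bad" for r
  proof -
    have rm: "1 \<le> r" "r \<le> m" and lt: "w r < w (n + 1 - r)" using r by auto
    have t: "t r = r" "t (n + 1 - r) = r" using rm by (auto simp: t_def m_def)
    have rn: "r \<in> {1..n}" "n + 1 - r \<in> {1..n}" using rm by (auto simp: m_def)
    have split: "(\<Sum>p\<in>{1..r}. ?s p q) = (\<Sum>p\<in>{1..<r}. ?s p q) + ?s r q" for q
    proof -
      have "{1..r} = insert r {1..<r}" using rm by auto
      then show ?thesis by simp
    qed
    have "0 \<le> (\<Sum>p\<in>{1..r}. ?s p (w r))" by (rule cov[OF rm(2) win(1)[OF rn(1)]])
    then have 1: "1 \<le> g r" using lt unfolding split g_def t by (simp add: pair_sign_def)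
    have q: "w (n + 1 - r) - 1 \<le> n" using win(1)[OF rn(2)] by simp
    have "0 \<le> (\<Sum>p\<in>{1..r}. ?s p (w (n + 1 - r) - 1))" by (rule cov[OF rm(2) q])
    moreover have "?s r (w (n + 1 - r) - 1) = -1" using lt by (auto simp: pair_sign_def)
    moreover have "(\<Sum>p\<in>{1..<r}. ?s p (w (n + 1 - r) - 1)) = (\<Sum>p\<in>{1..<r}. ?s p (w (n + 1 - r)))"
    proof (rule sum.cong)
      fix p assume p: "p \<in> {1..<r}"
      then have ne: "p \<noteq> n + 1 - r" "n + 1 - p \<noteq> n + 1 - r"
        using rm by (auto simp: m_def)
      have "w p \<noteq> w (n + 1 - r)" "w (n + 1 - p) \<noteq> w (n + 1 - r)"
        using inj[OF ne(1)] inj[OF ne(2)] by simp_all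
      then show "?s p (w (n + 1 - r) - 1) = ?s p (w (n + 1 - r))"
      proof -
        have "y \<le> w (n + 1 - r) - 1 \<longleftrightarrow> y \<le> w (n + 1 - r)" if "y \<noteq> w (n + 1 - r)" for y
          using win(2)[OF rn(2)] that by linarith
        then show ?thesis
          unfolding pair_sign_def using \<open>w p \<noteq> _\<close> \<open>w (n + 1 - p) \<noteq> _\<close> by simp
      qed
    qed simp
    ultimately have "1 \<le> g (n + 1 - r)" unfolding split g_def t by simp
    with 1 show ?thesis by simp
  qed
  have swap: "(\<Sum>p\<in>{1..m}. \<Sum>x\<in>{p+1..n-p}. ?s p (w x)) = (\<Sum>x\<in>{1..n}. g x)"
  proof -
    have "(\<Sum>p\<in>{1..m}. \<Sum>x\<in>{p+1..n-p}. ?s p (w x)) = (\<Sum>p\<in>{1..m}. \<Sum>x\<in>{x\<in>{1..n}. p < x \<and> x \<le> n - p}. ?s p (w x))"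
      by (intro sum.cong) auto
    also have "\<dots> = (\<Sum>x\<in>{1..n}. \<Sum>p | p \<in> {1..m} \<and> (p < x \<and> x \<le> n - p). ?s p (w x))"
      by (rule sum.swap_restrict) simp_all
    also have "\<dots> = (\<Sum>x\<in>{1..n}. g x)"
      unfolding g_def by (intro sum.cong refl) (auto simp: t_def m_def)
    finally show ?thesis .
  qed
  let ?B = "?bad \<union> (\<lambda>r. n + 1 - r) ` ?bad"
  have "int (card ?B) \<le> (\<Sum>x\<in>?B. g x)"
  proof -
    have "(\<Sum>x\<in>?B. 1) \<le> (\<Sum>x\<in>?B. g x)"
    proof (rule sum_mono)
      fix x assume "x \<in> ?B"
      then show "1 \<le> g x" using bad1 by blast
    qed
    then show ?thesis by simp
  qed
  also have "\<dots> \<le> (\<Sum>x\<in>{1..n}. g x)"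
    by (rule sum_mono2) (use g0 in \<open>auto simp: m_def\<close>)
  also have "\<dots> = int (card ?bad)"
    using inversions_by_layers[OF w m_def] len swap by (simp add: m_def)
  finally have le: "card ?B \<le> card ?bad" by simp
  have "card ?B = card ?bad + card ((\<lambda>r. n + 1 - r) ` ?bad)"
    by (rule card_Un_disjoint) (auto simp: m_def)
  moreover have "card ((\<lambda>r. n + 1 - r) ` ?bad) = card ?bad"
    by (rule card_image) (auto simp: inj_on_def m_def)
  ultimately have "card ?bad = 0" using le by simp
  then have nobad: "?bad = {}" by simp
  have good: "w (n + 1 - p) < w p" if "p \<in> {1..m}" for p
  proof -
    have "p \<noteq> n + 1 - p" using that by (auto simp: m_def)
    then have "w p \<noteq> w (n + 1 - p)" by (rule inj)
    moreover have "\<not> w p < w (n + 1 - p)" using nobad that by blast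
    ultimately show ?thesis by simp
  qed
  then have nonneg: "0 \<le> ?s p y" if "p \<in> {1..m}" for p y using good[OF that] by (auto simp: pair_sign_def)
  have tot: "(\<Sum>p\<in>{1..m}. \<Sum>x\<in>{p+1..n-p}. ?s p (w x)) = 0"
    using inversions_by_layers[OF w m_def] len \<open>card ?bad = 0\<close> by (simp add: m_def)
  have "(\<Sum>x\<in>{p+1..n-p}. ?s p (w x)) = 0" if "p \<in> {1..m}" for p
    using sum_nonneg_0[OF _ _ tot that] nonneg by (simp add: sum_nonneg)
  then have "?s p (w x) = 0" if "p \<in> {1..m}" "x \<in> {p+1..n-p}" for p x
    using sum_nonneg_0[of "{p+1..n-p}" "\<lambda>x. ?s p (w x)" x] nonneg[OF that(1)] that by blast
  then show ?thesis unfolding double_box_contraction_iff[OF w] using good by (simp add: m_def)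
qed

section \<open>Open orbits of the real group\<close>

definition conj_mat :: "'n::finite cmat \<Rightarrow> 'n cmat" where
  "conj_mat M = (\<chi> i j. cnj (M $ i $ j))"

lemma conj_mat_mult: "conj_mat (A ** B) = conj_mat A ** conj_mat B"
  by (simp add: conj_mat_def matrix_matrix_mult_def vec_eq_iff)

text \<open>
The first \<open>k\<close> columns span \<open>V\<^sub>k\<close>, the other columns span the conjugate of \<open>V\<^bsub>n-k\<^esub>\<close>.  The latter are listed
in reverse order because then frames on which conjugation reverses the columns are fixed by \<open>mix k\<close>.
\<close>

definition mix :: "nat \<Rightarrow> 'n::{finite,linorder} cmat \<Rightarrow> 'n cmat" where
  "mix k g = (\<chi> i j. if pos j \<le> k then g $ i $ j else cnj (g $ i $ rev_index j))"

text \<open>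
The cocycle of \<^const>\<open>mix\<close> under the action of upper triangular matrices from the right.
\<close>

definition mix_upper :: "nat \<Rightarrow> 'n::{finite,linorder} cmat \<Rightarrow> 'n cmat" where
  "mix_upper k b = (\<chi> i j. if pos j \<le> k then (if pos i \<le> k then b $ i $ j else 0)
      else (if pos i \<le> k then 0 else cnj (b $ rev_index i $ rev_index j)))"

lemma matrix_mult_nth: "((A :: 'n::finite cmat) ** B) $ i $ j = (\<Sum>k\<in>UNIV. A $ i $ k * B $ k $ j)"
  by (simp add: matrix_matrix_mult_def)

lemma mix_real:
  assumes "conj_mat h = h"
  shows "mix k (h ** g) = h ** mix k g"
proof -
  have "cnj (h $ i $ j) = h $ i $ j" for i j
    using arg_cong[OF assms, of "\<lambda>M. M $ i $ j"] by (simp add: conj_mat_def)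
  then show ?thesis by (simp add: mix_def matrix_matrix_mult_def vec_eq_iff)
qed

lemma bij_rev: "bij (rev_index :: 'n::{finite,linorder} \<Rightarrow> 'n)"
  by (rule o_bij[of rev_index]) (simp_all add: fun_eq_iff)

lemma mix_mult_upper:
  assumes b: "b \<in> upper"
  shows "mix k (g ** b) = mix k g ** mix_upper k b"
proof -
  have "mix k (g ** b) $ i $ j = (mix k g ** mix_upper k b) $ i $ j" for i j
  proof (cases "pos j \<le> k")
    case True
    have "g $ i $ l * b $ l $ j = mix k g $ i $ l * mix_upper k b $ l $ j" for l
    proof (cases "j < l")
      case True
      then show ?thesis using b \<open>pos j \<le> k\<close> by (simp add: upper_def mix_upper_def)
    next
      case False
      then have "pos l \<le> k" using True by (meson le_trans not_less pos_le_iff)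
      then show ?thesis using True by (simp add: mix_def mix_upper_def)
    qed
    moreover have "mix k (g ** b) $ i $ j = (g ** b) $ i $ j" using True by (simp add: mix_def)
    ultimately show ?thesis by (simp only: matrix_mult_nth)
  next
    case False
    have "cnj (g $ i $ rev_index l) * cnj (b $ rev_index l $ rev_index j) = mix k g $ i $ l * mix_upper k b $ l $ j" for l
    proof (cases "l < j")
      case True
      then show ?thesis using b False by (simp add: upper_def mix_upper_def)
    next
      case nl: False
      then have "\<not> pos l \<le> k" using False by (meson le_trans not_less pos_le_iff)
      then show ?thesis using False by (simp add: mix_def mix_upper_def)
    qed
    then have "(\<Sum>l\<in>UNIV. mix k g $ i $ l * mix_upper k b $ l $ j) = (\<Sum>l\<in>UNIV. cnj (g $ i $ rev_index l) * cnj (b $ rev_index l $ rev_index j))"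
      by simp
    also have "\<dots> = (\<Sum>l\<in>UNIV. cnj (g $ i $ l) * cnj (b $ l $ rev_index j))"
      using sum.reindex_bij_betw[OF bij_rev, of "\<lambda>l. cnj (g $ i $ l) * cnj (b $ l $ rev_index j)"] by simp
    finally have "(mix k g ** mix_upper k b) $ i $ j = cnj ((g ** b) $ i $ rev_index j)"
      by (simp add: matrix_mult_nth)
    moreover have "mix k (g ** b) $ i $ j = cnj ((g ** b) $ i $ rev_index j)" using False by (simp add: mix_def)
    ultimately show ?thesis by simp
  qed
  then show ?thesis by (simp add: vec_eq_iff)
qed

lemma det_mix_upper:
  assumes b: "b \<in> upper"
  shows "det (mix_upper k b :: 'n::{finite,linorder} cmat) =
    (\<Prod>i\<in>UNIV. if pos i \<le> k then b $ i $ i else cnj (b $ rev_index i $ rev_index i))"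
proof -
  let ?n = "CARD('n)"
  define r where "r i = (if pos i \<le> k then pos i else 2 * ?n - pos i)" for i :: 'n
  have "det (mix_upper k b :: 'n cmat) = (\<Prod>i\<in>UNIV. mix_upper k b $ i $ i)"
  proof (rule det_triangular)
    show "inj r"
    proof (rule injI)
      fix x y :: 'n assume "r x = r y"
      then have "pos x = pos y" using pos_le[of x] pos_le[of y] unfolding r_def by (auto simp del: pos_eq_iff split: if_splits)
      then show "x = y" by simp
    qed
    fix i j :: 'n assume nz: "mix_upper k b $ i $ j \<noteq> 0"
    show "r i \<le> r j"
    proof (cases "pos j \<le> k")
      case True
      then have i: "pos i \<le> k" "b $ i $ j \<noteq> 0" using nz by (auto simp: mix_upper_def split: if_splits)
      then have "pos i \<le> pos j" using b unfolding upper_def by (metis (mono_tags, lifting) mem_Collect_eq not_le pos_le_iff)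
      then show ?thesis using True i by (simp add: r_def)
    next
      case False
      then have i: "\<not> pos i \<le> k" "b $ rev_index i $ rev_index j \<noteq> 0" using nz by (auto simp: mix_upper_def split: if_splits)
      then have "\<not> rev_index j < rev_index i" using b unfolding upper_def by blast
      then have "pos j \<le> pos i" by (simp add: not_less)
      then have "2 * ?n - pos i \<le> 2 * ?n - pos j" by (rule diff_le_mono2)
      then show ?thesis using False i by (simp add: r_def)
    qed
  qed
  also have "\<dots> = (\<Prod>i\<in>UNIV. if pos i \<le> k then b $ i $ i else cnj (b $ rev_index i $ rev_index i))"
    by (rule prod.cong) (simp_all add: mix_upper_def)
  finally show ?thesis .
qed

definition isotropic_slope :: "('n \<Rightarrow> complex) \<Rightarrow> 'n::{finite,linorder} cmat" where
  "isotropic_slope e = (\<chi> i j. if j < i \<and> i = rev_index j then e j else 0)"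

text \<open>
For a pair of indices \<open>j < rev_index j\<close> the columns are \<open>e\<^sub>j + \<epsilon>\<^sub>j e\<^bsub>rev j\<^esub>\<close> and \<open>e\<^sub>j - \<epsilon>\<^sub>j e\<^bsub>rev j\<^esub>\<close>.  They are
conjugate isotropic vectors for \<open>\<epsilon>\<^sub>j = \<plusminus> \<i>\<close>; the choice of the signs decides the orientation.
\<close>

definition isotropic_basis :: "('n \<Rightarrow> complex) \<Rightarrow> 'n::{finite,linorder} cmat" where
  "isotropic_basis e = (\<chi> i j. if j < rev_index j then (if i = j then 1 else if i = rev_index j then e j else 0)
     else if rev_index j < j then (if i = rev_index j then 1 else if i = j then - e (rev_index j) else 0)
     else (if i = j then 1 else 0))"

definition isotropic_upper :: "('n \<Rightarrow> complex) \<Rightarrow> 'n::{finite,linorder} cmat" where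
  "isotropic_upper e = (\<chi> i j. if i = j then (if rev_index j < j then - 2 * e (rev_index j) else 1)
     else if rev_index j < j \<and> i = rev_index j then 1 else 0)"

lemma isotropic_slope_lower: "isotropic_slope e \<in> strictly_lower"
  by (auto simp: isotropic_slope_def strictly_lower_def)

lemma isotropic_upper_upper: "isotropic_upper e \<in> upper"
  by (auto simp: isotropic_upper_def upper_def)

lemma isotropic_basis_factor:
  "isotropic_basis e = (mat 1 + isotropic_slope e) ** (isotropic_upper e :: 'n::{finite,linorder} cmat)"
proof -
  have "((mat 1 + isotropic_slope e) ** (isotropic_upper e :: 'n cmat)) $ i $ j = isotropic_basis e $ i $ j" for i j :: 'n
  proof -
    have "((mat 1 + isotropic_slope e) ** (isotropic_upper e :: 'n cmat)) $ i $ j =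
       isotropic_upper e $ i $ j + (\<Sum>k\<in>UNIV. isotropic_slope e $ i $ k * (isotropic_upper e :: 'n cmat) $ k $ j)"
      by (simp add: matrix_matrix_mult_def mat_def distrib_right sum.distrib if_distrib[of "\<lambda>z. z * _"] cong: if_cong)
    also have "(\<Sum>k\<in>UNIV. isotropic_slope e $ i $ k * (isotropic_upper e :: 'n cmat) $ k $ j) =
        (\<Sum>k\<in>UNIV. if k = rev_index i then (if k < i then e k * (isotropic_upper e :: 'n cmat) $ k $ j else 0) else 0)"
      by (rule sum.cong) (auto simp: isotropic_slope_def)
    also have "\<dots> = (if rev_index i < i then e (rev_index i) * isotropic_upper e $ rev_index i $ j else 0)" by simp
    also have "isotropic_upper e $ i $ j + \<dots> = isotropic_basis e $ i $ j"
    proof -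
      have "rev_index (rev_index j) = j" "rev_index i = j \<longleftrightarrow> i = rev_index j" by (auto)
      then show ?thesis
        by (cases "i = j"; cases "i = rev_index j") (auto simp: isotropic_upper_def isotropic_basis_def)
    qed
    finally show ?thesis .
  qed
  then show ?thesis by (simp add: vec_eq_iff)
qed

lemma det_isotropic_basis:
  assumes "\<And>j. e j \<noteq> 0" shows "det (isotropic_basis e :: 'n::{finite,linorder} cmat) \<noteq> 0"
proof -
  have "det (isotropic_upper e :: 'n cmat) \<noteq> 0"
  proof -
    have "(isotropic_upper e :: 'n cmat) $ i $ i \<noteq> 0" for i using assms by (simp add: isotropic_upper_def)
    then show ?thesis using upper_diag_nz[OF isotropic_upper_upper] by blast
  qed
  then show ?thesis
    unfolding isotropic_basis_factor det_mul by (simp add: unit_lower_det isotropic_slope_lower)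
qed

lemma isotropic_basis_conj:
  assumes "\<And>j. cnj (e j) = - e j"
  shows "cnj (isotropic_basis e $ i $ rev_index j) = isotropic_basis e $ i $ (j :: 'n::{finite,linorder})"
  using assms by (auto simp: isotropic_basis_def)

lemma mix_isotropic_basis:
  assumes "\<And>j. cnj (e j) = - e j"
  shows "mix k (isotropic_basis e) = (isotropic_basis e :: 'n::{finite,linorder} cmat)"
  by (simp add: mix_def vec_eq_iff isotropic_basis_conj[OF assms])

text \<open>
The determinant is a polynomial along the segment, so that it has only finitely many zeros there.
\<close>

lemma det_segment:
  fixes A B :: "'n::finite cmat"
  assumes B: "det B \<noteq> 0" and d: "0 < \<delta>"
  shows "\<exists>s::real. 0 < s \<and> s < \<delta> \<and> det (A + s *\<^sub>R (B - A)) \<noteq> 0"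
proof (rule ccontr)
  assume no: "\<not> (\<exists>s::real. 0 < s \<and> s < \<delta> \<and> det (A + s *\<^sub>R (B - A)) \<noteq> 0)"
  define q :: "complex poly" where
    "q = (\<Sum>p | p permutes (UNIV :: 'n set). [:of_int (sign p):] * (\<Prod>i\<in>UNIV. [:A $ i $ p i, B $ i $ p i - A $ i $ p i:]))"
  have eval: "poly q (of_real s) = det (A + s *\<^sub>R (B - A))" for s :: real
  proof -
    have "poly [:A $ i $ j, B $ i $ j - A $ i $ j:] (of_real s) = (A + s *\<^sub>R (B - A)) $ i $ j" for i j
    proof -
      have "(A + s *\<^sub>R (B - A)) $ i $ j = A $ i $ j + s *\<^sub>R (B $ i $ j - A $ i $ j)" by simp
      also have "\<dots> = A $ i $ j + of_real s * (B $ i $ j - A $ i $ j)" by (simp only: scaleR_conv_of_real)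
      finally show ?thesis by simp
    qed
    then show ?thesis unfolding q_def det_def poly_sum poly_mult poly_prod by simp
  qed
  have "poly q 1 \<noteq> 0" using eval[of 1] B by simp
  then have "q \<noteq> 0" by auto
  then have fin: "finite {z. poly q z = 0}" by (rule poly_roots_finite)
  have "det (A + s *\<^sub>R (B - A)) = 0" if "0 < s" "s < \<delta>" for s
    using no that by blast
  then have "of_real ` {0<..<\<delta>} \<subseteq> {z. poly q z = 0}"
    by (auto simp: eval)
  then have "finite (of_real ` {0<..<\<delta>} :: complex set)" using fin finite_subset by blast
  then have "finite {0<..<\<delta>}" by (rule finite_imageD) (simp add: inj_on_def)
  then show False using infinite_Ioo[OF d] by blast
qed

lemma open_orbit_preimage:
  fixes D :: "'n::{finite,linorder} flag set"
  assumes "openin flag_topology D"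
  shows "open {g :: 'n cmat. det g \<noteq> 0 \<and> act g base_flag \<in> D}"
proof -
  obtain O' where O': "open O'" "{g \<in> SL_C. act g base_flag \<in> D} = SL_C \<inter> O'"
    using assms unfolding openin_flag_topology openin_open by blast
  let ?s = "\<lambda>g :: 'n cmat. g ** diag_scale (1 / det g)"
  have "continuous_on {g :: 'n cmat. det g \<noteq> 0} (\<lambda>g. diag_scale (1 / det g) :: 'n cmat)"
  proof -
    have "continuous_on {g :: 'n cmat. det g \<noteq> 0} (\<lambda>g. if i = j then if pos i = 1 then 1 / det g else 1 else 0)" for i j :: 'n
      by (cases "i = j"; cases "pos i = 1") (auto intro!: continuous_intros continuous_on_subset[OF continuous_det])
    then show ?thesis unfolding diag_scale_def by (intro continuous_on_vec_lambda)
  qed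
  then have "continuous_on {g :: 'n cmat. det g \<noteq> 0} ?s"
    by (intro mm.continuous_on continuous_intros)
  then have "open ({g. det g \<noteq> 0} \<inter> ?s -` O')"
    by (rule continuous_open_preimage[OF _ open_det_nz O'(1)])
  moreover have "{g. det g \<noteq> 0} \<inter> ?s -` O' = {g :: 'n cmat. det g \<noteq> 0 \<and> act g base_flag \<in> D}"
  proof -
    have "?s g \<in> O' \<longleftrightarrow> act g base_flag \<in> D" if "det g \<noteq> 0" for g
      using GL_to_SL[OF that] O'(2) by (metis (mono_tags, lifting) Int_iff mem_Collect_eq)
    then show ?thesis by auto
  qed
  ultimately show ?thesis by simp
qed

lemma SL_R_real: "h \<in> SL_R \<Longrightarrow> conj_mat h = h"
  by (auto simp: SL_R_def conj_mat_def vec_eq_iff Reals_cnj_iff)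

text \<open>
Up to nonzero factors the determinant of \<open>mix k g\<close> depends only on the orbit of the flag of \<open>g\<close> under the
real group.  So if it vanished once, it would vanish on the open set of matrices over \<open>D\<close>.
\<close>

theorem open_orbit_mix_nz:
  fixes D :: "'n::{finite,linorder} flag set"
  assumes D: "open_orbit D" and g: "det g \<noteq> 0" "act g base_flag \<in> D"
  shows "det (mix k g) \<noteq> 0"
proof
  assume z: "det (mix k g) = 0"
  obtain F where F: "F \<in> flags" "D = orbit SL_R F" and openD: "openin flag_topology D"
    using D unfolding open_orbit_def by blast
  have all0: "det (mix k g') = 0" if g': "det g' \<noteq> 0" "act g' base_flag \<in> D" for g'
  proof -
    obtain h where h: "h \<in> SL_R" "act g base_flag = act h F" using g F by (auto simp: orbit_def)
    obtain h' where h': "h' \<in> SL_R" "act g' base_flag = act h' F" using g' F by (auto simp: orbit_def)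
    have det1: "det h = 1" "det h' = 1" using h h' by (auto simp: SL_R_def SL_C_def)
    define G where "G = matrix_inv h ** g"
    have G: "g = h ** G" by (simp add: G_def matrix_mul_assoc det_inv_props det1)
    have "act G base_flag = F"
      using h(2) by (simp add: G_def act_act[symmetric]) (simp add: act_act det_inv_props det1)
    then have eq: "act (h' ** G) base_flag = act g' base_flag" using h'(2) by (simp add: act_act[symmetric])
    have dG: "det (h' ** G) \<noteq> 0" using g(1) det1 by (simp add: G det_mul)
    obtain b where b: "b \<in> upper" "det b \<noteq> 0" "g' = h' ** G ** b"
      by (rule act_base_eqE[OF dG g'(1) eq])
    have "det (mix k G) = 0" using z by (simp add: G mix_real SL_R_real h det_mul det1)
    then show ?thesis
      by (simp add: b(3) mix_mult_upper b(1) mix_real SL_R_real h' det_mul)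
  qed
  \<comment> \<open>a frame with nonzero determinant, which lies on a segment that starts over \<open>D\<close>\<close>
  define u :: "'n cmat" where "u = isotropic_basis (\<lambda>_. \<i>)"
  have u: "det (mix k u) \<noteq> 0"
  proof -
    have "mix k u = u" unfolding u_def by (rule mix_isotropic_basis) simp
    moreover have "det u \<noteq> 0" unfolding u_def by (rule det_isotropic_basis) simp
    ultimately show ?thesis by simp
  qed
  let ?W = "{g :: 'n cmat. det g \<noteq> 0 \<and> act g base_flag \<in> D}"
  have "\<forall>\<^sub>F s in at (0::real). g + s *\<^sub>R (u - g) \<in> ?W"
  proof (rule topological_tendstoD[OF _ open_orbit_preimage[OF openD]])
    show "((\<lambda>s. g + s *\<^sub>R (u - g)) \<longlongrightarrow> g) (at 0)" by (auto intro!: tendsto_eq_intros)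
    show "g \<in> ?W" using g by simp
  qed
  then obtain \<delta> where \<delta>: "0 < \<delta>" "\<And>s. s \<noteq> 0 \<Longrightarrow> dist s 0 < \<delta> \<Longrightarrow> g + s *\<^sub>R (u - g) \<in> ?W"
    unfolding eventually_at by blast
  obtain s where s: "0 < s" "s < \<delta>" "det (mix k g + s *\<^sub>R (mix k u - mix k g)) \<noteq> 0"
    using det_segment[OF u \<delta>(1)] by blast
  have "mix k (g + s *\<^sub>R (u - g)) = mix k g + s *\<^sub>R (mix k u - mix k g)"
    by (simp add: mix_def vec_eq_iff)
  moreover have "det (mix k (g + s *\<^sub>R (u - g))) = 0"
    using \<delta>(2)[of s] s(1,2) all0 by simp
  ultimately show False using s(3) by simp
qed

text \<open>
Inside \<open>E\<^sub>q\<close>, which is real, the intersections with \<open>V\<^sub>r\<close> and with the conjugate of \<open>V\<^bsub>n-r\<^esub>\<close> are independent.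
In terms of matrices: the columns of an invertible matrix that lie in \<open>E\<^sub>q\<close> are at most \<open>q\<close> in number.
\<close>

lemma open_orbit_dominance:
  fixes D :: "'n::{finite,linorder} flag set"
  assumes D: "open_orbit D" and w: "w permutes {1..CARD('n)}" and meet: "schubert_cell w \<inter> D \<noteq> {}"
    and r: "r \<le> CARD('n)" and q: "q \<le> CARD('n)"
  shows "card {i\<in>{1..r}. w i \<le> q} \<le> card {i\<in>{1..r}. w (CARD('n) + 1 - i) \<le> q}"
proof -
  let ?n = "CARD('n)" and ?\<sigma> = "index_perm w :: 'n \<Rightarrow> 'n"
  obtain b where b: "b \<in> upper" "det b \<noteq> 0" "act b (coordinate_flag w) \<in> D"
  proof -
    obtain F where "F \<in> schubert_cell w" "F \<in> D" using meet by blast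
    then show ?thesis using that unfolding mem_schubert_cell[OF w] by blast
  qed
  define g where "g = b ** perm_mat w"
  have dg: "det g \<noteq> 0" using b det_perm_mat[OF w] by (simp add: g_def det_mul)
  have gD: "act g base_flag \<in> D" using b(3) by (simp add: g_def act_act[symmetric] perm_mat_base[OF w])
  have N: "det (mix r g) \<noteq> 0" by (rule open_orbit_mix_nz[OF D dg gD])
  have gij: "g $ i $ j = b $ i $ ?\<sigma> j" for i j by (simp add: g_def monomial_mult_right)
  define J where "J = {j::'n. (pos j \<le> r \<and> pos (?\<sigma> j) \<le> q) \<or> (r < pos j \<and> pos (?\<sigma> (rev_index j)) \<le> q)}"
  define Z where "Z = {x :: (complex, 'n) vec. \<forall>j. j \<notin> J \<longrightarrow> x $ j = 0}"
  have injN: "inj ((*v) (mix r g))" using N inj_matrix_vector_mult invertible_det_nz by blast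
  have "(*v) (mix r g) ` Z \<subseteq> prefix_space q"
  proof (intro subsetI)
    fix y assume "y \<in> (*v) (mix r g) ` Z"
    then obtain x where x: "x \<in> Z" "y = mix r g *v x" by blast
    have "y $ i = 0" if i: "q < pos i" for i
    proof -
      have "mix r g $ i $ j * x $ j = 0" for j
      proof (cases "j \<in> J")
        case True
        then consider "pos j \<le> r" "pos (?\<sigma> j) < pos i" | "\<not> pos j \<le> r" "pos (?\<sigma> (rev_index j)) < pos i"
          using i by (auto simp: J_def simp del: pos_less_iff)
        then have "mix r g $ i $ j = 0"
          using b(1) by cases (simp_all add: mix_def gij upper_def)
        then show ?thesis by simp
      next
        case False then show ?thesis using x(1) by (simp add: Z_def)
      qed
      then have "(\<Sum>j\<in>UNIV. mix r g $ i $ j * x $ j) = 0" by (intro sum.neutral) blast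
      then show ?thesis by (simp add: x(2) matrix_vector_mult_def)
    qed
    then show "y \<in> prefix_space q" by (simp add: prefix_space_def)
  qed
  then have "vec.dim ((*v) (mix r g) ` Z) \<le> vec.dim (prefix_space q :: (complex, 'n) vec set)"
    by (rule vec.dim_subset)
  moreover have "vec.dim ((*v) (mix r g) ` Z) = card J"
    using inj_on_subset[OF injN] dim_coord[of J] by (simp add: vec.dim_image_eq Z_def)
  ultimately have "card J \<le> q" using q by (simp add: dim_prefix)
  moreover have "card J = card {i\<in>{1..r}. w i \<le> q} + card {i\<in>{r+1..?n}. w (?n + 1 - i) \<le> q}"
  proof -
    have p: "pos (?\<sigma> j) = w (pos j)" "pos (?\<sigma> (rev_index j)) = w (?n + 1 - pos j)" for j :: 'n
      by (simp_all add: pos_index_perm[OF w] pos_rev)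
    have "pos ` J = {i\<in>{1..r}. w i \<le> q} \<union> {i\<in>{r+1..?n}. w (?n + 1 - i) \<le> q}"
    proof (intro equalityI subsetI)
      fix i assume "i \<in> pos ` J"
      then obtain j where "j \<in> J" "i = pos j" by blast
      then show "i \<in> {i\<in>{1..r}. w i \<le> q} \<union> {i\<in>{r+1..?n}. w (?n + 1 - i) \<le> q}"
        using pos_ge_1[of j] pos_le[of j] by (auto simp: J_def p pos_rev)
    next
      fix i assume i: "i \<in> {i\<in>{1..r}. w i \<le> q} \<union> {i\<in>{r+1..?n}. w (?n + 1 - i) \<le> q}"
      then have "pos (idx i :: 'n) = i" using r by (intro pos_idx) auto
      then have "idx i \<in> J" using i by (auto simp: J_def p pos_rev)
      then show "i \<in> pos ` J" using \<open>pos (idx i :: 'n) = i\<close> by (metis imageI)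
    qed
    then have "card J = card ({i\<in>{1..r}. w i \<le> q} \<union> {i\<in>{r+1..?n}. w (?n + 1 - i) \<le> q})"
      using card_image[OF inj_pos, of J] by simp
    then show ?thesis by (subst (asm) card_Un_disjoint) auto
  qed
  moreover have "card {i\<in>{1..r}. w (?n + 1 - i) \<le> q} + card {i\<in>{r+1..?n}. w (?n + 1 - i) \<le> q} = q"
  proof -
    have "card {i\<in>{1..r}. w (?n + 1 - i) \<le> q} + card {i\<in>{r+1..?n}. w (?n + 1 - i) \<le> q}
       = card ({i\<in>{1..r}. w (?n + 1 - i) \<le> q} \<union> {i\<in>{r+1..?n}. w (?n + 1 - i) \<le> q})"
      by (rule card_Un_disjoint[symmetric]) auto
    also have "{i\<in>{1..r}. w (?n + 1 - i) \<le> q} \<union> {i\<in>{r+1..?n}. w (?n + 1 - i) \<le> q} = {i\<in>{1..?n}. w (?n + 1 - i) \<le> q}"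
      using r by auto
    also have "card \<dots> = card {1..q}"
    proof (rule bij_betw_same_card[of "\<lambda>i. w (?n + 1 - i)"], rule bij_betw_imageI)
      show "inj_on (\<lambda>i. w (?n + 1 - i)) {i\<in>{1..?n}. w (?n + 1 - i) \<le> q}"
      proof (rule inj_onI)
        fix x y assume x: "x \<in> {i\<in>{1..?n}. w (?n + 1 - i) \<le> q}" and y: "y \<in> {i\<in>{1..?n}. w (?n + 1 - i) \<le> q}"
          and "w (?n + 1 - x) = w (?n + 1 - y)"
        then have "?n + 1 - x = ?n + 1 - y" using permutes_inj[OF w] by (meson injD)
        moreover have "x \<le> ?n" "y \<le> ?n" using x y by simp_all
        ultimately show "x = y" by linarith
      qed
      show "(\<lambda>i. w (?n + 1 - i)) ` {i\<in>{1..?n}. w (?n + 1 - i) \<le> q} = {1..q}"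
      proof (intro equalityI subsetI)
        fix y assume "y \<in> (\<lambda>i. w (?n + 1 - i)) ` {i\<in>{1..?n}. w (?n + 1 - i) \<le> q}"
        then obtain i where i: "i \<in> {1..?n}" "y = w (?n + 1 - i)" "y \<le> q" by blast
        then have "?n + 1 - i \<in> {1..?n}" by auto
        then have "y \<in> {1..?n}" using permutes_in_image[OF w] i(2) by blast
        then show "y \<in> {1..q}" using i(3) by simp
      next
        fix y assume y: "y \<in> {1..q}"
        then have "y \<in> w ` {1..?n}" using permutes_image[OF w] q by auto
        then obtain k where k: "k \<in> {1..?n}" "y = w k" by blast
        then have "?n + 1 - (?n + 1 - k) = k" "?n + 1 - k \<in> {1..?n}" by auto
        then show "y \<in> (\<lambda>i. w (?n + 1 - i)) ` {i\<in>{1..?n}. w (?n + 1 - i) \<le> q}"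
          using k(2) y by (intro image_eqI[of _ _ "?n + 1 - k"]) auto
      qed
    qed
    finally show ?thesis by simp
  qed
  ultimately show ?thesis by linarith
qed

section \<open>Adjoints and the derivative of the determinant\<close>

definition adj :: "'n::finite cmat \<Rightarrow> 'n cmat" where
  "adj M = (\<chi> i j. cnj (M $ j $ i))"

lemma adj_mult: "adj (A ** B) = adj B ** adj A"
  by (simp add: adj_def matrix_matrix_mult_def vec_eq_iff mult.commute)

lemma adj_adj [simp]: "adj (adj M) = M"
  by (simp add: adj_def vec_eq_iff)

lemma adj_real: "conj_mat h = h \<Longrightarrow> adj h = transpose h"
  by (simp add: adj_def conj_mat_def transpose_def vec_eq_iff)

lemma transpose_mult: "transpose ((A :: 'n::finite cmat) ** B) = transpose B ** transpose A"
  by (rule matrix_transpose_mul)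

lemma conj_transpose: "conj_mat (transpose M) = adj M" "transpose (conj_mat M) = adj M"
  by (simp_all add: conj_mat_def transpose_def adj_def vec_eq_iff)

lemma mult_one_commute: "(A :: 'n::finite cmat) ** B = mat 1 \<Longrightarrow> B ** A = mat 1"
  by (simp add: matrix_left_right_inverse)

lemma linear_adj: "linear adj"
  by (rule linearI) (simp_all add: adj_def vec_eq_iff)

lemma linear_transpose: "linear (transpose :: 'n::finite cmat \<Rightarrow> 'n cmat)"
  by (rule linearI) (simp_all add: transpose_def vec_eq_iff)

lemma linear_mix: "linear (mix k)"
  by (rule linearI) (simp_all add: mix_def vec_eq_iff)

lemma linear_has_vector_derivative:
  fixes f :: "'n::finite cmat \<Rightarrow> 'm::finite cmat"
  assumes "linear f" "(C has_vector_derivative X) (at t)"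
  shows "((\<lambda>t. f (C t)) has_vector_derivative f X) (at t)"
proof -
  have "bounded_linear f" using linear_conv_bounded_linear assms(1) by blast
  then show ?thesis using assms(2) by (rule bounded_linear.has_vector_derivative)
qed

lemma entry_has_vector_derivative:
  fixes C :: "real \<Rightarrow> 'n::finite cmat"
  assumes "(C has_vector_derivative X) (at t)"
  shows "((\<lambda>t. C t $ i $ j) has_vector_derivative X $ i $ j) (at t)"
  by (intro bounded_linear.has_vector_derivative[OF bounded_linear_vec_nth] assms)

lemma det_has_vector_derivative_one:
  fixes N :: "real \<Rightarrow> 'n::finite cmat"
  assumes N: "(N has_vector_derivative X) (at 0)" and N0: "N 0 = mat 1"
  shows "((\<lambda>t. det (N t)) has_vector_derivative trace X) (at 0)"
proof -
  have ent: "((\<lambda>t. N t $ i $ j) has_derivative (\<lambda>y. y *\<^sub>R X $ i $ j)) (at 0)" for i j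
    using entry_has_vector_derivative[OF N] by (simp add: has_vector_derivative_def)
  have "((\<lambda>t. det (N t)) has_derivative
     (\<lambda>y. \<Sum>p | p permutes (UNIV :: 'n set). of_int (sign p) * (\<Sum>i\<in>UNIV. (y *\<^sub>R X $ i $ p i) * (\<Prod>j\<in>UNIV - {i}. N 0 $ j $ p j)))) (at 0)"
    unfolding det_def
    by (intro has_derivative_sum has_derivative_mult_right has_derivative_prod ent)
  moreover have "(\<Sum>p | p permutes (UNIV :: 'n set). of_int (sign p) * (\<Sum>i\<in>UNIV. (y *\<^sub>R X $ i $ p i) * (\<Prod>j\<in>UNIV - {i}. N 0 $ j $ p j)))
      = y *\<^sub>R trace X" for y
  proof -
    have z: "(\<Prod>j\<in>UNIV - {i}. N 0 $ j $ p j) = 0" if "p permutes (UNIV :: 'n set)" "p \<noteq> id" for p i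
    proof -
      have "\<exists>j. j \<noteq> i \<and> p j \<noteq> j"
      proof (rule ccontr)
        assume "\<not> ?thesis"
        then have fx: "p j = j" if "j \<noteq> i" for j using that by blast
        have "p i = i"
        proof (rule ccontr)
          assume "p i \<noteq> i"
          then have "p (p i) = p i" by (rule fx)
          then show False using permutes_inj[OF that(1)] \<open>p i \<noteq> i\<close> by (simp add: inj_eq)
        qed
        then have "p = id" using fx by (metis eq_id_iff)
        then show False using that by simp
      qed
      then obtain j where "j \<in> UNIV - {i}" "N 0 $ j $ p j = 0" by (auto simp: N0 mat_def)
      then show ?thesis by (meson finite_Diff finite_code prod_zero)
    qed
    have "(\<Sum>p | p permutes (UNIV :: 'n set). of_int (sign p) * (\<Sum>i\<in>UNIV. (y *\<^sub>R X $ i $ p i) * (\<Prod>j\<in>UNIV - {i}. N 0 $ j $ p j)))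
      = (\<Sum>p\<in>{id}. of_int (sign p) * (\<Sum>i\<in>UNIV. (y *\<^sub>R X $ i $ p i) * (\<Prod>j\<in>UNIV - {i}. N 0 $ j $ p j)))"
    proof (rule sum.mono_neutral_right)
      show "\<forall>p\<in>{p. p permutes (UNIV :: 'n set)} - {id}. of_int (sign p) * (\<Sum>i\<in>UNIV. (y *\<^sub>R X $ i $ p i) * (\<Prod>j\<in>UNIV - {i}. N 0 $ j $ p j)) = 0"
      proof
        fix p assume "p \<in> {p. p permutes (UNIV :: 'n set)} - {id}"
        then have "p permutes (UNIV :: 'n set)" "p \<noteq> id" by simp_all
        note zp = z[OF this]
        show "of_int (sign p) * (\<Sum>i\<in>UNIV. (y *\<^sub>R X $ i $ p i) * (\<Prod>j\<in>UNIV - {i}. N 0 $ j $ p j)) = 0"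
          by (simp only: zp mult_zero_right sum.neutral_const)
      qed
    qed (auto simp: permutes_id)
    also have "\<dots> = (\<Sum>i\<in>UNIV. y *\<^sub>R X $ i $ i)"
      by (simp add: sign_id N0 mat_def)
    finally show ?thesis by (simp add: trace_def scaleR_sum_right)
  qed
  ultimately show ?thesis by (simp add: has_vector_derivative_def)
qed

lemma det_has_vector_derivative:
  fixes N :: "real \<Rightarrow> 'n::finite cmat"
  assumes N: "(N has_vector_derivative X) (at 0)" and nz: "det (N 0) \<noteq> 0"
  shows "((\<lambda>t. det (N t)) has_vector_derivative det (N 0) * trace (X ** matrix_inv (N 0))) (at 0)"
proof -
  have "((\<lambda>t. N t ** matrix_inv (N 0)) has_vector_derivative X ** matrix_inv (N 0)) (at 0)"
    by (rule bounded_linear.has_vector_derivative[OF mm.bounded_linear_left N])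
  then have "((\<lambda>t. det (N t ** matrix_inv (N 0))) has_vector_derivative trace (X ** matrix_inv (N 0))) (at 0)"
    by (rule det_has_vector_derivative_one) (simp add: det_inv_props nz)
  then have "((\<lambda>t. det (N 0) * det (N t ** matrix_inv (N 0))) has_vector_derivative det (N 0) * trace (X ** matrix_inv (N 0))) (at 0)"
    by (rule bounded_linear.has_vector_derivative[OF bounded_linear_mult_right])
  moreover have "det (N 0) * det (N t ** matrix_inv (N 0)) = det (N t)" for t
    using nz by (simp add: det_mul det_inv_props)
  ultimately show ?thesis by simp
qed

section \<open>Unitary frames\<close>

definition herm :: "(complex, 'n::finite) vec \<Rightarrow> (complex, 'n) vec \<Rightarrow> complex" where
  "herm y x = (\<Sum>i\<in>UNIV. cnj (y $ i) * x $ i)"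

lemma inner_herm: "y \<bullet> x = Re (herm y x)"
  by (simp add: herm_def inner_vec_def inner_complex_def)

lemma herm_cnj: "cnj (herm y x) = herm x y"
  by (simp add: herm_def mult.commute)

lemma herm_scale: "herm (c *s y) (d *s x) = cnj c * d * herm y x"
  by (simp add: herm_def sum_distrib_left mult_ac)

lemma herm_self: "herm x x = of_real ((norm x)\<^sup>2)"
proof (rule complex_eqI)
  show "Re (herm x x) = Re (of_real ((norm x)\<^sup>2))"
    by (simp add: inner_herm[symmetric] power2_norm_eq_inner)
  have "Im (cnj (herm x x)) = Im (herm x x)" by (simp only: herm_cnj)
  then show "Im (herm x x) = Im (of_real ((norm x)\<^sup>2))" by simp
qed

lemma complex_subspace_real: "vec.subspace S \<Longrightarrow> subspace (S :: (complex, 'n::finite) vec set)"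
proof (unfold subspace_def, intro conjI ballI allI)
  assume S: "vec.subspace S"
  show "0 \<in> S" by (rule vec.subspace_0[OF S])
  show "x + y \<in> S" if "x \<in> S" "y \<in> S" for x y by (rule vec.subspace_add[OF S that])
  show "c *\<^sub>R x \<in> S" if "x \<in> S" for c x
  proof -
    have "c *\<^sub>R x = of_real c *s x" by (simp add: vec_eq_iff scaleR_conv_of_real[where 'a=complex])
    then show ?thesis using vec.subspace_scale[OF S that] by metis
  qed
qed

text \<open>
For complex subspaces orthogonality for the real inner product is orthogonality for the Hermitian one,
as \<open>y\<close> can be replaced by \<open>\<i> y\<close>.
\<close>

lemma unit_vector_orthogonal:
  fixes S T :: "(complex, 'n::finite) vec set"
  assumes S: "vec.subspace S" and T: "vec.subspace T" and ST: "S \<subset> T"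
  obtains x where "x \<in> T" "herm x x = 1" "\<And>y. y \<in> S \<Longrightarrow> herm y x = 0"
proof -
  have spans: "span S = S" "span T = T" using complex_subspace_real S T span_eq_iff by blast+
  obtain x where x: "x \<noteq> 0" "x \<in> span T" "\<And>y. y \<in> span S \<Longrightarrow> orthogonal x y"
    using orthogonal_to_subspace_exists_gen[of S T] ST spans by metis
  have orth: "herm y x = 0" if y: "y \<in> S" for y
  proof (rule complex_eqI)
    have "orthogonal x y" using x(3) y spans by simp
    then show "Re (herm y x) = Re 0" by (simp add: orthogonal_def inner_herm[symmetric] inner_commute)
    have "\<i> *s y \<in> S" by (rule vec.subspace_scale[OF S y])
    then have "orthogonal x (\<i> *s y)" using x(3) spans by simp
    then have "Re (herm (\<i> *s y) x) = 0" by (simp add: orthogonal_def inner_herm[symmetric] inner_commute)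
    moreover have "herm (\<i> *s y) x = - \<i> * herm y x" using herm_scale[of \<i> y 1 x] by simp
    ultimately show "Im (herm y x) = Im 0" by simp
  qed
  define c where "c = complex_of_real (1 / norm x)"
  show ?thesis
  proof
    show "c *s x \<in> T" using vec.subspace_scale[OF T] x(2) spans by simp
    show "herm (c *s x) (c *s x) = 1"
    proof -
      have "herm (c *s x) (c *s x) = cnj c * c * herm x x" by (rule herm_scale)
      also have "\<dots> = complex_of_real ((1 / norm x) * (1 / norm x) * (norm x)\<^sup>2)"
        by (simp only: herm_self c_def complex_cnj_complex_of_real of_real_mult)
      also have "(1 / norm x) * (1 / norm x) * (norm x)\<^sup>2 = 1" using x(1) by (simp add: power2_eq_square)
      finally show ?thesis by simp
    qed
    show "herm y (c *s x) = 0" if "y \<in> S" for y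
      using herm_scale[of 1 y c x] orth[OF that] by simp
  qed
qed

lemma adj_mult_nth: "(adj A ** B) $ i $ j = herm (column i A) (column j B)"
  by (simp add: adj_def matrix_matrix_mult_def herm_def column_def)

lemma det_unitary_nz:
  assumes "adj u ** u = mat 1" shows "det (u :: 'n::finite cmat) \<noteq> 0"
  using arg_cong[OF assms, of det] by (auto simp: det_mul det_I)

lemma inv_unitary:
  assumes "adj u ** u = mat 1" shows "matrix_inv (u :: 'n::finite cmat) = adj u"
proof -
  have "adj u ** u ** matrix_inv u = adj u"
    by (simp add: matrix_mul_assoc[symmetric] det_inv_props det_unitary_nz[OF assms])
  then show ?thesis by (simp add: assms)
qed

theorem unitary_frame:
  assumes F: "F \<in> (flags :: 'n::{finite,linorder} flag set)"
  obtains u where "adj u ** u = mat 1" "act u base_flag = F"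
proof -
  let ?n = "CARD('n)"
  have sub: "vec.subspace (F p)" if "p \<le> ?n" for p using F that by (auto simp: flags_def)
  have "\<exists>x. x \<in> F p \<and> herm x x = 1 \<and> (\<forall>y\<in>F (p - 1). herm y x = 0)" if p: "p \<in> {1..?n}" for p
  proof -
    have p': "p - 1 \<le> ?n" "p \<le> ?n" "1 \<le> p" using p by auto
    have "F (p - 1) \<subseteq> F p" using flags_mono[OF F _ p'(2)] by simp
    moreover have "F (p - 1) \<noteq> F p" using flags_step[OF F p'(3,2)] by blast
    ultimately obtain x where "x \<in> F p" "herm x x = 1" "\<And>y. y \<in> F (p - 1) \<Longrightarrow> herm y x = 0"
      using unit_vector_orthogonal[OF sub[OF p'(1)] sub[OF p'(2)]] by blast
    then show ?thesis by blast
  qed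
  then obtain e where e: "\<And>p. p \<in> {1..?n} \<Longrightarrow> e p \<in> F p \<and> herm (e p) (e p) = 1 \<and> (\<forall>y\<in>F (p - 1). herm y (e p) = 0)"
    by metis
  define u :: "'n cmat" where "u = (\<chi> i j. e (pos j) $ i)"
  have col: "column j u = e (pos j)" for j by (simp add: u_def column_def vec_eq_iff)
  have lt: "herm (column i u) (column j u) = 0" if "i < j" for i j
  proof -
    have "pos i \<le> pos j - 1" "pos j - 1 \<le> ?n" using that pos_le[of j] by (simp_all flip: pos_less_iff)
    then have "e (pos i) \<in> F (pos j - 1)" using e[OF pos_in[of i]] flags_mono[OF F] by blast
    then show ?thesis unfolding col using e[OF pos_in[of j]] by blast
  qed
  have "(adj u ** u) $ i $ j = mat 1 $ i $ j" for i j
  proof -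
    consider "i < j" | "i = j" | "j < i" by fastforce
    then show ?thesis
    proof cases
      case 1 then show ?thesis unfolding adj_mult_nth using lt by (simp add: mat_def)
    next
      case 2 then show ?thesis unfolding adj_mult_nth col using e[OF pos_in[of j]] by (simp add: mat_def)
    next
      case 3
      then have "herm (column i u) (column j u) = 0" using lt[OF 3] herm_cnj by (metis complex_cnj_zero)
      then show ?thesis unfolding adj_mult_nth using 3 by (simp add: mat_def)
    qed
  qed
  then have un: "adj u ** u = mat 1" by (simp add: vec_eq_iff)
  have "act u base_flag = F"
    by (rule matrix_of_columns_flag[OF F det_unitary_nz[OF un]]) (use col e[OF pos_in] in simp)
  then show ?thesis using that un by blast
qed

section \<open>Rotations\<close>

lemma SO_R_mult: "h \<in> SO_R \<Longrightarrow> k \<in> SO_R \<Longrightarrow> h ** k \<in> SO_R"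
proof -
  assume h: "h \<in> SO_R" and k: "k \<in> SO_R"
  have "transpose (h ** k) ** (h ** k) = transpose k ** (transpose h ** h) ** k"
    by (simp add: transpose_mult matrix_mul_assoc)
  also have "\<dots> = mat 1" using h k by (simp add: SO_R_def)
  finally have 1: "transpose (h ** k) ** (h ** k) = mat 1" .
  have "(h ** k) $ i $ j \<in> \<real>" for i j
    using h k by (auto simp: SO_R_def SL_R_def matrix_matrix_mult_def intro!: sum_in_Reals Reals_mult)
  then show ?thesis using 1 h k by (simp add: SO_R_def SL_R_def SL_C_def det_mul)
qed

lemma orbit_SO_R_trans:
  assumes "p \<in> orbit SO_R F" "h \<in> SO_R"
  shows "act h p \<in> orbit SO_R F"
proof -
  obtain k where "k \<in> SO_R" "p = act k F" using assms(1) by (auto simp: orbit_def)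
  then have "act h p = act (h ** k) F" "h ** k \<in> SO_R" using SO_R_mult[OF assms(2)] by (simp_all add: act_act)
  then show ?thesis unfolding orbit_def by blast
qed

lemma adj_SO_R: "h \<in> SO_R \<Longrightarrow> adj h ** h = mat 1"
proof -
  assume "h \<in> SO_R"
  then have "conj_mat h = h" "transpose h ** h = mat 1" using SL_R_real by (auto simp: SO_R_def)
  then show ?thesis by (simp add: adj_real)
qed

lemma transpose_in_SO_R: "h \<in> SO_R \<Longrightarrow> transpose h \<in> SO_R"
proof -
  assume h: "h \<in> SO_R"
  then have "h ** transpose h = mat 1" using mult_one_commute by (auto simp: SO_R_def)
  then show ?thesis using h by (simp add: SO_R_def SL_R_def SL_C_def det_transpose) (simp add: transpose_def)
qed

lemma orbit_SO_R_connect: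
  assumes "p \<in> orbit SO_R F" "q \<in> orbit SO_R F"
  obtains h where "h \<in> SO_R" "q = act h p"
proof -
  obtain a b where a: "a \<in> SO_R" "p = act a F" and b: "b \<in> SO_R" "q = act b F"
    using assms by (auto simp: orbit_def)
  have "act (transpose a) p = F" using a by (simp add: act_act SO_R_def)
  then have "q = act (b ** transpose a) p" using b by (simp add: act_act[symmetric])
  then show ?thesis using that SO_R_mult[OF b(1) transpose_in_SO_R[OF a(1)]] by blast
qed

definition unit_mat :: "'n::finite \<Rightarrow> 'n \<Rightarrow> 'n cmat" where
  "unit_mat a b = (\<chi> i j. if i = a \<and> j = b then 1 else 0)"

lemma unit_mat_mult: "unit_mat a b ** unit_mat c d = (if b = c then unit_mat a d else 0)"
proof -
  have "(unit_mat a b ** unit_mat c d) $ i $ j = (if b = c then unit_mat a d else 0) $ i $ j" for i j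
  proof -
    have "(unit_mat a b ** unit_mat c d) $ i $ j = (\<Sum>k\<in>UNIV. if k = b then (if i = a then 1 else 0) * unit_mat c d $ k $ j else 0)"
      unfolding matrix_mult_nth by (rule sum.cong) (simp_all add: unit_mat_def)
    then show ?thesis by (simp add: unit_mat_def)
  qed
  then show ?thesis by (simp add: vec_eq_iff)
qed

text \<open>
The one-parameter group generated by the skew matrix \<open>unit_mat a b - unit_mat b a\<close>.
\<close>

definition rotation :: "'n::finite \<Rightarrow> 'n \<Rightarrow> real \<Rightarrow> 'n cmat" where
  "rotation a b t = mat 1 + (cos t - 1) *\<^sub>R (unit_mat a a + unit_mat b b) + sin t *\<^sub>R (unit_mat a b - unit_mat b a)"

lemma rotation_add:
  assumes "a \<noteq> b"
  shows "rotation a b s ** rotation a b t = rotation a b (s + t)"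
proof -
  define P :: "'a cmat" where "P = unit_mat a a + unit_mat b b"
  define G :: "'a cmat" where "G = unit_mat a b - unit_mat b a"
  have rules: "P ** P = P" "P ** G = G" "G ** P = G" "G ** G = - P"
    using assms by (simp_all add: P_def G_def mm.add_left mm.add_right mm.diff_left mm.diff_right unit_mat_mult)
  have "(mat 1 + (cos s - 1) *\<^sub>R P + sin s *\<^sub>R G) ** (mat 1 + (cos t - 1) *\<^sub>R P + sin t *\<^sub>R G)
    = mat 1 + ((cos s - 1) + (cos t - 1) + (cos s - 1) * (cos t - 1) - sin s * sin t) *\<^sub>R P
      + (sin s + sin t + (cos s - 1) * sin t + sin s * (cos t - 1)) *\<^sub>R G"
    by (simp add: mm.add_left mm.add_right mm.diff_left mm.diff_right mm.scaleR_left mm.scaleR_right rules algebra_simps)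
  also have "(cos s - 1) + (cos t - 1) + (cos s - 1) * (cos t - 1) - sin s * sin t = cos (s + t) - 1"
    by (simp add: cos_add algebra_simps)
  also have "sin s + sin t + (cos s - 1) * sin t + sin s * (cos t - 1) = sin (s + t)"
    by (simp add: sin_add algebra_simps)
  finally show ?thesis by (simp only: rotation_def P_def G_def)
qed

lemma rotation_SO_R:
  assumes "a \<noteq> b"
  shows "rotation a b t \<in> SO_R"
proof -
  have tr: "transpose (rotation a b s) = rotation a b (- s)" for s
  proof -
    have tu: "transpose (unit_mat c d) = (unit_mat d c :: 'a cmat)" for c d
      by (auto simp: transpose_def vec_eq_iff unit_mat_def)
    show ?thesis
      by (simp add: rotation_def linear_add[OF linear_transpose] linear_diff[OF linear_transpose]
          linear_scale[OF linear_transpose] tu transpose_mat algebra_simps)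
  qed
  have r0: "rotation a b 0 = mat 1" by (simp add: rotation_def)
  have orth: "transpose (rotation a b s) ** rotation a b s = mat 1" for s
    unfolding tr rotation_add[OF assms] by (simp add: r0)
  have sq: "det (rotation a b s) * det (rotation a b s) = 1" for s
    using arg_cong[OF orth[of s], of det] by (simp add: det_mul det_transpose det_I)
  have "rotation a b t = rotation a b (t / 2) ** rotation a b (t / 2)" by (simp add: rotation_add[OF assms])
  then have "det (rotation a b t) = 1" using sq[of "t / 2"] by (simp add: det_mul)
  moreover have "rotation a b t $ i $ j \<in> \<real>" for i j
  proof -
    have um: "(unit_mat c d :: 'a cmat) $ i $ j = complex_of_real (if i = c \<and> j = d then 1 else 0)" for c d
      by (simp add: unit_mat_def)
    have mt: "(mat 1 :: 'a cmat) $ i $ j = complex_of_real (if i = j then 1 else 0)"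
      by (simp add: mat_def)
    show ?thesis
      unfolding rotation_def vector_add_component vector_minus_component vector_scaleR_component um mt
        scaleR_conv_of_real[where 'a=complex]
      by (intro Reals_add Reals_mult Reals_diff Reals_of_real)
  qed
  ultimately show ?thesis using orth by (simp add: SO_R_def SL_R_def SL_C_def)
qed

lemma mult_indicator_diff:
  "(r::complex) * ((if P then 1 else 0) - (if Q then 1 else 0)) = (if P then r else 0) - (if Q then r else 0)"
  by (cases P; cases Q) simp_all

text \<open>
Rotations of coordinate planes give generators of the real skew matrices as tangent vectors, and the
tangent space is a subspace.
\<close>

lemma real_skew_tangent:
  fixes C\<^sub>0 :: "'n::{finite,linorder} flag set"
  assumes C0: "C\<^sub>0 = orbit SO_R F" and sub: "subspace (tangent C\<^sub>0 p)" and p: "p \<in> C\<^sub>0"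
    and g: "det g \<noteq> 0" "act g base_flag = p"
    and X: "conj_mat X = X" "transpose X = - X"
  shows "X \<in> tangent C\<^sub>0 p"
proof -
  have gen: "unit_mat a b - unit_mat b a \<in> tangent C\<^sub>0 p" for a b
  proof (cases "a = b")
    case True then show ?thesis using subspace_0[OF sub] by simp
  next
    case False
    let ?G = "unit_mat a b - unit_mat b a :: 'n cmat"
    have "(rotation a b has_vector_derivative - sin 0 *\<^sub>R (unit_mat a a + unit_mat b b) + cos 0 *\<^sub>R ?G) (at 0)"
      unfolding rotation_def[abs_def] by (auto intro!: derivative_eq_intros)
    then have "(rotation a b has_vector_derivative ?G) (at 0)" by simp
    then have "((\<lambda>t. rotation a b t ** g) has_vector_derivative ?G ** g) (at 0)"
      by (rule bounded_linear.has_vector_derivative[OF mm.bounded_linear_left])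
    moreover have "rotation a b 0 ** g = g" by (simp add: rotation_def)
    moreover have "act (rotation a b t ** g) base_flag \<in> C\<^sub>0" for t
      using orbit_SO_R_trans[OF _ rotation_SO_R[OF False]] p by (simp add: act_act[symmetric] g C0)
    ultimately show ?thesis
      unfolding tangent_def using g by (intro CollectI exI[of _ "\<lambda>t. rotation a b t ** g"]) simp
  qed
  have re: "X $ i $ j = of_real (Re (X $ i $ j))" for i j
    using arg_cong[OF X(1), of "\<lambda>M. M $ i $ j"] by (simp add: conj_mat_def complex_eq_iff)
  have sk: "X $ j $ i = - X $ i $ j" for i j
    using arg_cong[OF X(2), of "\<lambda>M. M $ i $ j"] by (simp add: transpose_def)
  define S :: "'n cmat" where "S = (\<Sum>a\<in>UNIV. \<Sum>b\<in>UNIV. (Re (X $ a $ b) / 2) *\<^sub>R (unit_mat a b - unit_mat b a))"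
  have XS: "X $ i $ j = S $ i $ j" for i j
  proof -
    have "S $ i $ j
      = (\<Sum>a\<in>UNIV. \<Sum>b\<in>UNIV. (if i = a \<and> j = b then X $ a $ b / 2 else 0) - (if i = b \<and> j = a then X $ a $ b / 2 else 0))"
    proof -
      have "((Re (X $ a $ b) / 2) *\<^sub>R (unit_mat a b - unit_mat b a)) $ i $ j
        = (if i = a \<and> j = b then X $ a $ b / 2 else 0) - (if i = b \<and> j = a then X $ a $ b / 2 else 0)" for a b
      proof -
        have "((Re (X $ a $ b) / 2) *\<^sub>R (unit_mat a b - unit_mat b a)) $ i $ j = (X $ a $ b / 2) * (unit_mat a b $ i $ j - unit_mat b a $ i $ j)"
          by (subst re) (simp add: scaleR_conv_of_real[where 'a=complex])
        then show ?thesis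
          unfolding unit_mat_def vec_lambda_beta by (simp only: mult_indicator_diff)
      qed
      then show ?thesis by (simp only: S_def sum_component)
    qed
    also have "\<dots> = X $ i $ j / 2 - X $ j $ i / 2"
    proof -
      have 1: "(\<Sum>a\<in>UNIV. \<Sum>b\<in>UNIV. if i = a \<and> j = b then X $ a $ b / 2 else 0) = X $ i $ j / 2"
      proof -
        have "(\<Sum>b\<in>UNIV. if i = a \<and> j = b then X $ a $ b / 2 else 0) = (if i = a then X $ a $ j / 2 else 0)" for a
          by (cases "i = a") simp_all
        then show ?thesis by simp
      qed
      have 2: "(\<Sum>a\<in>UNIV. \<Sum>b\<in>UNIV. if i = b \<and> j = a then X $ a $ b / 2 else 0) = X $ j $ i / 2"
      proof -
        have "(\<Sum>b\<in>UNIV. if i = b \<and> j = a then X $ a $ b / 2 else 0) = (if j = a then X $ a $ i / 2 else 0)" for a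
          by (cases "j = a") simp_all
        then show ?thesis by simp
      qed
      show ?thesis by (simp only: sum_subtractf 1 2)
    qed
    also have "\<dots> = X $ i $ j" using sk[of i j] by simp
    finally show ?thesis by simp
  qed
  have "X = S" using XS by (simp add: vec_eq_iff)
  moreover have "S \<in> tangent C\<^sub>0 p"
    unfolding S_def by (intro subspace_sum subspace_scale sub gen)
  ultimately show ?thesis by simp
qed

section \<open>Isotropy of base cycles\<close>

abbreviation diag :: "('n::finite \<Rightarrow> complex) \<Rightarrow> 'n cmat" where
  "diag d \<equiv> monomial_matrix id d"

lemma diag_left: "(diag d ** M) $ i $ j = d i * M $ i $ j"
  using monomial_mult_left[of id d M i j] by simp

lemma diag_right: "(M ** diag d) $ i $ j = M $ i $ j * d j"
  using monomial_mult_right[of M id d i j] by simp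

lemma diag_nth: "diag d $ i $ j = (if i = j then d j else 0)"
  by (simp add: monomial_matrix_def)

lemma adj_diag: "adj (diag d) = diag (\<lambda>i. cnj (d i))"
  by (simp add: vec_eq_iff adj_def diag_nth)

lemma trace_conj: "trace (conj_mat M) = cnj (trace M)"
  by (simp add: trace_def conj_mat_def)

lemma det_conj: "det (conj_mat M) = cnj (det (M :: 'n::finite cmat))"
  by (simp add: det_def conj_mat_def)

lemma det_adj: "det (adj M) = cnj (det (M :: 'n::finite cmat))"
  using det_conj[of "transpose M"] by (simp add: conj_transpose det_transpose)

text \<open>
The leading \<open>k \<times> k\<close> block, completed by the identity so that its determinant is that of a matrix of full
size.  For \<open>M = adj C ** C\<close> the determinant is the squared norm of the Pluecker vector of \<open>V\<^sub>k\<close>.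
\<close>

definition leading_block :: "nat \<Rightarrow> 'n::{finite,linorder} cmat \<Rightarrow> 'n cmat" where
  "leading_block k M = (\<chi> i j. if pos i \<le> k \<and> pos j \<le> k then M $ i $ j else if i = j then 1 else 0)"

text \<open>
The linear part of the affine map \<^const>\<open>leading_block\<close>.
\<close>

definition leading_block0 :: "nat \<Rightarrow> 'n::{finite,linorder} cmat \<Rightarrow> 'n cmat" where
  "leading_block0 k M = (\<chi> i j. if pos i \<le> k \<and> pos j \<le> k then M $ i $ j else 0)"

lemma leading_block_one: "leading_block k (mat 1) = mat 1"
  by (simp add: leading_block_def mat_def vec_eq_iff)

lemma leading_block_has_vector_derivative:
  fixes G :: "real \<Rightarrow> 'n::{finite,linorder} cmat"
  assumes "(G has_vector_derivative Y) (at t)"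
  shows "((\<lambda>t. leading_block k (G t)) has_vector_derivative leading_block0 k Y) (at t)"
proof -
  define K :: "'n cmat" where "K = (\<chi> i j. if pos i \<le> k \<and> pos j \<le> k then 0 else if i = j then 1 else 0)"
  have "linear (leading_block0 k :: 'n cmat \<Rightarrow> 'n cmat)" by (rule linearI) (simp_all add: leading_block0_def vec_eq_iff)
  from linear_has_vector_derivative[OF this assms]
  have "((\<lambda>t. leading_block0 k (G t) + K) has_vector_derivative leading_block0 k Y) (at t)"
    by (simp add: has_vector_derivative_add_const)
  moreover have "leading_block k M = leading_block0 k M + K" for M by (simp add: leading_block_def leading_block0_def K_def vec_eq_iff)
  ultimately show ?thesis by simp
qed

lemma trace_leading_block0: "trace (leading_block0 k M) = (\<Sum>i\<in>{i. pos i \<le> k}. M $ i $ i)"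
proof -
  have "trace (leading_block0 k M) = (\<Sum>i\<in>UNIV. if pos i \<le> k then M $ i $ i else 0)"
    unfolding trace_def by (simp add: leading_block0_def)
  then show ?thesis by (simp add: sum.If_cases)
qed

lemma leading_block_gram:
  assumes b: "b \<in> upper"
  shows "leading_block k (adj b ** b) = adj (leading_block k b) ** leading_block k b"
proof -
  have "leading_block k (adj b ** b) $ i $ j = (adj (leading_block k b) ** leading_block k b) $ i $ j" for i j
  proof -
    have R: "(adj (leading_block k b) ** leading_block k b) $ i $ j = (\<Sum>l\<in>UNIV. cnj (leading_block k b $ l $ i) * leading_block k b $ l $ j)"
      by (simp add: matrix_mult_nth adj_def)
    consider "pos i \<le> k" "pos j \<le> k" | "\<not> pos i \<le> k" | "pos i \<le> k" "\<not> pos j \<le> k" by blast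
    then show ?thesis
    proof cases
      case 1
      have "leading_block k (adj b ** b) $ i $ j = (\<Sum>l\<in>UNIV. cnj (b $ l $ i) * b $ l $ j)"
        using 1 by (simp add: leading_block_def matrix_mult_nth adj_def)
      also have "\<dots> = (\<Sum>l\<in>UNIV. cnj (leading_block k b $ l $ i) * leading_block k b $ l $ j)"
      proof (rule sum.cong)
        fix l
        show "cnj (b $ l $ i) * b $ l $ j = cnj (leading_block k b $ l $ i) * leading_block k b $ l $ j"
        proof (cases "pos l \<le> k")
          case True then show ?thesis using 1 by (simp add: leading_block_def)
        next
          case False
          then have "i < l" using 1(1) by (metis le_less_trans not_le pos_less_iff)
          then have "b $ l $ i = 0" using b by (simp add: upper_def)
          moreover have "leading_block k b $ l $ i = 0" using False 1(1) by (auto simp: leading_block_def)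
          ultimately show ?thesis by simp
        qed
      qed simp
      finally show ?thesis using R by simp
    next
      case 2
      then have "leading_block k b $ l $ i = (if l = i then 1 else 0)" for l by (simp add: leading_block_def)
      then have "(adj (leading_block k b) ** leading_block k b) $ i $ j = leading_block k b $ i $ j"
        unfolding R by (simp add: if_distrib[of cnj] if_distrib[of "\<lambda>z. z * _"] cong: if_cong)
      then show ?thesis using 2 by (simp add: leading_block_def)
    next
      case 3
      then have "leading_block k b $ l $ j = (if l = j then 1 else 0)" for l by (simp add: leading_block_def)
      then have "(adj (leading_block k b) ** leading_block k b) $ i $ j = cnj (leading_block k b $ j $ i)"
        unfolding R by (simp add: if_distrib[of "\<lambda>z. _ * z"] cong: if_cong)
      then show ?thesis using 3 by (auto simp: leading_block_def)
    qed
  qed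
  then show ?thesis by (simp add: vec_eq_iff)
qed

definition leading_product :: "nat \<Rightarrow> 'n::{finite,linorder} cmat \<Rightarrow> complex" where
  "leading_product k b = (\<Prod>i\<in>UNIV. if pos i \<le> k then b $ i $ i else 1)"

lemma det_leading_block_gram:
  assumes b: "b \<in> upper"
  shows "det (leading_block k (adj b ** b)) = cnj (leading_product k b) * leading_product k b"
proof -
  have "leading_block k b \<in> upper" using b by (auto simp: upper_def leading_block_def)
  then have "det (leading_block k b) = leading_product k b"
    unfolding leading_product_def det_upper[OF \<open>leading_block k b \<in> upper\<close>] by (intro prod.cong) (simp_all add: leading_block_def)
  then show ?thesis by (simp add: leading_block_gram[OF b] det_mul det_adj)
qed

lemma det_mix_upper_lead:
  fixes b :: "'n::{finite,linorder} cmat"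
  assumes b: "b \<in> upper" and k: "k \<le> CARD('n)"
  shows "det (mix_upper k b) = leading_product k b * cnj (leading_product (CARD('n) - k) b)"
proof -
  have eq: "pos (rev_index i) \<le> CARD('n) - k \<longleftrightarrow> \<not> pos i \<le> k" for i :: 'n
    using pos_rev_sum[of i] k by linarith
  have "cnj (leading_product (CARD('n) - k) b) = (\<Prod>i\<in>UNIV. if pos i \<le> CARD('n) - k then cnj (b $ i $ i) else 1)"
    by (simp add: leading_product_def if_distrib[of cnj] cong: if_cong)
  also have "\<dots> = (\<Prod>i\<in>UNIV. if pos (rev_index i) \<le> CARD('n) - k then cnj (b $ rev_index i $ rev_index i) else 1)"
    by (rule prod.reindex_bij_betw[OF bij_rev, symmetric])
  finally have "leading_product k b * cnj (leading_product (CARD('n) - k) b) =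
      (\<Prod>i\<in>UNIV. (if pos i \<le> k then b $ i $ i else 1) * (if \<not> pos i \<le> k then cnj (b $ rev_index i $ rev_index i) else 1))"
    by (simp only: leading_product_def eq prod.distrib)
  also have "\<dots> = (\<Prod>i\<in>UNIV. if pos i \<le> k then b $ i $ i else cnj (b $ rev_index i $ rev_index i))"
    by (rule prod.cong) simp_all
  finally show ?thesis by (simp add: det_mix_upper[OF b])
qed

text \<open>
Let \<open>P\<close> be the orthogonal projection to \<open>V\<^sub>k\<close>.  In the direction of \<open>A = P - conj P\<close>, which is \<open>\<i>\<close> times a
real skew matrix, the logarithm of the invariant quotient \<open>|det (mix k C)|\<^sup>2 / (E\<^sub>k E\<^bsub>n-k\<^esub>)\<close> has the derivative
\<open>4 k - 2 (k - tr (P conj P)) - 2 (k - tr (P\<^bsub>n-k\<^esub> conj P))\<close>, with \<open>P\<^bsub>n-k\<^esub>\<close> the projection to \<open>V\<^bsub>n-k\<^esub>\<close>.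
The two remaining traces are sums of squares \<open>|b(u\<^sub>i, u\<^sub>l)|\<^sup>2\<close>, so they are zero if the quotient is constant.
\<close>

lemma base_cycle_isotropic_core:
  fixes C\<^sub>0 D :: "'n::{finite,linorder} flag set"
  assumes D: "open_orbit D" and C0: "C\<^sub>0 = orbit SO_R F" "C\<^sub>0 \<subseteq> D" and sub: "complex_submanifold d C\<^sub>0"
    and p: "p \<in> C\<^sub>0" and u: "adj u ** u = mat 1" "act u base_flag = p"
    and k: "k \<le> CARD('n) - k" "k \<le> CARD('n)"
    and il: "pos i \<le> CARD('n) - k" "pos l \<le> k"
  shows "(transpose u ** u) $ i $ l = 0"
proof -
  let ?n = "CARD('n)"
  define J :: "'n cmat" where "J = diag (\<lambda>j. if pos j \<le> k then 1 else 0)"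
  define P where "P = u ** J ** adj u"
  define A where "A = P - conj_mat P"
  define S where "S = transpose u ** u"
  define T where "T = trace J"
  have uu: "u ** adj u = mat 1" using mult_one_commute[OF u(1)] .
  have detu: "det u \<noteq> 0" by (rule det_unitary_nz[OF u(1)])
  have adjJ: "adj J = J" by (simp add: J_def adj_diag if_distrib[of cnj] cong: if_cong)
  have JJ: "J ** J = J" by (simp add: vec_eq_iff J_def diag_left diag_nth)
  have conjJ: "conj_mat J = J" by (simp add: vec_eq_iff J_def conj_mat_def diag_nth)
  have adjP: "adj P = P" by (simp add: P_def adj_mult adjJ matrix_mul_assoc)
  have tr_conj_adj: "transpose M = conj_mat (adj M)" "adj (conj_mat M) = conj_mat (adj M)" for M :: "'n cmat"
    by (simp_all add: conj_mat_def transpose_def adj_def vec_eq_iff)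
  have adjcP: "adj (conj_mat P) = conj_mat P"
    by (simp only: tr_conj_adj(2) adjP)
  have adjA: "adj A = A" by (simp add: A_def linear_diff[OF linear_adj] adjP adjcP)
  have conjA: "conj_mat A = - A" by (simp add: A_def conj_mat_def vec_eq_iff)
  have trA: "transpose A = - A"
    by (simp only: tr_conj_adj(1) adjA conjA)
  \<comment> \<open>\<open>X\<close> is real and skew, hence tangent; as the tangent space is complex, \<open>A = \<i> X\<close> is tangent as well.\<close>
  define X where "X = cscale (- \<i>) A"
  have "conj_mat X = cscale \<i> (conj_mat A)" by (simp add: X_def conj_mat_def cscale_def vec_eq_iff)
  then have conjX: "conj_mat X = X" by (simp add: conjA X_def cscale_def vec_eq_iff)
  have "transpose X = cscale (- \<i>) (transpose A)" by (simp add: X_def transpose_def cscale_def vec_eq_iff)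
  then have trX: "transpose X = - X" by (simp add: trA X_def cscale_def vec_eq_iff)
  have "X \<in> tangent C\<^sub>0 p"
    by (rule real_skew_tangent[OF C0(1) tangent_submanifold(1)[OF sub p] p detu u(2) conjX trX])
  then have "cscale \<i> X \<in> tangent C\<^sub>0 p" by (rule tangent_submanifold(3)[OF sub p])
  moreover have "cscale \<i> X = A" by (simp add: X_def cscale_def vec_eq_iff)
  ultimately have "A \<in> tangent C\<^sub>0 p" by simp
  then obtain C where C: "C 0 = u" "(C has_vector_derivative A ** u) (at 0)" "\<forall>\<^sub>F t in at 0. act (C t) base_flag \<in> C\<^sub>0"
    using tangent_lift[OF _ detu u(2)] by metis
  define \<nu> where "\<nu> = mix k u"
  have "act u base_flag \<in> D" using u(2) p C0(2) by auto
  then have nz: "det \<nu> \<noteq> 0" unfolding \<nu>_def by (rule open_orbit_mix_nz[OF D detu])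
  \<comment> \<open>The numerator of the quotient has logarithmic derivative \<open>tr (A proj) - tr (A (1 - proj))\<close>, as \<open>conj A = - A\<close>.  Here \<open>proj\<close> is the projection to \<open>V\<^sub>k\<close> along the conjugate of \<open>V\<^bsub>n-k\<^esub>\<close>, which contains the range of \<open>conj P\<close> because \<open>k \<le> n - k\<close>.\<close>
  define f where "f t = det (mix k (C t))" for t
  have mixA: "mix k (A ** u) = A ** \<nu> ** diag (\<lambda>j. if pos j \<le> k then 1 else - 1)"
  proof -
    have "mix k (A ** u) $ i $ j = (A ** \<nu> ** diag (\<lambda>j. if pos j \<le> k then 1 else - 1)) $ i $ j" for i j
    proof (cases "pos j \<le> k")
      case True
      then show ?thesis unfolding diag_right by (simp add: mix_def \<nu>_def matrix_mult_nth)
    next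
      case False
      have "cnj (A $ i $ l) = - A $ i $ l" for l
        using arg_cong[OF conjA, of "\<lambda>M. M $ i $ l"] by (simp add: conj_mat_def)
      then show ?thesis unfolding diag_right using False by (simp add: mix_def \<nu>_def matrix_mult_nth sum_negf)
    qed
    then show ?thesis by (simp add: vec_eq_iff)
  qed
  have T: "cnj T = T" unfolding T_def using trace_conj[of J] by (simp add: conjJ)
  have trP': "trace P = T"
  proof -
    have "trace P = trace (adj u ** (u ** J))" unfolding P_def by (rule trace_mul_sym)
    then show ?thesis by (simp add: matrix_mul_assoc u(1) T_def)
  qed
  have trA0: "trace A = 0" by (simp add: A_def trace_sub trace_conj trP' T)
  define proj where "proj = \<nu> ** J ** matrix_inv \<nu>"
  have nuJ: "\<nu> ** J = u ** J"
    by (simp add: vec_eq_iff J_def diag_right \<nu>_def mix_def)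
  have PiP: "proj ** P = P"
  proof -
    have "proj ** P = \<nu> ** J ** (matrix_inv \<nu> ** \<nu>) ** J ** adj u"
      by (simp add: proj_def P_def nuJ[symmetric] matrix_mul_assoc)
    also have "\<dots> = \<nu> ** (J ** J) ** adj u" by (simp add: det_inv_props nz matrix_mul_assoc)
    finally show ?thesis by (simp add: JJ nuJ P_def)
  qed
  have PicP: "proj ** conj_mat P = 0"
  proof -
    define W :: "'n cmat" where "W = (\<chi> j i. if j = rev_index i \<and> pos i \<le> k then 1 else 0)"
    have far: "\<not> pos (rev_index i) \<le> k" if "pos i \<le> k" for i :: 'n
      using pos_rev_sum[of i] that k by linarith
    have "(conj_mat u ** J) $ a $ i = (\<nu> ** W) $ a $ i" for a i
    proof -
      have "(\<nu> ** W) $ a $ i = (\<Sum>j\<in>UNIV. if j = rev_index i then (if pos i \<le> k then \<nu> $ a $ j else 0) else 0)"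
        unfolding matrix_mult_nth by (rule sum.cong) (simp_all add: W_def)
      also have "\<dots> = (if pos i \<le> k then cnj (u $ a $ i) else 0)"
        using far[of i] by (simp add: \<nu>_def mix_def)
      finally show ?thesis by (simp add: J_def diag_right conj_mat_def)
    qed
    then have uJ: "conj_mat u ** J = \<nu> ** W" by (simp add: vec_eq_iff)
    have JW: "J ** W = 0"
    proof -
      have "(J ** W) $ j $ i = 0" for j i
        unfolding J_def diag_left using far[of i] by (auto simp: W_def)
      then show ?thesis by (simp add: vec_eq_iff)
    qed
    have "conj_mat P = conj_mat u ** J ** conj_mat (adj u)"
      by (simp add: P_def conj_mat_mult conjJ)
    then have "proj ** conj_mat P = \<nu> ** J ** (matrix_inv \<nu> ** \<nu>) ** W ** conj_mat (adj u)"
      by (simp add: proj_def uJ matrix_mul_assoc)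
    also have "\<dots> = \<nu> ** (J ** W) ** conj_mat (adj u)" by (simp add: det_inv_props nz matrix_mul_assoc)
    finally show ?thesis by (simp add: JW)
  qed
  have trAPi: "trace (A ** proj) = T"
  proof -
    have "trace (A ** proj) = trace (proj ** A)" by (rule trace_mul_sym)
    also have "proj ** A = P" by (simp add: A_def mm.diff_right PiP PicP)
    finally show ?thesis by (simp add: trP')
  qed
  have "diag (\<lambda>j. if pos j \<le> k then 1 else - 1) = J + J - mat 1"
    by (simp add: vec_eq_iff J_def diag_nth mat_def)
  then have "mix k (A ** u) ** matrix_inv \<nu> = A ** \<nu> ** (J + J - mat 1) ** matrix_inv \<nu>"
    by (simp only: mixA)
  also have "\<dots> = A ** \<nu> ** J ** matrix_inv \<nu> + A ** \<nu> ** J ** matrix_inv \<nu> - A ** (\<nu> ** matrix_inv \<nu>)"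
    by (simp only: mm.add_left mm.add_right mm.diff_left mm.diff_right matrix_mul_rid matrix_mul_assoc)
  also have "A ** (\<nu> ** matrix_inv \<nu>) = A" by (simp add: det_inv_props nz)
  also have "A ** \<nu> ** J ** matrix_inv \<nu> = A ** proj" by (simp only: proj_def matrix_mul_assoc)
  finally have "mix k (A ** u) ** matrix_inv \<nu> = A ** proj + A ** proj - A" .
  then have trmix: "trace (mix k (A ** u) ** matrix_inv \<nu>) = 2 * T"
    by (simp only: trace_add trace_sub trAPi trA0) simp
  have df: "(f has_vector_derivative det \<nu> * (2 * T)) (at 0)"
    using det_has_vector_derivative[OF linear_has_vector_derivative[OF linear_mix C(2), of k]] nz
    unfolding f_def by (simp add: C(1) \<nu>_def[symmetric] trmix)
  define H where "H = adj u ** A ** u"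
  \<comment> \<open>The denominator of the quotient is \<open>E\<^sub>k E\<^bsub>n-k\<^esub>\<close>; both factors are 1 at 0 because \<open>u\<close> is unitary.\<close>
  define E where "E j t = det (leading_block j (adj (C t) ** C t))" for j t
  have dG: "((\<lambda>t. adj (C t) ** C t) has_vector_derivative H + H) (at 0)"
  proof -
    have "((\<lambda>t. adj (C t) ** C t) has_vector_derivative adj (C 0) ** (A ** u) + adj (A ** u) ** C 0) (at 0)"
      by (rule mm.has_vector_derivative[OF linear_has_vector_derivative[OF linear_adj C(2)] C(2)])
    then show ?thesis by (simp add: C(1) H_def adj_mult adjA matrix_mul_assoc)
  qed
  have dE: "(E j has_vector_derivative 2 * (\<Sum>i\<in>{i. pos i \<le> j}. H $ i $ i)) (at 0)" for j
  proof -
    have "(E j has_vector_derivative trace (leading_block0 j (H + H))) (at 0)"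
      unfolding E_def
      by (rule det_has_vector_derivative_one[OF leading_block_has_vector_derivative[OF dG]]) (simp add: C(1) u(1) leading_block_one)
    then show ?thesis by (simp add: trace_leading_block0 sum.distrib sum_distrib_left)
  qed
  have E0: "E j 0 = 1" for j by (simp add: E_def C(1) u(1) leading_block_one det_I)
  \<comment> \<open>On the cycle \<open>C t = h u b\<close> with \<open>h\<close> real orthogonal and \<open>b\<close> upper triangular, and the diagonal of \<open>b\<close> cancels in the quotient.\<close>
  define \<kappa> where "\<kappa> = det \<nu> * cnj (det \<nu>)"
  have f0: "f 0 = det \<nu>" by (simp add: f_def C(1) \<nu>_def)
  have "\<forall>\<^sub>F t in at 0. det (C t) \<noteq> 0"
    by (rule eventually_det_nz[OF has_vector_derivative_continuous[OF C(2)]]) (use detu C(1) in simp)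
  then have ev: "\<forall>\<^sub>F t in at 0. \<kappa> * (E k t * E (?n - k) t) = f t * cnj (f t)"
    using C(3)
  proof eventually_elim
    case (elim t)
    obtain h where h: "h \<in> SO_R" "act (C t) base_flag = act h p"
      using orbit_SO_R_connect[of p F "act (C t) base_flag"] p elim(2) C0(1) by metis
    have deth: "det h = 1" and conjh: "conj_mat h = h" using h(1) SL_R_real by (auto simp: SO_R_def SL_R_def SL_C_def)
    have "act (h ** u) base_flag = act (C t) base_flag" using h(2) by (simp add: u(2)[symmetric] act_act)
    moreover have "det (h ** u) \<noteq> 0" using detu by (simp add: det_mul deth)
    moreover have "det (C t) \<noteq> 0" using elim(1) by simp
    ultimately obtain b where b: "b \<in> upper" "det b \<noteq> 0" "C t = h ** u ** b"
      using act_base_eqE by metis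
    have "f t = det \<nu> * (leading_product k b * cnj (leading_product (?n - k) b))"
      unfolding f_def b(3) mix_mult_upper[OF b(1)] mix_real[OF conjh]
      by (simp add: det_mul deth \<nu>_def det_mix_upper_lead[OF b(1) k(2)])
    moreover have "adj (C t) ** C t = adj b ** b"
    proof -
      have "adj (C t) ** C t = adj b ** (adj u ** (adj h ** h) ** u) ** b"
        by (simp add: b(3) adj_mult matrix_mul_assoc)
      then show ?thesis by (simp add: adj_SO_R[OF h(1)] u(1))
    qed
    ultimately show ?case by (simp add: E_def det_leading_block_gram[OF b(1)] \<kappa>_def mult_ac)
  qed
  let ?\<Sigma> = "\<lambda>j. \<Sum>i\<in>{i. pos i \<le> j}. H $ i $ i"
  have "((\<lambda>t. \<kappa> * (E k t * E (?n - k) t)) has_vector_derivative \<kappa> * (E k 0 * (2 * ?\<Sigma> (?n - k)) + 2 * ?\<Sigma> k * E (?n - k) 0)) (at 0)"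
    by (intro bounded_linear.has_vector_derivative[OF bounded_linear_mult_right] has_vector_derivative_mult dE)
  from has_vector_derivative_cong_eventually[OF ev _ this]
  have "((\<lambda>t. f t * cnj (f t)) has_vector_derivative \<kappa> * (E k 0 * (2 * ?\<Sigma> (?n - k)) + 2 * ?\<Sigma> k * E (?n - k) 0)) (at 0)"
    by (simp add: E0 \<kappa>_def f0)
  moreover have "((\<lambda>t. f t * cnj (f t)) has_vector_derivative f 0 * cnj (det \<nu> * (2 * T)) + det \<nu> * (2 * T) * cnj (f 0)) (at 0)"
    by (intro has_vector_derivative_mult df bounded_linear.has_vector_derivative[OF bounded_linear_cnj])
  ultimately have "\<kappa> * (E k 0 * (2 * ?\<Sigma> (?n - k)) + 2 * ?\<Sigma> k * E (?n - k) 0) = f 0 * cnj (det \<nu> * (2 * T)) + det \<nu> * (2 * T) * cnj (f 0)"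
    by (rule vector_derivative_unique_at)
  also have "\<dots> = \<kappa> * (4 * T)" by (simp add: f0 \<kappa>_def T)
  finally have "\<kappa> * (2 * ?\<Sigma> (?n - k) + 2 * ?\<Sigma> k) = \<kappa> * (4 * T)" by (simp add: E0)
  moreover have "\<kappa> \<noteq> 0" using nz by (simp add: \<kappa>_def)
  ultimately have four: "2 * ?\<Sigma> (?n - k) + 2 * ?\<Sigma> k = 4 * T"
    unfolding mult_cancel_left by blast
  have halve: "x + y = 2 * T" if "2 * x + 2 * y = 4 * T" for x y :: complex
  proof -
    have "x + y = (2 * x + 2 * y) / 2" by simp
    then show ?thesis by (simp only: that) simp
  qed
  have bal: "?\<Sigma> (?n - k) + ?\<Sigma> k = 2 * T" by (rule halve[OF four])
  \<comment> \<open>the defect from isotropy, which enters the diagonal of \<open>H\<close> with negative sign\<close>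
  define \<beta> where "\<beta> i = (\<Sum>l\<in>{l. pos l \<le> k}. (cmod (S $ i $ l))\<^sup>2)" for i
  have Ssym: "S $ i $ l = S $ l $ i" for i l
    by (simp add: S_def matrix_mult_nth transpose_def mult.commute)
  have Hii: "H $ i $ i = (if pos i \<le> k then 1 else 0) - of_real (\<beta> i)" for i
  proof -
    have "H = adj u ** P ** u - adj u ** conj_mat P ** u"
      by (simp add: H_def A_def mm.diff_left mm.diff_right)
    moreover have "adj u ** P ** u = J"
    proof -
      have "adj u ** P ** u = (adj u ** u) ** J ** (adj u ** u)" by (simp add: P_def matrix_mul_assoc)
      then show ?thesis by (simp add: u(1))
    qed
    moreover have "adj u ** conj_mat P ** u = conj_mat S ** J ** S"
    proof -
      have "conj_mat S = adj u ** conj_mat u" by (simp add: S_def conj_mat_mult conj_transpose)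
      moreover have "conj_mat P = conj_mat u ** J ** transpose u"
        by (simp add: P_def conj_mat_mult conjJ) (simp add: conj_mat_def adj_def transpose_def vec_eq_iff)
      ultimately show ?thesis by (simp add: S_def matrix_mul_assoc)
    qed
    moreover have "(conj_mat S ** J ** S) $ i $ i = of_real (\<beta> i)"
    proof -
      have "(conj_mat S ** J ** S) $ i $ i = (\<Sum>l\<in>UNIV. (conj_mat S ** J) $ i $ l * S $ l $ i)"
        by (rule matrix_mult_nth)
      also have "\<dots> = (\<Sum>l\<in>UNIV. if pos l \<le> k then of_real ((cmod (S $ i $ l))\<^sup>2) else 0)"
      proof (rule sum.cong)
        fix l
        have "cnj (S $ i $ l) * S $ i $ l = of_real ((cmod (S $ i $ l))\<^sup>2)"
          by (metis complex_norm_square mult.commute)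
        then show "(conj_mat S ** J) $ i $ l * S $ l $ i = (if pos l \<le> k then of_real ((cmod (S $ i $ l))\<^sup>2) else 0)"
          unfolding J_def diag_right by (simp add: conj_mat_def Ssym[of l i])
      qed simp
      finally show ?thesis by (simp add: sum.If_cases \<beta>_def)
    qed
    ultimately show ?thesis by (simp add: J_def diag_nth)
  qed
  have Tj: "(\<Sum>i\<in>{i::'n. pos i \<le> j}. if pos i \<le> k then 1 else 0) = T" if "k \<le> j" for j
  proof -
    have "{i::'n. pos i \<le> j} \<inter> {i. pos i \<le> k} = {i. pos i \<le> k}" using that by auto
    then show ?thesis by (simp add: T_def trace_def J_def diag_nth sum.If_cases)
  qed
  have sig: "?\<Sigma> j = T - of_real (\<Sum>i\<in>{i. pos i \<le> j}. \<beta> i)" if "k \<le> j" for j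
    unfolding Hii sum_subtractf Tj[OF that] by simp
  have cancel: "x + y = 0" if "(T - x) + (T - y) = 2 * T" for x y :: complex
  proof -
    have "x + y = 2 * T - ((T - x) + (T - y))" by simp
    then show ?thesis by (simp only: that) simp
  qed
  have "complex_of_real ((\<Sum>i\<in>{i. pos i \<le> ?n - k}. \<beta> i) + (\<Sum>i\<in>{i. pos i \<le> k}. \<beta> i)) = 0"
    unfolding of_real_add by (rule cancel) (simp only: bal[symmetric] sig[OF k(1)] sig[OF order_refl])
  then have "(\<Sum>i\<in>{i. pos i \<le> ?n - k}. \<beta> i) + (\<Sum>i\<in>{i. pos i \<le> k}. \<beta> i) = 0" by (simp only: of_real_eq_0_iff)
  moreover have \<beta>0: "0 \<le> \<beta> i" for i unfolding \<beta>_def by (intro sum_nonneg) simp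
  ultimately have "(\<Sum>i\<in>{i. pos i \<le> ?n - k}. \<beta> i) = 0"
    using sum_nonneg[of "{i. pos i \<le> ?n - k}" \<beta>] sum_nonneg[of "{i. pos i \<le> k}" \<beta>] by (smt (verit) \<beta>0)
  then have "\<beta> i = 0"
    using sum_nonneg_0[of "{i. pos i \<le> ?n - k}" \<beta> i] \<beta>0 il(1) by simp
  then have "(cmod (S $ i $ l))\<^sup>2 = 0"
    unfolding \<beta>_def using sum_nonneg_0[of "{l. pos l \<le> k}" "\<lambda>l. (cmod (S $ i $ l))\<^sup>2" l] il(2) by simp
  then show ?thesis by (simp add: S_def)
qed

section \<open>Isotropic frames\<close>

text \<open>
Unitary frames of isotropic flags: conjugation reverses the order of the columns, which makes
\<open>b(u\<^sub>i, u\<^sub>j)\<close> equal to 1 for \<open>j = rev_index i\<close> and 0 otherwise.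
\<close>

definition iso_unitary :: "'n::{finite,linorder} cmat \<Rightarrow> bool" where
  "iso_unitary u \<longleftrightarrow> adj u ** u = mat 1 \<and> (\<forall>i j. cnj (u $ i $ j) = u $ i $ rev_index j)"

abbreviation rev_mat :: "'n::{finite,linorder} cmat" where
  "rev_mat \<equiv> monomial_matrix rev_index (\<lambda>_. 1)"

lemma rev_mat_right: "(M ** rev_mat) $ i $ j = M $ i $ rev_index j"
  by (simp add: monomial_mult_right)

lemma rev_mat_left: "(rev_mat ** M) $ i $ j = M $ rev_index i $ j"
  using monomial_mult_left[OF bij_rev, of "\<lambda>_. 1" M "rev_index i" j] by simp

lemma rev_mat_nth: "(rev_mat :: 'n::{finite,linorder} cmat) $ i $ j = (if i = rev_index j then 1 else 0)"
  by (simp add: monomial_matrix_def)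

lemma rev_mat_sq: "rev_mat ** rev_mat = (mat 1 :: 'n::{finite,linorder} cmat)"
  by (simp add: vec_eq_iff rev_mat_left rev_mat_nth mat_def)

text \<open>
In a unitary frame \<open>u\<close> of an isotropic flag the matrix \<open>S\<close> of the form \<open>b\<close> vanishes above the antidiagonal.
As \<open>S\<close> is unitary, it is concentrated on the antidiagonal, where a rescaling of the columns makes it 1.
\<close>

lemma base_cycle_iso_frame:
  fixes C\<^sub>0 D :: "'n::{finite,linorder} flag set"
  assumes D: "open_orbit D" and C0: "C\<^sub>0 = orbit SO_R F" "C\<^sub>0 \<subseteq> D" and sub: "complex_submanifold d C\<^sub>0"
    and p: "p \<in> C\<^sub>0"
  obtains u where "iso_unitary u" "act u base_flag = p"
proof -
  let ?n = "CARD('n)"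
  have "p \<in> flags" using sub p by (auto simp: complex_submanifold_def)
  then obtain u where u: "adj u ** u = mat 1" "act u base_flag = p" by (rule unitary_frame)
  have uu: "u ** adj u = mat 1" using mult_one_commute[OF u(1)] .
  define S where "S = transpose u ** u"
  have Ssym: "S $ i $ l = S $ l $ i" for i l
    by (simp add: S_def matrix_mult_nth transpose_def mult.commute)
  have half: "S $ i $ j = 0" if "pos i + pos j \<le> ?n" "pos j \<le> pos i" for i j
    unfolding S_def
    by (rule base_cycle_isotropic_core[OF D C0 sub p u, of "pos j"]) (use that in linarith)+
  have S0: "S $ i $ j = 0" if "pos i + pos j \<le> ?n" for i j
    using half[of i j] half[of j i] that Ssym[of i j] by (metis add.commute nat_le_linear)
  have adjS: "adj S ** S = mat 1"
  proof -
    have "conj_mat u ** transpose u = mat 1"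
      using arg_cong[OF uu, of conj_mat]
      by (simp add: conj_mat_mult) (simp add: conj_mat_def adj_def transpose_def vec_eq_iff mat_def)
    moreover have "adj S = adj u ** conj_mat u"
      by (simp add: S_def adj_mult) (simp add: adj_def conj_mat_def transpose_def vec_eq_iff)
    then have "adj S ** S = adj u ** (conj_mat u ** transpose u) ** u"
      by (simp add: S_def matrix_mul_assoc)
    ultimately show ?thesis by (simp add: u(1))
  qed
  \<comment> \<open>\<open>T\<close> is upper triangular and unitary, hence diagonal.\<close>
  define T where "T = rev_mat ** S"
  have Tn: "T $ i $ j = S $ rev_index i $ j" for i j by (simp add: T_def rev_mat_left)
  have Tu: "T \<in> upper"
    unfolding upper_def
  proof (intro CollectI allI impI)
    fix i j :: 'n assume "j < i"
    then have "pos j < pos i" by simp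
    then have "pos (rev_index i) + pos j \<le> ?n" using pos_rev_sum[of i] by linarith
    then have "S $ rev_index i $ j = 0" by (rule S0)
    then show "T $ i $ j = 0" by (simp add: Tn)
  qed
  have adj_rev: "adj rev_mat = (rev_mat :: 'n cmat)"
    by (auto simp: vec_eq_iff adj_def rev_mat_nth)
  have adjT: "adj T ** T = mat 1"
  proof -
    have "adj T ** T = adj S ** (rev_mat ** rev_mat) ** S"
      by (simp add: T_def adj_mult adj_rev matrix_mul_assoc)
    then show ?thesis by (simp add: rev_mat_sq adjS)
  qed
  have "adj T \<in> upper"
    using upper_inv[OF Tu det_unitary_nz[OF adjT]] by (simp add: inv_unitary[OF adjT])
  then have low0: "T $ i $ j = 0" if "i < j" for i j
    using that unfolding upper_def adj_def by simp
  have offdiag: "T $ i $ j = 0" if "i \<noteq> j" for i j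
    using that low0[of i j] Tu unfolding upper_def by (metis (mono_tags, lifting) linorder_neqE mem_Collect_eq)
  define s where "s i = T $ i $ i" for i
  have snorm: "cnj (s i) * s i = 1" for i
  proof -
    have "(adj T ** T) $ i $ i = (\<Sum>l\<in>UNIV. if l = i then cnj (s i) * s i else 0)"
      unfolding matrix_mult_nth by (rule sum.cong) (auto simp: adj_def s_def offdiag)
    then show ?thesis by (simp add: adjT mat_def)
  qed
  have ssym: "s (rev_index i) = s i" for i
    using Ssym[of i "rev_index i"] by (simp add: s_def Tn)
  \<comment> \<open>Column \<open>i\<close> has to be scaled by \<open>c i\<close> with \<open>c i * c (rev_index i) * s i = 1\<close>.  By symmetry of \<open>S\<close> a square root works, since \<open>csqrt\<close> is a fixed function and therefore agrees at \<open>i\<close> and \<open>rev_index i\<close>.\<close>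
  define c where "c i = csqrt (cnj (s i))" for i
  have csq: "c i * c i = cnj (s i)" for i
    using power2_csqrt[of "cnj (s i)"] by (simp add: c_def power2_eq_square)
  have cnorm: "cnj (c i) * c i = 1" for i
  proof -
    have "cmod (s i) * cmod (s i) = 1" using arg_cong[OF snorm[of i], of cmod] by (simp add: norm_mult)
    then have "cmod (s i) = 1" by (metis abs_norm_cancel abs_square_eq_1 power2_eq_square)
    then have "cmod (c i) = 1" by (simp add: c_def)
    then show ?thesis by (metis complex_norm_square mult.commute of_real_1 one_power2)
  qed
  define v where "v = u ** diag c"
  have v1: "adj v ** v = mat 1"
  proof -
    have "adj v ** v = adj (diag c) ** (adj u ** u) ** diag c"
      by (simp add: v_def adj_mult matrix_mul_assoc)
    then have "adj v ** v = adj (diag c) ** diag c" by (simp add: u(1))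
    then show ?thesis by (simp add: vec_eq_iff adj_diag diag_left diag_nth mat_def cnorm)
  qed
  have v2: "transpose v ** v = rev_mat"
  proof -
    have td: "transpose (diag c) = diag c" by (simp add: vec_eq_iff transpose_def diag_nth)
    have "transpose v ** v = diag c ** (S ** diag c)"
      by (simp add: v_def transpose_mult td S_def matrix_mul_assoc)
    then have e: "(transpose v ** v) $ i $ j = c i * (S $ i $ j * c j)" for i j
      by (simp add: diag_left diag_right)
    have "c i * (S $ i $ j * c j) = rev_mat $ i $ j" for i j
    proof (cases "i = rev_index j")
      case True
      then have "S $ i $ j = s j" by (simp add: s_def Tn)
      moreover have "c i = c j" by (simp add: True c_def ssym)
      moreover have "c j * (s j * c j) = (c j * c j) * s j" by (simp only: mult_ac)
      then have "c j * (s j * c j) = 1" by (simp only: csq snorm)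
      ultimately show ?thesis using True by (simp add: rev_mat_nth)
    next
      case False
      then have "rev_index i \<noteq> j" by auto
      then have "S $ i $ j = 0" using offdiag[of "rev_index i" j] by (simp add: Tn)
      then show ?thesis using False by (simp add: rev_mat_nth)
    qed
    then show ?thesis using e by (simp add: vec_eq_iff)
  qed
  have "conj_mat v ** transpose v = mat 1"
    using arg_cong[OF mult_one_commute[OF v1], of conj_mat]
    by (simp add: conj_mat_mult) (simp add: conj_mat_def adj_def transpose_def vec_eq_iff mat_def)
  then have "conj_mat v ** rev_mat = v"
    unfolding v2[symmetric] by (simp add: matrix_mul_assoc)
  then have "conj_mat v ** (rev_mat ** rev_mat) = v ** rev_mat" by (simp add: matrix_mul_assoc)
  then have "conj_mat v = v ** rev_mat" by (simp add: rev_mat_sq)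
  then have "cnj (v $ i $ j) = v $ i $ rev_index j" for i j
  proof -
    have "cnj (v $ i $ j) = conj_mat v $ i $ j" by (simp add: conj_mat_def)
    also have "\<dots> = (v ** rev_mat) $ i $ j" by (simp only: \<open>conj_mat v = v ** rev_mat\<close>)
    finally show ?thesis by (simp only: rev_mat_right)
  qed
  then have "iso_unitary v" using v1 by (simp add: iso_unitary_def)
  moreover have "act v base_flag = p"
  proof -
    have du: "diag c \<in> upper" by (auto simp: upper_def diag_nth)
    have "c i \<noteq> 0" for i using cnorm[of i] by auto
    then have "det (diag c) \<noteq> 0" using upper_diag_nz[OF du] by (simp add: diag_nth)
    then show ?thesis unfolding v_def by (simp add: act_mult_upper du u(2))
  qed
  ultimately show ?thesis using that by blast
qed

lemma iso_unitary_transpose: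
  assumes "iso_unitary v"
  shows "transpose v ** v = rev_mat" "conj_mat v = v ** rev_mat" "conj_mat (adj v) = rev_mat ** adj v"
proof -
  have c: "cnj (v $ i $ j) = v $ i $ rev_index j" for i j using assms by (simp add: iso_unitary_def)
  have c': "cnj (v $ i $ rev_index j) = v $ i $ j" for i j using c[of i "rev_index j"] by simp
  have "(transpose v ** v) $ i $ j = (adj v ** v) $ rev_index i $ j" for i j
    by (simp add: matrix_mult_nth transpose_def adj_def c')
  moreover have "adj v ** v = mat 1" using assms by (simp add: iso_unitary_def)
  ultimately have e: "(transpose v ** v) $ i $ j = (mat 1 :: 'a cmat) $ rev_index i $ j" for i j by simp
  have "(mat 1 :: 'a cmat) $ rev_index i $ j = rev_mat $ i $ j" for i j
    by (auto simp: mat_def rev_mat_nth)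
  then show "transpose v ** v = rev_mat" using e by (simp add: vec_eq_iff)
  have "conj_mat v $ i $ j = (v ** rev_mat) $ i $ j" for i j
    unfolding rev_mat_right by (simp add: conj_mat_def c)
  then show "conj_mat v = v ** rev_mat" by (simp add: vec_eq_iff)
  have "conj_mat (adj v) $ i $ j = (rev_mat ** adj v) $ i $ j" for i j
    unfolding rev_mat_left by (simp add: conj_mat_def adj_def c)
  then show "conj_mat (adj v) = rev_mat ** adj v" by (simp add: vec_eq_iff)
qed

lemma iso_unitaryD:
  assumes "iso_unitary u"
  shows "adj u ** u = mat 1" "u ** adj u = mat 1" "det u \<noteq> 0" "matrix_inv u = adj u"
  using assms mult_one_commute det_unitary_nz inv_unitary by (auto simp: iso_unitary_def)

section \<open>The tangent space and the dimension of a base cycle\<close>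

text \<open>
The lower parts of matrices in the complex orthogonal Lie algebra, written in an isotropic frame.
\<close>

definition antisymmetric_lower :: "'n::{finite,linorder} cmat set" where
  "antisymmetric_lower = {Y \<in> strictly_lower. \<forall>i j. Y $ rev_index j $ rev_index i = - Y $ i $ j}"

lemma subspace_antisymmetric_lower: "subspace (antisymmetric_lower :: 'n::{finite,linorder} cmat set)"
  by (auto simp: antisymmetric_lower_def subspace_def strictly_lower_def)

text \<open>
The entries below the diagonal and above the antidiagonal.  They are free coordinates on
\<^const>\<open>antisymmetric_lower\<close>: the entries beyond the antidiagonal are their negatives, and those on it
are zero.
\<close>

definition isotropic_entries :: "('n::{finite,linorder} \<times> 'n) set" where
  "isotropic_entries = {(i, j). j < i \<and> pos i + pos j \<le> CARD('n)}"

lemma dim_antisymmetric_lower: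
  "dim (antisymmetric_lower :: 'n::{finite,linorder} cmat set) = 2 * card (isotropic_entries :: ('n \<times> 'n) set)"
proof -
  let ?Q = "isotropic_entries :: ('n \<times> 'n) set"
  define \<rho> :: "'n cmat \<Rightarrow> 'n cmat" where "\<rho> Y = (\<chi> i j. if (i, j) \<in> ?Q then Y $ i $ j else 0)" for Y
  have lin: "linear \<rho>" by (rule linearI) (simp_all add: \<rho>_def vec_eq_iff)
  have far: "(rev_index j, rev_index i) \<in> ?Q" if "j < i" "\<not> pos i + pos j \<le> CARD('n)" "i \<noteq> rev_index j" for i j :: 'n
  proof -
    have "pos i \<noteq> pos (rev_index j)" using that(3) by simp
    then have "pos (rev_index j) + pos (rev_index i) \<le> CARD('n)"
      using pos_rev_sum[of i] pos_rev_sum[of j] that(2) by linarith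
    then show ?thesis using that(1) by (simp add: isotropic_entries_def)
  qed
  have disj: "(rev_index j, rev_index i) \<notin> ?Q" if "(i, j) \<in> ?Q" for i j :: 'n
  proof -
    have "pos i + pos j \<le> CARD('n)" using that by (simp add: isotropic_entries_def)
    then have "\<not> pos (rev_index j) + pos (rev_index i) \<le> CARD('n)"
      using pos_rev_sum[of i] pos_rev_sum[of j] by linarith
    then show ?thesis by (simp add: isotropic_entries_def)
  qed
  have inj: "inj_on \<rho> antisymmetric_lower"
  proof (rule inj_onI)
    fix Y Z :: "'n cmat" assume Y: "Y \<in> antisymmetric_lower" and Z: "Z \<in> antisymmetric_lower" and eq: "\<rho> Y = \<rho> Z"
    have Q: "Y $ i $ j = Z $ i $ j" if "(i, j) \<in> ?Q" for i j
      using arg_cong[OF eq, of "\<lambda>M. M $ i $ j"] that by (simp add: \<rho>_def)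
    have sy: "Y $ i $ j = - Y $ rev_index j $ rev_index i" "Z $ i $ j = - Z $ rev_index j $ rev_index i" for i j
      using Y Z unfolding antisymmetric_lower_def by (metis (mono_tags, lifting) add.inverse_inverse mem_Collect_eq)+
    have "Y $ i $ j = Z $ i $ j" for i j
    proof (cases "j < i")
      case False
      then show ?thesis using Y Z by (simp add: antisymmetric_lower_def strictly_lower_def)
    next
      case lt: True
      show ?thesis
      proof (cases "pos i + pos j \<le> CARD('n)")
        case True
        then show ?thesis using lt by (intro Q) (simp add: isotropic_entries_def)
      next
        case nle: False
        show ?thesis
        proof (cases "i = rev_index j")
          case True
          have "Y $ i $ j = - Y $ i $ j" using sy(1)[of i j] True by simp
          moreover have "Z $ i $ j = - Z $ i $ j" using sy(2)[of i j] True by simp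
          ultimately show ?thesis by (simp add: complex_eq_iff)
        next
          case False
          show ?thesis using sy[of i j] Q[OF far[OF lt nle False]] by simp
        qed
      qed
    qed
    then show "Y = Z" by (simp add: vec_eq_iff)
  qed
  have img: "\<rho> ` antisymmetric_lower = {X. \<forall>i j. (i, j) \<notin> ?Q \<longrightarrow> X $ i $ j = 0}"
  proof (intro equalityI subsetI)
    fix X assume "X \<in> \<rho> ` antisymmetric_lower"
    then obtain Y where "X = \<rho> Y" by blast
    then show "X \<in> {X. \<forall>i j. (i, j) \<notin> ?Q \<longrightarrow> X $ i $ j = 0}" by (simp add: \<rho>_def)
  next
    fix X :: "'n cmat" assume X: "X \<in> {X. \<forall>i j. (i, j) \<notin> ?Q \<longrightarrow> X $ i $ j = 0}"
    define Y :: "'n cmat" where "Y = (\<chi> i j. if (i, j) \<in> ?Q then X $ i $ j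
      else if (rev_index j, rev_index i) \<in> ?Q then - X $ rev_index j $ rev_index i else 0)"
    have "Y \<in> strictly_lower" by (simp add: strictly_lower_def Y_def isotropic_entries_def not_less[symmetric])
    moreover have "Y $ rev_index j $ rev_index i = - Y $ i $ j" for i j
      using disj[of i j] by (simp add: Y_def)
    ultimately have "Y \<in> antisymmetric_lower" by (simp add: antisymmetric_lower_def)
    moreover have "X = \<rho> Y" using X by (simp add: vec_eq_iff \<rho>_def Y_def)
    ultimately show "X \<in> \<rho> ` antisymmetric_lower" by blast
  qed
  have "span antisymmetric_lower = (antisymmetric_lower :: 'n cmat set)"
    using subspace_antisymmetric_lower span_eq_iff by blast
  then have "inj_on \<rho> (span antisymmetric_lower)" using inj by (simp only:)
  then have "dim (\<rho> ` antisymmetric_lower) = dim (antisymmetric_lower :: 'n cmat set)"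
    by (rule dim_image_eq[OF lin])
  then show ?thesis unfolding img dim_entries by simp
qed

lemma low_adj_lower: "Y \<in> strictly_lower \<Longrightarrow> low (adj Y) = 0"
  by (simp add: low_def adj_def strictly_lower_def vec_eq_iff)

text \<open>
A curve of isotropic flags keeps \<open>b(V\<^sub>i, V\<^sub>j) = 0\<close> for \<open>i + j \<le> n\<close>, and the derivatives of these equations
say that the lower part is antisymmetric.  Conversely, an antisymmetric lower part is the lower part
of a real skew matrix, and the difference to it stabilizes the flag.
\<close>

lemma tangent_base_cycle:
  fixes C\<^sub>0 D :: "'n::{finite,linorder} flag set"
  assumes D: "open_orbit D" and C0: "C\<^sub>0 = orbit SO_R F" "C\<^sub>0 \<subseteq> D" and sub: "complex_submanifold d C\<^sub>0"
    and p: "p \<in> C\<^sub>0" and u: "iso_unitary u" "act u base_flag = p"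
  shows "tangent C\<^sub>0 p = {X. low (matrix_inv u ** X ** u) \<in> antisymmetric_lower}"
proof (intro equalityI subsetI)
  note uD = iso_unitaryD[OF u(1)]
  note uT = iso_unitary_transpose[OF u(1)]
  fix X assume "X \<in> tangent C\<^sub>0 p"
  then obtain C where C: "C 0 = u" "(C has_vector_derivative X ** u) (at 0)" "\<forall>\<^sub>F t in at 0. act (C t) base_flag \<in> C\<^sub>0"
    using tangent_lift[OF _ uD(3) u(2)] by metis
  have "\<forall>\<^sub>F t in at 0. det (C t) \<noteq> 0"
    by (rule eventually_det_nz[OF has_vector_derivative_continuous[OF C(2)]]) (use uD(3) C(1) in simp)
  then have ev: "\<forall>\<^sub>F t in at 0. \<forall>i j. pos i + pos j \<le> CARD('n) \<longrightarrow> (transpose (C t) ** C t) $ i $ j = 0"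
    using C(3)
  proof eventually_elim
    case (elim t)
    obtain v where v: "iso_unitary v" "act v base_flag = act (C t) base_flag"
      using base_cycle_iso_frame[OF D C0 sub elim(2)] by metis
    have "det (C t) \<noteq> 0" using elim(1) by simp
    then obtain b where b: "b \<in> upper" "C t = v ** b"
      using act_base_eqE[OF iso_unitaryD(3)[OF v(1)] _ v(2)] by metis
    have "transpose (C t) ** C t = transpose b ** (transpose v ** v) ** b"
      by (simp add: b(2) transpose_mult matrix_mul_assoc)
    then have eq: "transpose (C t) ** C t = transpose b ** (rev_mat ** b)"
      by (simp add: iso_unitary_transpose[OF v(1)] matrix_mul_assoc)
    show ?case
    proof (intro allI impI)
      fix i j :: 'n assume ij: "pos i + pos j \<le> CARD('n)"
      have "b $ l $ i * b $ rev_index l $ j = 0" for l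
      proof (rule ccontr)
        assume nz: "b $ l $ i * b $ rev_index l $ j \<noteq> 0"
        then have "\<not> i < l" "\<not> j < rev_index l" using b(1) unfolding upper_def by auto
        then have "pos l \<le> pos i" "pos (rev_index l) \<le> pos j" by (simp_all add: not_less)
        then show False using pos_rev_sum[of l] ij by linarith
      qed
      then show "(transpose (C t) ** C t) $ i $ j = 0"
        unfolding eq matrix_mult_nth[of "transpose b"] rev_mat_left
        by (intro sum.neutral ballI) (simp only: transpose_def vec_lambda_beta)
    qed
  qed
  define T where "T = matrix_inv u ** X ** u"
  have dG: "((\<lambda>t. transpose (C t) ** C t) has_vector_derivative transpose u ** (X ** u) + transpose (X ** u) ** u) (at 0)"
    using mm.has_vector_derivative[OF linear_has_vector_derivative[OF linear_transpose C(2)] C(2)] by (simp add: C(1))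
  have uX: "transpose u ** (X ** u) = rev_mat ** T"
  proof -
    have "X ** u = u ** T" by (simp add: T_def uD matrix_mul_assoc)
    then show ?thesis by (simp add: matrix_mul_assoc uT)
  qed
  have trXu: "transpose (X ** u) ** u = transpose (rev_mat ** T)"
    unfolding uX[symmetric] by (simp add: transpose_mult)
  have rel: "T $ rev_index i $ j + T $ rev_index j $ i = 0" if ij: "pos i + pos j \<le> CARD('n)" for i j
  proof -
    have d1: "((\<lambda>t. (transpose (C t) ** C t) $ i $ j) has_vector_derivative (rev_mat ** T + transpose (rev_mat ** T)) $ i $ j) (at 0)"
      using entry_has_vector_derivative[OF dG] by (simp only: uX trXu)
    have ev0: "\<forall>\<^sub>F t in at 0. (transpose (C t) ** C t) $ i $ j = 0"
      using ev by (rule eventually_mono) (use ij in blast)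
    have at0: "(transpose (C 0) ** C 0) $ i $ j = 0"
    proof -
      have "i \<noteq> rev_index j" using ij pos_rev_sum[of j] by auto
      then show ?thesis by (simp add: C(1) uT rev_mat_nth)
    qed
    have "((\<lambda>t::real. 0::complex) has_vector_derivative (rev_mat ** T + transpose (rev_mat ** T)) $ i $ j) (at 0)"
      by (rule has_vector_derivative_cong_eventually[OF ev0 at0 d1])
    then have "(rev_mat ** T + transpose (rev_mat ** T)) $ i $ j = 0"
      using vector_derivative_unique_at has_vector_derivative_const by blast
    moreover have "transpose (rev_mat ** T) $ i $ j = (rev_mat ** T) $ j $ i" by (simp add: transpose_def)
    ultimately show ?thesis by (simp add: rev_mat_left)
  qed
  have "low T $ rev_index j $ rev_index i = - low T $ i $ j" for i j
  proof (cases "j < i")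
    case True
    then have "pos j < pos i" by simp
    then have "pos (rev_index i) + pos j \<le> CARD('n)" using pos_rev_sum[of i] by linarith
    from rel[OF this] have "T $ i $ j + T $ rev_index j $ rev_index i = 0" by simp
    then show ?thesis using True by (simp add: low_def eq_neg_iff_add_eq_0 add.commute)
  next
    case False
    then show ?thesis by (simp add: low_def)
  qed
  then show "X \<in> {X. low (matrix_inv u ** X ** u) \<in> antisymmetric_lower}"
    by (simp add: antisymmetric_lower_def T_def)
next
  note uD = iso_unitaryD[OF u(1)]
  note uT = iso_unitary_transpose[OF u(1)]
  have subT: "subspace (tangent C\<^sub>0 p)" by (rule tangent_submanifold(1)[OF sub p])
  fix X assume "X \<in> {X. low (matrix_inv u ** X ** u) \<in> antisymmetric_lower}"
  then have XY: "low (matrix_inv u ** X ** u) \<in> antisymmetric_lower" by simp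
  define Y where "Y = low (matrix_inv u ** X ** u)"
  have Y: "Y \<in> strictly_lower" and anti: "\<And>i j. Y $ rev_index j $ rev_index i = - Y $ i $ j"
    using XY by (auto simp: Y_def antisymmetric_lower_def)
  \<comment> \<open>the skew-Hermitian matrix with lower part \<open>Y\<close>; in the frame \<open>u\<close> it represents a real matrix because \<open>Y\<close> is antisymmetric\<close>
  define Z where "Z = Y - adj Y"
  define X0 where "X0 = u ** Z ** adj u"
  have adjZ: "adj Z = - Z" by (simp add: Z_def linear_diff[OF linear_adj])
  have adjX0: "adj X0 = - X0"
    by (simp add: X0_def adj_mult adjZ matrix_mul_assoc mm.minus_left mm.minus_right)
  have revZ: "rev_mat ** conj_mat Z ** rev_mat = Z"
  proof -
    have "(rev_mat ** conj_mat Z ** rev_mat) $ i $ j = Z $ i $ j" for i j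
      unfolding rev_mat_right rev_mat_left
      using anti[of i j] anti[of j i] by (simp add: conj_mat_def Z_def adj_def)
    then show ?thesis by (simp add: vec_eq_iff)
  qed
  have conjX0: "conj_mat X0 = X0"
  proof -
    have "conj_mat X0 = u ** (rev_mat ** conj_mat Z ** rev_mat) ** adj u"
      by (simp add: X0_def conj_mat_mult uT matrix_mul_assoc)
    then show ?thesis by (simp add: revZ X0_def)
  qed
  have "transpose X0 = - X0"
  proof -
    have "transpose X0 = adj (conj_mat X0)" by (simp add: transpose_def adj_def conj_mat_def vec_eq_iff)
    then show ?thesis by (simp add: conjX0 adjX0)
  qed
  then have X0T: "X0 \<in> tangent C\<^sub>0 p"
    by (rule real_skew_tangent[OF C0(1) subT p uD(3) u(2) conjX0])
  define X1 where "X1 = X - X0"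
  define \<beta> where "\<beta> = matrix_inv u ** X1 ** u"
  have "\<beta> = matrix_inv u ** X ** u - Z"
  proof -
    have "matrix_inv u ** X0 ** u = (adj u ** u) ** Z ** (adj u ** u)" by (simp add: uD(4) X0_def matrix_mul_assoc)
    then have "matrix_inv u ** X0 ** u = Z" by (simp add: uD(1))
    then show ?thesis by (simp add: \<beta>_def X1_def mm.diff_left mm.diff_right)
  qed
  then have "low \<beta> = 0"
    using low_id[OF Y] low_adj_lower[OF Y] by (simp add: linear_diff[OF linear_low] Z_def Y_def[symmetric])
  then have bu: "\<beta> \<in> upper" using low_plus_up[of \<beta>] up_upper[of \<beta>] by simp
  have X1T: "X1 \<in> tangent C\<^sub>0 p"
  proof -
    define C where "C t = u ** (mat 1 + t *\<^sub>R \<beta>)" for t :: real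
    have C0': "C 0 = u" by (simp add: C_def)
    have "((\<lambda>t::real. mat 1 + t *\<^sub>R \<beta>) has_vector_derivative \<beta>) (at 0)" by (auto intro!: derivative_eq_intros)
    then have "(C has_vector_derivative u ** \<beta>) (at 0)"
      unfolding C_def by (rule bounded_linear.has_vector_derivative[OF mm.bounded_linear_right])
    moreover have "u ** \<beta> = X1 ** u" by (simp add: \<beta>_def matrix_mul_assoc uD)
    ultimately have dC: "(C has_vector_derivative X1 ** C 0) (at 0)" by (simp add: C0')
    have "\<forall>\<^sub>F t in at (0::real). det (mat 1 + t *\<^sub>R \<beta>) \<noteq> 0"
      by (rule eventually_det_nz) (auto intro!: continuous_intros simp: det_I)
    then have "\<forall>\<^sub>F t in at 0. act (C t) base_flag \<in> C\<^sub>0"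
    proof (rule eventually_mono)
      fix t :: real assume "det (mat 1 + t *\<^sub>R \<beta>) \<noteq> 0"
      moreover have "mat 1 + t *\<^sub>R \<beta> \<in> upper" by (intro subspace_add subspace_upper subspace_scale upper_one bu)
      ultimately have "act (C t) base_flag = p" by (simp add: C_def act_mult_upper u(2))
      then show "act (C t) base_flag \<in> C\<^sub>0" using p by simp
    qed
    then show ?thesis unfolding tangent_def using dC C0' uD(3) u(2) by auto
  qed
  have "X0 + X1 \<in> tangent C\<^sub>0 p" by (rule subspace_add[OF subT X0T X1T])
  then show "X \<in> tangent C\<^sub>0 p" by (simp add: X1_def)
qed

theorem cdim_base_cycle:
  fixes C\<^sub>0 D :: "'n::{finite,linorder} flag set"
  assumes D: "open_orbit D" and C0: "C\<^sub>0 = orbit SO_R F" "C\<^sub>0 \<subseteq> D" and sub: "complex_submanifold d C\<^sub>0"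
    and p: "p \<in> C\<^sub>0"
  shows "cdim C\<^sub>0 = card (isotropic_entries :: ('n \<times> 'n) set)"
proof -
  obtain u where u: "iso_unitary u" "act u base_flag = p" by (rule base_cycle_iso_frame[OF D C0 sub p])
  have lower: "antisymmetric_lower \<subseteq> (strictly_lower :: 'n cmat set)" by (auto simp: antisymmetric_lower_def)
  have "dim (tangent C\<^sub>0 p) = 2 * card (isotropic_entries :: ('n \<times> 'n) set) + dim (upper :: 'n cmat set)"
    unfolding tangent_base_cycle[OF D C0 sub p u]
    by (simp only: dim_conj_low(2)[OF iso_unitaryD(3)[OF u(1)] subspace_antisymmetric_lower lower] dim_antisymmetric_lower)
  then have "d = card (isotropic_entries :: ('n \<times> 'n) set)"
    using tangent_submanifold(2)[OF sub p] by linarith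
  then show ?thesis using cdim_submanifold[OF sub] p by blast
qed

text \<open>
The codimension of the base cycle is \<open>m (n - m)\<close>.  Counting the inversions of the permutation that reverses
the order by layers gives all pairs on the left and exactly the entries of \<^const>\<open>isotropic_entries\<close>
in the correction term.
\<close>

lemma dimension_balance:
  "card {(i::'n::{finite,linorder}, j::'n). j < i} =
     CARD('n) div 2 * (CARD('n) - CARD('n) div 2) + card (isotropic_entries :: ('n \<times> 'n) set)"
proof -
  let ?n = "CARD('n)" and ?m = "CARD('n) div 2"
  \<comment> \<open>In the reversed order all pairs are inverted, and every middle entry lies between the entries of each outer pair.\<close>
  define w where "w k = (if k \<in> {1..?n} then ?n + 1 - k else k)" for k :: nat
  have w: "w permutes {1..?n}"
  proof (rule bij_imp_permutes)
    show "bij_betw w {1..?n} {1..?n}"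
      by (rule bij_betw_byWitness[of _ w]) (auto simp: w_def)
    show "w k = k" if "k \<notin> {1..?n}" for k using that by (simp only: w_def if_False)
  qed
  have "index_perm w j = rev_index j" for j :: 'n
    using pos_in[of j] unfolding index_perm_def rev_index_def w_def by simp
  then have "{(i::'n, j::'n). j < i} = cell_directions w" by (simp add: cell_directions_def)
  then have N: "card {(i::'n, j::'n). j < i} = inversions ?n w" using card_cell_directions[OF w] by simp
  have bad: "{p\<in>{1..?m}. w p < w (?n + 1 - p)} = {}" by (auto simp: w_def)
  have one: "pair_sign ?n w p (w x) = 1" if "p \<in> {1..?m}" "x \<in> {p+1..?n-p}" for p x
    using that by (auto simp: pair_sign_def w_def)
  have "(\<Sum>p\<in>{1..?m}. \<Sum>x\<in>{p+1..?n-p}. pair_sign ?n w p (w x)) = (\<Sum>p\<in>{1..?m}. int (card {p+1..?n-p}))"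
    by (rule sum.cong) (simp_all add: one)
  also have "\<dots> = int (card (SIGMA p:{1..?m}. {p+1..?n-p}))" by simp
  also have "card (SIGMA p:{1..?m}. {p+1..?n-p}) = card (isotropic_entries :: ('n \<times> 'n) set)"
  proof (rule bij_betw_same_card[of "\<lambda>(b, a). (idx a :: 'n, idx b :: 'n)"], rule bij_betw_imageI)
    show "inj_on (\<lambda>(b, a). (idx a :: 'n, idx b :: 'n)) (SIGMA p:{1..?m}. {p+1..?n-p})"
      by (rule inj_on_inverseI[where g = "\<lambda>(i::'n, j::'n). (pos j, pos i)"]) (auto intro!: pos_idx)
    show "(\<lambda>(b, a). (idx a :: 'n, idx b :: 'n)) ` (SIGMA p:{1..?m}. {p+1..?n-p}) = isotropic_entries"
    proof (intro equalityI subsetI)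
      fix z assume "z \<in> (\<lambda>(b, a). (idx a :: 'n, idx b :: 'n)) ` (SIGMA p:{1..?m}. {p+1..?n-p})"
      then obtain a b where z: "z = (idx a, idx b)" and ab: "1 \<le> b" "b \<le> ?m" "b + 1 \<le> a" "a \<le> ?n - b" by auto
      then have p: "pos (idx a :: 'n) = a" "pos (idx b :: 'n) = b" by (auto intro!: pos_idx)
      have "(idx b :: 'n) < idx a" using p ab by (metis Suc_eq_plus1 Suc_le_eq pos_less_iff)
      then show "z \<in> isotropic_entries" using ab by (simp add: z isotropic_entries_def p)
    next
      fix z assume "z \<in> (isotropic_entries :: ('n \<times> 'n) set)"
      then obtain i j :: 'n where z: "z = (i, j)" "j < i" "pos i + pos j \<le> ?n" by (auto simp: isotropic_entries_def)
      have "pos j < pos i" using z(2) by simp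
      then have "1 \<le> pos j" "pos j \<le> ?m" "pos j + 1 \<le> pos i" "pos i \<le> ?n - pos j"
        using z(3) pos_ge_1[of j] by linarith+
      then have "(pos j, pos i) \<in> (SIGMA p:{1..?m}. {p+1..?n-p})" by (simp only: mem_Sigma_iff atLeastAtMost_iff simp_thms)
      then show "z \<in> (\<lambda>(b, a). (idx a :: 'n, idx b :: 'n)) ` (SIGMA p:{1..?m}. {p+1..?n-p})"
        by (rule rev_image_eqI) (simp add: z(1))
    qed
  qed
  finally have "int (inversions ?n w) = int (?m * (?n - ?m)) + int (card (isotropic_entries :: ('n \<times> 'n) set))"
    using inversions_by_layers[OF w refl] by (simp only: bad card.empty)
  then show ?thesis unfolding N by linarith
qed

section \<open>Schubert cells that meet the base cycle\<close>

lemma isotropic_basis_gram: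
  assumes e: "\<And>j. cnj (e j) * e j = 1"
  shows "adj (isotropic_basis e) ** isotropic_basis e = diag (\<lambda>j::'n::{finite,linorder}. if j = rev_index j then 1 else 2)"
proof -
  let ?B = "isotropic_basis e :: 'n cmat"
  have "(adj ?B ** ?B) $ i $ j = diag (\<lambda>j. if j = rev_index j then 1 else 2) $ i $ j" for i j
  proof -
    have "(adj ?B ** ?B) $ i $ j = (\<Sum>l\<in>UNIV. cnj (?B $ l $ i) * ?B $ l $ j)"
      by (simp add: matrix_mult_nth adj_def)
    also have "\<dots> = (\<Sum>l\<in>{i, rev_index i}. cnj (?B $ l $ i) * ?B $ l $ j)"
      by (rule sum.mono_neutral_right) (auto simp: isotropic_basis_def)
    also have "\<dots> = diag (\<lambda>j. if j = rev_index j then 1 else 2) $ i $ j"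
    proof (cases "i = rev_index i")
      case True
      then have r: "rev_index i = i" by simp
      have ij: "i = rev_index j \<longleftrightarrow> i = j" using r by (metis rev_rev)
      have "(\<Sum>l\<in>{i, rev_index i}. cnj (?B $ l $ i) * ?B $ l $ j) = ?B $ i $ j"
        by (simp add: r isotropic_basis_def)
      also have "?B $ i $ j = (if i = j then 1 else 0)"
        using r ij by (auto simp: isotropic_basis_def)
      finally show ?thesis using r by (auto simp: diag_nth)
    next
      case False
      then have two: "(\<Sum>l\<in>{i, rev_index i}. cnj (?B $ l $ i) * ?B $ l $ j) =
          cnj (?B $ i $ i) * ?B $ i $ j + cnj (?B $ rev_index i $ i) * ?B $ rev_index i $ j" by simp
      consider "j = i" | "j = rev_index i" | "j \<noteq> i" "j \<noteq> rev_index i" by blast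
      then show ?thesis
      proof cases
        case 1
        then show ?thesis unfolding two using False e[of i] e[of "rev_index i"]
          by (auto simp: isotropic_basis_def diag_nth)
      next
        case 2
        have "i < rev_index i \<or> rev_index i < i" using False by (meson linorder_neqE)
        then show ?thesis unfolding two using False 2 e[of i] e[of "rev_index i"]
          by (auto simp: isotropic_basis_def diag_nth)
      next
        case 3
        have "rev_index i \<noteq> rev_index j" "i \<noteq> rev_index j" using 3 by auto
        then show ?thesis unfolding two using 3 by (simp add: isotropic_basis_def diag_nth)
      qed
    qed
    finally show ?thesis .
  qed
  then show ?thesis by (simp add: vec_eq_iff)
qed

definition normalizer :: "'n::{finite,linorder} cmat" where
  "normalizer = diag (\<lambda>j. if j = rev_index j then 1 else of_real (1 / sqrt 2))"

text \<open>
A frame of an isotropic flag in the cell of \<open>w\<close>: the permutation turns \<open>e\<^sub>i \<plusminus> \<i> e\<^bsub>rev i\<^esub>\<close> into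
\<open>e\<^bsub>k\<^sub>i\<^esub> \<plusminus> \<i> e\<^bsub>l\<^sub>i\<^esub>\<close>.
\<close>

definition spaced_frame :: "(nat \<Rightarrow> nat) \<Rightarrow> ('n::{finite,linorder} \<Rightarrow> complex) \<Rightarrow> 'n cmat" where
  "spaced_frame w e = perm_mat w ** isotropic_basis e ** normalizer"

lemma spaced_frame_iso_unitary:
  assumes w: "w permutes {1..CARD('n)}" and e: "\<And>j. cnj (e j) * e j = 1" "\<And>j. cnj (e j) = - e j"
  shows "iso_unitary (spaced_frame w e :: 'n::{finite,linorder} cmat)"
  unfolding iso_unitary_def
proof (intro conjI allI)
  let ?P = "perm_mat w :: 'n cmat" and ?B = "isotropic_basis e :: 'n cmat"
  define r where "r j = (if j = rev_index j then 1 else complex_of_real (1 / sqrt 2))" for j :: 'n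
  have N: "normalizer = diag r" by (simp add: normalizer_def r_def[abs_def])
  have bij: "bij (index_perm w :: 'n \<Rightarrow> 'n)" by (rule bij_index_perm[OF w])
  have PP: "adj ?P ** ?P = mat 1"
  proof -
    have "(adj ?P ** ?P) $ i $ j = mat 1 $ i $ j" for i j
    proof -
      have "(adj ?P ** ?P) $ i $ j = adj ?P $ i $ index_perm w j" by (simp add: monomial_mult_right)
      also have "\<dots> = mat 1 $ i $ j" using bij by (simp add: adj_def monomial_matrix_def mat_def bij_def inj_eq eq_commute)
      finally show ?thesis .
    qed
    then show ?thesis by (simp add: vec_eq_iff)
  qed
  have "adj (spaced_frame w e) ** spaced_frame w e = adj (diag r) ** (adj ?B ** (adj ?P ** ?P) ** ?B) ** diag r"
    by (simp add: spaced_frame_def N adj_mult matrix_mul_assoc)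
  then have eq: "adj (spaced_frame w e) ** spaced_frame w e = adj (diag r) ** diag (\<lambda>j. if j = rev_index j then 1 else 2) ** diag r"
    by (simp add: PP isotropic_basis_gram[OF e(1)])
  have half: "cnj (complex_of_real (1 / sqrt 2)) * 2 * complex_of_real (1 / sqrt 2) = 1"
  proof -
    have "cnj (complex_of_real (1 / sqrt 2)) * 2 * complex_of_real (1 / sqrt 2) = complex_of_real (2 * ((1 / sqrt 2) * (1 / sqrt 2)))"
      by (simp only: complex_cnj_complex_of_real of_real_mult of_real_numeral mult_ac)
    also have "2 * ((1 / sqrt 2) * (1 / sqrt 2)) = (1::real)" by simp
    finally show ?thesis by simp
  qed
  have rr: "cnj (r j) * (if j = rev_index j then 1 else 2) * r j = 1" for j
    using half by (simp only: r_def split: if_split) simp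
  show "adj (spaced_frame w e) ** spaced_frame w e = mat 1"
  proof -
    have "(adj (diag r) ** diag (\<lambda>j. if j = rev_index j then 1 else 2) ** diag r) $ i $ j = mat 1 $ i $ j" for i j
    proof -
      have "(adj (diag r) ** diag (\<lambda>j. if j = rev_index j then 1 else 2) ** diag r) $ i $ j =
          cnj (r i) * (if i = j then if j = rev_index j then 1 else 2 else 0) * r j"
        by (cases "i = j") (simp_all add: diag_right adj_diag diag_nth)
      also have "\<dots> = (if i = j then 1 else 0)"
      proof (cases "i = j")
        case True
        then show ?thesis using rr[of j] by (simp only: simp_thms if_True)
      next
        case False
        then show ?thesis by simp
      qed
      finally show ?thesis by (simp only: mat_def vec_lambda_beta)
    qed
    then show ?thesis unfolding eq by (simp add: vec_eq_iff)
  qed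
  fix i j :: 'n
  obtain k where k: "i = index_perm w k" using bij by (metis bij_pointE)
  have ent: "spaced_frame w e $ i $ l = ?B $ k $ l * r l" for l
    unfolding spaced_frame_def N diag_right k by (simp add: monomial_mult_left[OF bij])
  have "cnj (?B $ k $ j) = ?B $ k $ rev_index j"
    using isotropic_basis_conj[of e k "rev_index j"] e(2) by simp
  moreover have "cnj (r j) = r (rev_index j)" by (auto simp: r_def)
  ultimately show "cnj (spaced_frame w e $ i $ j) = spaced_frame w e $ i $ rev_index j"
    by (simp add: ent)
qed

lemma normalizer_upper: "normalizer \<in> (upper :: 'n::{finite,linorder} cmat set)" "det (normalizer :: 'n cmat) \<noteq> 0"
proof -
  show u: "normalizer \<in> (upper :: 'n cmat set)" by (auto simp: normalizer_def upper_def diag_nth)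
  show "det (normalizer :: 'n cmat) \<noteq> 0" unfolding upper_diag_nz[OF u] by (simp add: normalizer_def diag_nth)
qed

text \<open>
The spacing condition says that the slopes of \<^const>\<open>isotropic_basis\<close> are free coordinates of the cell.
\<close>

lemma spaced_frame_in_cell:
  assumes w: "w permutes {1..CARD('n)}" and sp: "spacing CARD('n) w" and e: "\<And>j. e j \<noteq> 0"
  shows "act (spaced_frame w e) base_flag \<in> (schubert_cell w :: 'n::{finite,linorder} flag set)"
proof -
  let ?n = "CARD('n)"
  have iu: "det (isotropic_upper e :: 'n cmat) \<noteq> 0"
    unfolding upper_diag_nz[OF isotropic_upper_upper] using e by (simp add: isotropic_upper_def)
  have "spaced_frame w e = perm_mat w ** (mat 1 + isotropic_slope e) ** isotropic_upper e ** normalizer"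
    by (simp add: spaced_frame_def isotropic_basis_factor matrix_mul_assoc)
  then have "act (spaced_frame w e) base_flag = chart_at (mat 1 ** perm_mat w) (isotropic_slope e :: 'n cmat)"
    by (simp add: chart_at_def act_mult_upper normalizer_upper isotropic_upper_upper iu)
  moreover have "chart_at (mat 1 ** perm_mat w) (isotropic_slope e :: 'n cmat) \<in> schubert_cell w"
  proof (subst cell_chart[OF w upper_one _ isotropic_slope_lower])
    show "det (mat 1 :: 'n cmat) \<noteq> 0" by (simp add: det_I)
    show "\<forall>i j. (i, j) \<notin> cell_directions w \<longrightarrow> (isotropic_slope e :: 'n cmat) $ i $ j = 0"
    proof (intro allI impI)
      fix i j :: 'n assume nd: "(i, j) \<notin> cell_directions w"
      show "isotropic_slope e $ i $ j = 0"
      proof (rule ccontr)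
        assume "isotropic_slope e $ i $ j \<noteq> 0"
        then have ij: "j < i" "i = rev_index j" by (auto simp: isotropic_slope_def split: if_splits)
        have "pos j < pos i" using ij(1) by simp
        then have "2 * pos j \<le> ?n" using pos_rev_sum[of j] unfolding ij(2) by linarith
        then have "pos j \<le> ?n div 2" by linarith
        then have "pos j \<in> {1..?n div 2}" using pos_ge_1[of j] by simp
        then have "w (?n + 1 - pos j) < w (pos j)"
          using sp by (auto simp: spacing_def entry_l_def entry_k_def)
        then have "pos (index_perm w i) < pos (index_perm w j)"
          by (simp only: pos_index_perm[OF w] ij(2) pos_rev)
        then show False using nd ij(1) by (simp add: cell_directions_def)
      qed
    qed
  qed simp
  ultimately show ?thesis by simp
qed

lemma det_spaced_frame_flip:
  assumes n: "CARD('n) \<ge> 2"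
  shows "det (spaced_frame w (\<lambda>j. if j = idx 1 then - \<i> else \<i>) :: 'n::{finite,linorder} cmat) = - det (spaced_frame w (\<lambda>_. \<i>) :: 'n cmat)"
proof -
  let ?j0 = "rev_index (idx 1) :: 'n"
  have p1: "pos (idx 1 :: 'n) = 1" using n by (intro pos_idx) auto
  have lt: "(idx 1 :: 'n) < ?j0"
  proof -
    have "pos (idx 1 :: 'n) < pos ?j0" using n by (simp only: pos_rev p1)
    then show ?thesis by (simp only: pos_less_iff)
  qed
  define f where "f e j = (if rev_index j < j then - 2 * e (rev_index j) else 1)" for e :: "'n \<Rightarrow> complex" and j :: 'n
  have det: "det (isotropic_basis e :: 'n cmat) = (\<Prod>j\<in>UNIV. f e j)" for e
    unfolding isotropic_basis_factor det_mul det_upper[OF isotropic_upper_upper]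
    by (simp add: unit_lower_det isotropic_slope_lower isotropic_upper_def f_def)
  have rem: "(\<Prod>j\<in>UNIV. f e j) = f e ?j0 * (\<Prod>j\<in>UNIV - {?j0}. f e j)" for e
    by (rule prod.remove) simp_all
  have "(\<Prod>j\<in>UNIV - {?j0}. f (\<lambda>j. if j = idx 1 then - \<i> else \<i>) j) = (\<Prod>j\<in>UNIV - {?j0}. f (\<lambda>_. \<i>) j)"
  proof (rule prod.cong)
    fix j assume "j \<in> UNIV - {?j0}"
    then have "rev_index j \<noteq> idx 1" by (metis DiffD2 insertI1 rev_rev)
    then show "f (\<lambda>j. if j = idx 1 then - \<i> else \<i>) j = f (\<lambda>_. \<i>) j" by (simp add: f_def)
  qed simp
  moreover have "f (\<lambda>j. if j = idx 1 then - \<i> else \<i>) ?j0 = - f (\<lambda>_. \<i>) ?j0" using lt by (simp add: f_def)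
  ultimately have "det (isotropic_basis (\<lambda>j. if j = idx 1 then - \<i> else \<i>) :: 'n cmat) = - det (isotropic_basis (\<lambda>_. \<i>) :: 'n cmat)"
    unfolding det rem by simp
  then show ?thesis unfolding spaced_frame_def det_mul by simp
qed

text \<open>
Two frames with the same behaviour under conjugation differ by a real matrix, and unitary frames by a
unitary one.
\<close>

lemma iso_frames_orthogonal:
  assumes u: "iso_unitary (u :: 'n::{finite,linorder} cmat)" and v: "iso_unitary v"
  shows "conj_mat (v ** adj u) = v ** adj u" "transpose (v ** adj u) ** (v ** adj u) = mat 1"
proof -
  note uD = iso_unitaryD[OF u] and vD = iso_unitaryD[OF v]
  have "conj_mat (v ** adj u) = v ** (rev_mat ** rev_mat) ** adj u"
    by (simp add: conj_mat_mult iso_unitary_transpose(2)[OF v] iso_unitary_transpose(3)[OF u] matrix_mul_assoc)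
  then show real: "conj_mat (v ** adj u) = v ** adj u" by (simp add: rev_mat_sq)
  have "transpose (v ** adj u) ** (v ** adj u) = adj (v ** adj u) ** (v ** adj u)"
    by (simp only: adj_real[OF real])
  also have "\<dots> = u ** (adj v ** v) ** adj u" by (simp add: adj_mult matrix_mul_assoc)
  finally show "transpose (v ** adj u) ** (v ** adj u) = mat 1" by (simp add: uD vD)
qed

lemma spacing_cell_meets_base_cycle:
  fixes C\<^sub>0 D :: "'n::{finite,linorder} flag set"
  assumes n: "CARD('n) \<ge> 2" and w: "w permutes {1..CARD('n)}" and sp: "spacing CARD('n) w"
    and D: "open_orbit D" and C0: "C\<^sub>0 = orbit SO_R F" "C\<^sub>0 \<subseteq> D" and sub: "complex_submanifold d C\<^sub>0"
    and p: "p \<in> C\<^sub>0"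
  shows "schubert_cell w \<inter> C\<^sub>0 \<noteq> {}"
proof -
  obtain u where u: "iso_unitary u" "act u base_flag = p" by (rule base_cycle_iso_frame[OF D C0 sub p])
  note uD = iso_unitaryD[OF u(1)]
  have hit: "schubert_cell w \<inter> C\<^sub>0 \<noteq> {}"
    if e: "\<And>j. cnj (e j) * e j = 1" "\<And>j. cnj (e j) = - e j" and det: "det (spaced_frame w e ** adj u) = 1" for e :: "'n \<Rightarrow> complex"
  proof -
    let ?v = "spaced_frame w e"
    have v: "iso_unitary ?v" by (rule spaced_frame_iso_unitary[OF w e])
    note orth = iso_frames_orthogonal[OF u(1) v]
    have "(?v ** adj u) $ i $ j \<in> \<real>" for i j
      using arg_cong[OF orth(1), of "\<lambda>M. M $ i $ j"] by (simp add: conj_mat_def Reals_cnj_iff)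
    then have "?v ** adj u \<in> SO_R" using det orth(2) by (simp add: SO_R_def SL_R_def SL_C_def)
    then have "act (?v ** adj u) p \<in> C\<^sub>0" using orbit_SO_R_trans p C0(1) by blast
    moreover have "act (?v ** adj u) p = act ?v base_flag"
    proof -
      have "act (?v ** adj u) p = act (?v ** (adj u ** u)) base_flag" by (simp add: u(2)[symmetric] act_act matrix_mul_assoc)
      then show ?thesis by (simp add: uD)
    qed
    moreover have "e j \<noteq> 0" for j using e(1)[of j] by auto
    then have "act ?v base_flag \<in> schubert_cell w" by (rule spaced_frame_in_cell[OF w sp])
    ultimately show ?thesis by auto
  qed
  \<comment> \<open>Flipping one sign changes the sign of the determinant, so one of the two frames is reached from \<open>u\<close> by a rotation.\<close>
  let ?e1 = "\<lambda>_::'n. \<i>" and ?e2 = "\<lambda>j::'n. if j = idx 1 then - \<i> else \<i>"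
  have e1: "cnj (?e1 j) * ?e1 j = 1" "cnj (?e1 j) = - ?e1 j" for j by simp_all
  have e2: "cnj (?e2 j) * ?e2 j = 1" "cnj (?e2 j) = - ?e2 j" for j by simp_all
  let ?O = "spaced_frame w ?e1 ** adj u"
  have "det ?O * det ?O = 1"
    using arg_cong[OF iso_frames_orthogonal(2)[OF u(1) spaced_frame_iso_unitary[OF w e1]], of det]
    by (simp add: det_mul det_transpose det_I)
  then have "det ?O = 1 \<or> det ?O = - 1" by (simp add: square_eq_1_iff)
  then show ?thesis
  proof
    assume "det ?O = 1" then show ?thesis by (rule hit[OF e1])
  next
    assume "det ?O = - 1"
    then have "det (spaced_frame w ?e2 ** adj u) = 1"
      by (simp only: det_mul det_spaced_frame_flip[OF n] mult_minus_left) simp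
    then show ?thesis by (rule hit[OF e2])
  qed
qed

lemma SO_R_orbit_subset:
  assumes "F' \<in> orbit SL_R F"
  shows "orbit SO_R F' \<subseteq> orbit SL_R F"
proof
  fix p assume "p \<in> orbit SO_R F'"
  then obtain h where h: "h \<in> SO_R" "p = act h F'" by (auto simp: orbit_def)
  obtain k where k: "k \<in> SL_R" "F' = act k F" using assms by (auto simp: orbit_def)
  have "(h ** k) $ i $ j \<in> \<real>" for i j
    using h k by (auto simp: SO_R_def SL_R_def matrix_matrix_mult_def intro!: sum_in_Reals Reals_mult)
  then have "h ** k \<in> SL_R" using h k by (simp add: SO_R_def SL_R_def SL_C_def det_mul)
  moreover have "p = act (h ** k) F" by (simp add: h k act_act)
  ultimately show "p \<in> orbit SL_R F" unfolding orbit_def by blast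
qed

theorem theorem8:
  fixes D C\<^sub>0 :: "'n::{finite,linorder} flag set" and w :: "nat \<Rightarrow> nat" and n m :: nat
  assumes "n = CARD('n)" and "n \<ge> 2" and "m = n div 2"
    and "open_orbit D" and "base_cycle D C\<^sub>0"
    and "w permutes {1..n}"
  shows "(schubert_variety w \<in> schubert_duals C\<^sub>0 \<longleftrightarrow> double_box_contraction n w) \<and>
         (schubert_variety w \<in> schubert_duals C\<^sub>0 \<longrightarrow>
            spacing n w \<and>
            (n = 2 * m \<longrightarrow> inversions n w = m\<^sup>2) \<and>
            (n = 2 * m + 1 \<longrightarrow> inversions n w = m\<^sup>2 + m))"
proof -
  note n = assms(1,2) and m = assms(3) and D = assms(4)
  have w: "w permutes {1..CARD('n)}" using assms(6) n(1) by simp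
  obtain F d where F: "F \<in> D" and C0: "C\<^sub>0 = orbit SO_R F" and sub: "complex_submanifold d C\<^sub>0"
    using assms(5) unfolding base_cycle_def by blast
  have C0D: "C\<^sub>0 \<subseteq> D"
  proof -
    obtain F' where "D = orbit SL_R F'" using D unfolding open_orbit_def by blast
    then show ?thesis using SO_R_orbit_subset[of F F'] F C0 by simp
  qed
  have FC0: "F \<in> C\<^sub>0"
  proof -
    have "(mat 1 :: 'n cmat) $ i $ j \<in> \<real>" for i j by (simp add: mat_def)
    then have "mat 1 \<in> (SO_R :: 'n cmat set)" by (simp add: SO_R_def SL_R_def SL_C_def det_I transpose_mat)
    then show ?thesis unfolding C0 orbit_def by (metis act_one image_eqI)
  qed
  have cC0: "cdim C\<^sub>0 = card (isotropic_entries :: ('n \<times> 'n) set)"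
    by (rule cdim_base_cycle[OF D C0 C0D sub FC0])
  have cZ: "cdim (flags :: 'n flag set) = card {(i::'n, j::'n). j < i}"
    using cdim_submanifold[OF flags_submanifold] prefix_space_flags by blast
  have dims: "cdim (schubert_variety w :: 'n flag set) + cdim C\<^sub>0 = cdim (flags :: 'n flag set) \<longleftrightarrow>
      inversions n w = m * (n - m)"
    unfolding cC0 cZ cdim_schubert_variety[OF w] dimension_balance by (simp add: n(1) m)
  have forward: "double_box_contraction n w" if S: "schubert_variety w \<in> schubert_duals C\<^sub>0"
  proof -
    have len: "inversions n w = n div 2 * (n - n div 2)" and meet: "schubert_variety w \<inter> C\<^sub>0 \<noteq> {}"
      using S dims m by (auto simp: schubert_duals_def)
    obtain q where q: "q \<in> schubert_variety w" "q \<in> D" using meet C0D by blast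
    have "openin flag_topology D" using D by (simp add: open_orbit_def)
    then have cellD: "schubert_cell w \<inter> D \<noteq> {}"
      using q unfolding schubert_variety_def in_closure_of by blast
    show ?thesis
    proof (rule minimal_length_double_box_contraction[OF assms(6) _ len])
      fix r q assume "r \<le> n div 2" "q \<le> n"
      then show "card {i\<in>{1..r}. w i \<le> q} \<le> card {i\<in>{1..r}. w (n + 1 - i) \<le> q}"
        using open_orbit_dominance[OF D w cellD, of r q] n(1) by simp
    qed
  qed
  have backward: "schubert_variety w \<in> schubert_duals C\<^sub>0" if c: "double_box_contraction n w"
  proof -
    have "spacing CARD('n) w" using double_box_contraction_spacing[OF assms(6) c] n(1) by simp
    then have "schubert_cell w \<inter> C\<^sub>0 \<noteq> {}"
      using n by (intro spacing_cell_meets_base_cycle[OF _ w _ D C0 C0D sub FC0]) simp_all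
    then have "schubert_variety w \<inter> C\<^sub>0 \<noteq> {}" using schubert_cell_subset_variety[OF w] by blast
    moreover have "inversions n w = m * (n - m)"
      using double_box_contraction_inversions[OF assms(6) c] m by simp
    ultimately show ?thesis using dims w by (auto simp: schubert_duals_def)
  qed
  have lens: "(n = 2 * m \<longrightarrow> inversions n w = m\<^sup>2) \<and> (n = 2 * m + 1 \<longrightarrow> inversions n w = m\<^sup>2 + m)"
    if c: "double_box_contraction n w"
  proof -
    have len: "inversions n w = m * (n - m)"
      using double_box_contraction_inversions[OF assms(6) c] m by simp
    show ?thesis
    proof (intro conjI impI)
      assume "n = 2 * m"
      then have "n - m = m" by simp
      then show "inversions n w = m\<^sup>2" using len by (simp only: power2_eq_square)
    next
      assume "n = 2 * m + 1"
      then have "n - m = m + 1" by simp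
      then show "inversions n w = m\<^sup>2 + m" using len by (simp only: power2_eq_square distrib_left mult_1_right)
    qed
  qed
  show ?thesis
    using forward backward lens double_box_contraction_spacing[OF assms(6)] by blast
qed

end
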